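(* Let $\kappa$ be a weakly compact cardinal ($\kappa=\omega$ allowed), $B$ a $\kappa$-coherent Boolean algebra, $\mathcal{C}$ a $\kappa$-coherent category with $\kappa$-small disjoint coproducts, and $M:\mathcal{C}\to Sh(B,\tau_{\kappa-coh})$ a $\kappa$-coherent functor. Then the following are equivalent: 1. $M$ is strongly positively closed. 2. $L^1(\Gamma M)$ is a Boolean algebra. 3. $L^1(\Gamma M)\cong B$.
   Context: $\kappa$-small means of cardinality $<\kappa$. The category $\mathcal{C}$ is small. A category is $\kappa$-coherent if (i) it has $\kappa$-small limits; (ii) every morphism factors as an effective epimorphism followed by a monomorphism, stably under pullback; (iii) every $\kappa$-small (possibly empty) family of subobjects of an object has a union, stable under pullback; (iv) $\kappa$-small effective epimorphic families are closed under transfinite composition of length $<\kappa$: given a rooted tree of objects $x_t$, all of whose maximal branches have a common length $\gamma<\kappa$, with maps $x_t\to x_s$ for $s\le t$, such that for each non-maximal node $t$ the maps into $x_t$ from its immediate successors form a $\kappa$-small effective epimorphic family and such that at limit levels each branch has a unique continuation $t$, with $x_t=\lim_{s<t}x_s$, the family of maps $\lim_{t\in \text{branch}}x_t\to x_{root}$ over all maximal branches is effective epimorphic. (A family $(x_i\to x)_i$ is effective epimorphic if the union of the images is $x$.) For $\kappa=\omega$ this is the usual notion of coherent category. A functor is $\kappa$-coherent if it preserves $\kappa$-small limits, effective epimorphisms and $\kappa$-small unions. A lattice is $\kappa$-coherent if it is so as a category. $\tau_{\kappa-coh}$ is the topology on $B$ whose covers of $b$ are the $\kappa$-small families $(b_i\leq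 b)_i$ with $\bigvee_i b_i=b$ (including the empty cover of $\bot$). $M$ is strongly positively closed if for every mono $u\hookrightarrow x$ in $\mathcal{C}$, $Mx=Mu\cup\bigcup_{v\hookrightarrow x:\ v\cap u=\emptyset}Mv$ (union of subobjects in $Sh(B,\tau_{\kappa-coh})$). $\Gamma M:\mathcal{C}\to\mathbf{Set}$ is $x\mapsto Mx(\top)$ (global sections). For a finite-limit-preserving $F:\mathcal{C}\to\mathbf{Set}$, let $\int F$ be its category of elements (objects $(x,a)$ with $a\in Fx$; morphisms $(x,a)\to(y,b)$ are $f:x\to y$ with $Ff(a)=b$). $L^1(F)$ is the filtered colimit of distributive lattices $L^1(F)=\mathrm{colim}_{(x,a)\in(\int F)^{op}}Sub_{\mathcal{C}}(x)$, with transition maps given by pullback of subobjects. *)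

theory Defs
  imports "HOL-Algebra.Lattice" "HOL-Library.FuncSet"
begin

unbundle cardinal_syntax

section \<open>Categories, functors and limits\<close>

record ('o, 'm) cat =
  Obj :: "'o set"
  Arr :: "'m set"
  Dom :: "'m \<Rightarrow> 'o"
  Cod :: "'m \<Rightarrow> 'o"
  Ident :: "'o \<Rightarrow> 'm"
  Comp :: "'m \<Rightarrow> 'm \<Rightarrow> 'm" (infixl \<open>\<cdot>\<index>\<close> 70)

definition hom :: "('o, 'm) cat \<Rightarrow> 'o \<Rightarrow> 'o \<Rightarrow> 'm set" where
  "hom C x y = {f \<in> Arr C. Dom C f = x \<and> Cod C f = y}"

text \<open>Every category here is small: objects and arrows form sets. The composite \<open>g \<cdot> f\<close> is
  "\<open>g\<close> after \<open>f\<close>".\<close>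

locale category =
  fixes C :: "('o, 'm) cat" (structure)
  assumes Dom_in: "f \<in> Arr C \<Longrightarrow> Dom C f \<in> Obj C"
    and Cod_in: "f \<in> Arr C \<Longrightarrow> Cod C f \<in> Obj C"
    and Ident_in: "x \<in> Obj C \<Longrightarrow> Ident C x \<in> hom C x x"
    and Comp_in: "f \<in> hom C x y \<Longrightarrow> g \<in> hom C y z \<Longrightarrow> g \<cdot> f \<in> hom C x z"
    and Comp_Ident: "f \<in> hom C x y \<Longrightarrow> f \<cdot> Ident C x = f"
    and Ident_Comp: "f \<in> hom C x y \<Longrightarrow> Ident C y \<cdot> f = f"
    and Comp_assoc: "f \<in> hom C w x \<Longrightarrow> g \<in> hom C x y \<Longrightarrow> h \<in> hom C y z \<Longrightarrow>
      (h \<cdot> g) \<cdot> f = h \<cdot> (g \<cdot> f)"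

definition op_cat :: "('o, 'm) cat \<Rightarrow> ('o, 'm) cat" where
  "op_cat C = \<lparr>Obj = Obj C, Arr = Arr C, Dom = Cod C, Cod = Dom C, Ident = Ident C,
    Comp = (\<lambda>g f. f \<cdot>\<^bsub>C\<^esub> g)\<rparr>"

text \<open>The preordered set \<open>(A, R)\<close> as a category: an arrow \<open>a \<rightarrow> b\<close> is the pair \<open>(a, b) \<in> R\<close>.\<close>

definition preorder_cat :: "'a set \<Rightarrow> 'a rel \<Rightarrow> ('a, 'a \<times> 'a) cat" where
  "preorder_cat A R = \<lparr>Obj = A, Arr = Restr R A, Dom = fst, Cod = snd, Ident = (\<lambda>a. (a, a)),
    Comp = (\<lambda>g f. (fst f, snd g))\<rparr>"

definition order_cat :: "('b::order, 'b \<times> 'b) cat" where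
  "order_cat = preorder_cat UNIV {(a, b). a \<le> b}"

record ('j, 'u, 'o, 'm) fctr =
  fobj :: "'j \<Rightarrow> 'o"
  farr :: "'u \<Rightarrow> 'm"

definition is_functor :: "('j, 'u) cat \<Rightarrow> ('o, 'm) cat \<Rightarrow> ('j, 'u, 'o, 'm) fctr \<Rightarrow> bool" where
  "is_functor J C F \<longleftrightarrow> category J \<and> category C \<and>
    (\<forall>i\<in>Obj J. fobj F i \<in> Obj C) \<and>
    (\<forall>u\<in>Arr J. farr F u \<in> hom C (fobj F (Dom J u)) (fobj F (Cod J u))) \<and>
    (\<forall>i\<in>Obj J. farr F (Ident J i) = Ident C (fobj F i)) \<and>
    (\<forall>u\<in>Arr J. \<forall>v\<in>Arr J. Cod J u = Dom J v \<longrightarrow>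
      farr F (v \<cdot>\<^bsub>J\<^esub> u) = farr F v \<cdot>\<^bsub>C\<^esub> farr F u)"

definition fctr_comp ::
  "('o, 'm, 'p, 'n) fctr \<Rightarrow> ('j, 'u, 'o, 'm) fctr \<Rightarrow> ('j, 'u, 'p, 'n) fctr" where
  "fctr_comp G F = \<lparr>fobj = fobj G \<circ> fobj F, farr = farr G \<circ> farr F\<rparr>"

definition is_cone ::
  "('o, 'm) cat \<Rightarrow> ('j, 'u) cat \<Rightarrow> ('j, 'u, 'o, 'm) fctr \<Rightarrow> 'o \<Rightarrow> ('j \<Rightarrow> 'm) \<Rightarrow> bool" where
  "is_cone C J D c \<pi> \<longleftrightarrow> c \<in> Obj C \<and> (\<forall>j\<in>Obj J. \<pi> j \<in> hom C c (fobj D j)) \<and>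
    (\<forall>u\<in>Arr J. farr D u \<cdot>\<^bsub>C\<^esub> \<pi> (Dom J u) = \<pi> (Cod J u))"

definition is_limit ::
  "('o, 'm) cat \<Rightarrow> ('j, 'u) cat \<Rightarrow> ('j, 'u, 'o, 'm) fctr \<Rightarrow> 'o \<Rightarrow> ('j \<Rightarrow> 'm) \<Rightarrow> bool" where
  "is_limit C J D c \<pi> \<longleftrightarrow> is_cone C J D c \<pi> \<and>
    (\<forall>c' \<pi>'. is_cone C J D c' \<pi>' \<longrightarrow>
      (\<exists>!h. h \<in> hom C c' c \<and> (\<forall>j\<in>Obj J. \<pi> j \<cdot>\<^bsub>C\<^esub> h = \<pi>' j)))"

text \<open>A cardinal is given by a cardinal order \<open>\<kappa> :: 'k rel\<close>. Every category with \<open>\<kappa>\<close>-small sets of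
  objects and arrows is isomorphic to one with objects and arrows in \<open>'k\<close>, so diagram shapes
  (and index sets of coproducts) may be taken in \<open>'k\<close>. The objects embed in the arrows via
  identities, so smallness need only be required of the arrows.\<close>

definition has_small_limits :: "'k rel \<Rightarrow> ('o, 'm) cat \<Rightarrow> bool" where
  "has_small_limits \<kappa> C \<longleftrightarrow>
    (\<forall>(J :: ('k, 'k) cat) D. is_functor J C D \<and> |Arr J| <o \<kappa> \<longrightarrow> (\<exists>c \<pi>. is_limit C J D c \<pi>))"

text \<open>\<open>is_pullback C f g p q\<close>: the square \<open>f \<cdot> p = g \<cdot> q\<close> is cartesian; in particular \<open>p\<close> is a
  pullback of \<open>g\<close> along \<open>f\<close>.\<close>

definition is_commuting_square :: "('o, 'm) cat \<Rightarrow> 'm \<Rightarrow> 'm \<Rightarrow> 'm \<Rightarrow> 'm \<Rightarrow> bool" where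
  "is_commuting_square C f g p q \<longleftrightarrow> {f, g, p, q} \<subseteq> Arr C \<and> Cod C f = Cod C g \<and>
    Dom C p = Dom C q \<and> Cod C p = Dom C f \<and> Cod C q = Dom C g \<and> f \<cdot>\<^bsub>C\<^esub> p = g \<cdot>\<^bsub>C\<^esub> q"

definition is_pullback :: "('o, 'm) cat \<Rightarrow> 'm \<Rightarrow> 'm \<Rightarrow> 'm \<Rightarrow> 'm \<Rightarrow> bool" where
  "is_pullback C f g p q \<longleftrightarrow> is_commuting_square C f g p q \<and>
    (\<forall>p' q'. is_commuting_square C f g p' q' \<longrightarrow>
      (\<exists>!h. h \<in> hom C (Dom C p') (Dom C p) \<and> p \<cdot>\<^bsub>C\<^esub> h = p' \<and> q \<cdot>\<^bsub>C\<^esub> h = q'))"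

definition is_initial :: "('o, 'm) cat \<Rightarrow> 'o \<Rightarrow> bool" where
  "is_initial C x \<longleftrightarrow> x \<in> Obj C \<and> (\<forall>y\<in>Obj C. \<exists>!f. f \<in> hom C x y)"

definition is_coproduct ::
  "('o, 'm) cat \<Rightarrow> 'i set \<Rightarrow> ('i \<Rightarrow> 'o) \<Rightarrow> 'o \<Rightarrow> ('i \<Rightarrow> 'm) \<Rightarrow> bool" where
  "is_coproduct C I X c \<iota> \<longleftrightarrow> c \<in> Obj C \<and> (\<forall>i\<in>I. \<iota> i \<in> hom C (X i) c) \<and>
    (\<forall>y\<in>Obj C. \<forall>g. (\<forall>i\<in>I. g i \<in> hom C (X i) y) \<longrightarrow>
      (\<exists>!h. h \<in> hom C c y \<and> (\<forall>i\<in>I. h \<cdot>\<^bsub>C\<^esub> \<iota> i = g i)))"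


section \<open>Subobjects, effective epimorphisms, unions\<close>

definition is_mono :: "('o, 'm) cat \<Rightarrow> 'm \<Rightarrow> bool" where
  "is_mono C m \<longleftrightarrow> m \<in> Arr C \<and>
    (\<forall>z g h. g \<in> hom C z (Dom C m) \<and> h \<in> hom C z (Dom C m) \<and> m \<cdot>\<^bsub>C\<^esub> g = m \<cdot>\<^bsub>C\<^esub> h \<longrightarrow> g = h)"

definition monos_into :: "('o, 'm) cat \<Rightarrow> 'o \<Rightarrow> 'm set" where
  "monos_into C x = {m. is_mono C m \<and> Cod C m = x}"

definition sub_le :: "('o, 'm) cat \<Rightarrow> 'm \<Rightarrow> 'm \<Rightarrow> bool" where
  "sub_le C m n \<longleftrightarrow> (\<exists>h \<in> hom C (Dom C m) (Dom C n). n \<cdot>\<^bsub>C\<^esub> h = m)"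

text \<open>The poset of subobjects of \<open>x\<close>: monomorphisms into \<open>x\<close> modulo mutual factorization.\<close>

definition Sub :: "('o, 'm) cat \<Rightarrow> 'o \<Rightarrow> 'm set gorder" where
  "Sub C x = \<lparr>carrier = monos_into C x //
      {(m, n). m \<in> monos_into C x \<and> n \<in> monos_into C x \<and> sub_le C m n \<and> sub_le C n m},
    eq = (=), le = (\<lambda>U V. \<exists>m\<in>U. \<exists>n\<in>V. sub_le C m n)\<rparr>"

text \<open>All pullbacks of members of \<open>S\<close> along \<open>f\<close>. If \<open>S\<close> is the class of a mono, this is the class of
  its pullback, so this is also the transition map between subobject posets.\<close>

definition pullbacks_along :: "('o, 'm) cat \<Rightarrow> 'm \<Rightarrow> 'm set \<Rightarrow> 'm set" where
  "pullbacks_along C f S = {n. \<exists>m\<in>S. \<exists>q. is_pullback C f m n q}"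

text \<open>The mono \<open>m\<close> represents the union (least upper bound) of the subobjects of \<open>x\<close> represented
  by the members of \<open>S\<close>.\<close>

definition is_union :: "('o, 'm) cat \<Rightarrow> 'o \<Rightarrow> 'm set \<Rightarrow> 'm \<Rightarrow> bool" where
  "is_union C x S m \<longleftrightarrow> S \<subseteq> monos_into C x \<and> m \<in> monos_into C x \<and> (\<forall>s\<in>S. sub_le C s m) \<and>
    (\<forall>n\<in>monos_into C x. (\<forall>s\<in>S. sub_le C s n) \<longrightarrow> sub_le C m n)"

text \<open>\<open>u \<inter> v = \<emptyset>\<close>: the pullback of \<open>u\<close> and \<open>v\<close> is the empty union of subobjects of \<open>x\<close>.\<close>

definition sub_disjoint :: "('o, 'm) cat \<Rightarrow> 'o \<Rightarrow> 'm \<Rightarrow> 'm \<Rightarrow> bool" where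
  "sub_disjoint C x u v \<longleftrightarrow> (\<exists>p q. is_pullback C u v p q \<and> is_union C x {} (u \<cdot>\<^bsub>C\<^esub> p))"

text \<open>An effective epimorphism is a coequalizer of its kernel pair.\<close>

definition is_coequalizer :: "('o, 'm) cat \<Rightarrow> 'm \<Rightarrow> 'm \<Rightarrow> 'm \<Rightarrow> bool" where
  "is_coequalizer C p q e \<longleftrightarrow> {p, q, e} \<subseteq> Arr C \<and> Dom C p = Dom C q \<and> Cod C p = Dom C e \<and>
    Cod C q = Dom C e \<and> e \<cdot>\<^bsub>C\<^esub> p = e \<cdot>\<^bsub>C\<^esub> q \<and>
    (\<forall>z. \<forall>g\<in>hom C (Dom C e) z. g \<cdot>\<^bsub>C\<^esub> p = g \<cdot>\<^bsub>C\<^esub> q \<longrightarrow>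
      (\<exists>!h. h \<in> hom C (Cod C e) z \<and> h \<cdot>\<^bsub>C\<^esub> e = g))"

definition is_eff_epi :: "('o, 'm) cat \<Rightarrow> 'm \<Rightarrow> bool" where
  "is_eff_epi C e \<longleftrightarrow> (\<exists>p q. is_pullback C e e p q \<and> is_coequalizer C p q e)"

text \<open>The mono \<open>m\<close> represents the image of \<open>f\<close>.\<close>

definition is_image :: "('o, 'm) cat \<Rightarrow> 'm \<Rightarrow> 'm \<Rightarrow> bool" where
  "is_image C f m \<longleftrightarrow> is_mono C m \<and>
    (\<exists>e \<in> hom C (Dom C f) (Dom C m). is_eff_epi C e \<and> m \<cdot>\<^bsub>C\<^esub> e = f)"

definition is_eff_epi_family :: "('o, 'm) cat \<Rightarrow> 'o \<Rightarrow> 'm set \<Rightarrow> bool" where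
  "is_eff_epi_family C x S \<longleftrightarrow> (\<forall>f\<in>S. f \<in> Arr C \<and> Cod C f = x \<and> (\<exists>m. is_image C f m)) \<and>
    is_union C x {m. \<exists>f\<in>S. is_image C f m} (Ident C x)"


section \<open>Trees and weakly compact cardinals\<close>

text \<open>\<open>R\<close> is the reflexive order of the tree, with the root (if any) at the bottom.\<close>

definition is_tree :: "'n set \<Rightarrow> 'n rel \<Rightarrow> bool" where
  "is_tree T R \<longleftrightarrow> partial_order_on T R \<and>
    (\<forall>t\<in>T. well_order_on (underS R t) (Restr R (underS R t)))"

definition is_chain :: "'n set \<Rightarrow> 'n rel \<Rightarrow> 'n set \<Rightarrow> bool" where
  "is_chain T R b \<longleftrightarrow> b \<subseteq> T \<and> (\<forall>s\<in>b. \<forall>t\<in>b. (s, t) \<in> R \<or> (t, s) \<in> R)"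

definition branches :: "'n set \<Rightarrow> 'n rel \<Rightarrow> 'n set set" where
  "branches T R = {b. is_chain T R b \<and> (\<forall>b'. is_chain T R b' \<and> b \<subseteq> b' \<longrightarrow> b' = b)}"

definition immediate_succs :: "'n set \<Rightarrow> 'n rel \<Rightarrow> 'n \<Rightarrow> 'n set" where
  "immediate_succs T R t = {s\<in>T. t \<in> underS R s \<and> \<not> (\<exists>r. t \<in> underS R r \<and> r \<in> underS R s)}"

text \<open>A nonempty set \<open>c\<close> of nodes without greatest element; for \<open>c\<close> a downward closed chain this says
  that its length is a limit ordinal.\<close>

definition no_greatest :: "'n rel \<Rightarrow> 'n set \<Rightarrow> bool" where
  "no_greatest R c \<longleftrightarrow> c \<noteq> {} \<and> (\<forall>s\<in>c. \<exists>t\<in>c. (t, s) \<notin> R)"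

text \<open>Tree property: a tree of height \<open>\<kappa>\<close> all of whose levels are \<open>\<kappa>\<close>-small has a branch of
  length \<open>\<kappa>\<close>. Such a tree has \<open>\<kappa>\<close> nodes (\<open>\<kappa>\<close> regular), so nodes may be taken in \<open>'k\<close>.
  The ordinals below \<open>\<kappa>\<close> are the order types of the proper initial segments \<open>underS \<kappa> a\<close>.\<close>

definition tree_level :: "'k rel \<Rightarrow> 'n set \<Rightarrow> 'n rel \<Rightarrow> 'k \<Rightarrow> 'n set" where
  "tree_level \<kappa> T R a = {t\<in>T. Restr R (underS R t) =o Restr \<kappa> (underS \<kappa> a)}"

definition tree_property :: "'k rel \<Rightarrow> bool" where
  "tree_property \<kappa> \<longleftrightarrow> (\<forall>(T :: 'k set) R.
    is_tree T R \<and> (\<forall>t\<in>T. Restr R (underS R t) <o \<kappa>) \<and>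
    (\<forall>a\<in>Field \<kappa>. tree_level \<kappa> T R a \<noteq> {} \<and> |tree_level \<kappa> T R a| <o \<kappa>) \<longrightarrow>
    (\<exists>b\<in>branches T R. Restr R b =o \<kappa>))"

text \<open>Inaccessible with the tree property, except that uncountability is not demanded, so that
  \<open>\<omega>\<close> is included.\<close>

definition weakly_compact :: "'k rel \<Rightarrow> bool" where
  "weakly_compact \<kappa> \<longleftrightarrow> Cinfinite \<kappa> \<and> regularCard \<kappa> \<and>
    (\<forall>A :: 'k set. |A| <o \<kappa> \<longrightarrow> |Pow A| <o \<kappa>) \<and> tree_property \<kappa>"


section \<open>\<open>\<kappa>\<close>-coherent categories and functors\<close>

text \<open>The data in the transfinite composition axiom: a functor \<open>X\<close> from the opposite of a rooted
  tree to \<open>C\<close>; the arrow \<open>(t, s)\<close> of \<open>preorder_cat T (R\<inverse>)\<close>, for \<open>s \<le> t\<close>, is sent to the map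
  \<open>x\<^sub>t \<rightarrow> x\<^sub>s\<close>.\<close>

definition is_covering_tree :: "'k rel \<Rightarrow> ('o, 'm) cat \<Rightarrow> 'n set \<Rightarrow> 'n rel \<Rightarrow> 'n \<Rightarrow>
    ('n, 'n \<times> 'n, 'o, 'm) fctr \<Rightarrow> bool" where
  "is_covering_tree \<kappa> C T R r X \<longleftrightarrow>
    is_tree T R \<and> r \<in> T \<and> (\<forall>t\<in>T. (r, t) \<in> R) \<and>
    (\<exists>\<gamma> :: 'k rel. \<gamma> <o \<kappa> \<and> (\<forall>b\<in>branches T R. Restr R b =o \<gamma>)) \<and>
    is_functor (preorder_cat T (R\<inverse>)) C X \<and>
    (\<forall>t\<in>T. (\<exists>s\<in>T. t \<in> underS R s) \<longrightarrow>
      |immediate_succs T R t| <o \<kappa> \<and>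
      is_eff_epi_family C (fobj X t) ((\<lambda>s. farr X (s, t)) ` immediate_succs T R t)) \<and>
    (\<forall>c. is_chain T R c \<and> (\<forall>s\<in>c. underS R s \<subseteq> c) \<and> no_greatest R c \<and> c \<notin> branches T R \<longrightarrow>
      (\<exists>!t. t \<in> T \<and> underS R t = c)) \<and>
    (\<forall>t\<in>T. no_greatest R (underS R t) \<longrightarrow>
      is_limit C (preorder_cat (underS R t) (R\<inverse>)) X (fobj X t) (\<lambda>s. farr X (t, s)))"

text \<open>A tree of height \<open>< \<kappa>\<close> with \<open>\<kappa>\<close>-small branching has at most \<open>2\<^sup>\<kappa>\<close> nodes, so nodes may be
  taken in the type \<open>'k set\<close>.\<close>

definition transfinite_composition :: "'k rel \<Rightarrow> ('o, 'm) cat \<Rightarrow> bool" where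
  "transfinite_composition \<kappa> C \<longleftrightarrow>
    (\<forall>(T :: 'k set set) R r X c \<pi>. is_covering_tree \<kappa> C T R r X \<and>
      (\<forall>b\<in>branches T R. is_limit C (preorder_cat b (R\<inverse>)) X (c b) (\<pi> b)) \<longrightarrow>
      is_eff_epi_family C (fobj X r) ((\<lambda>b. \<pi> b r) ` branches T R))"

definition kcoherent :: "'k rel \<Rightarrow> ('o, 'm) cat \<Rightarrow> bool" where
  "kcoherent \<kappa> C \<longleftrightarrow> category C \<and>
    has_small_limits \<kappa> C \<and>
    (\<forall>f\<in>Arr C. \<exists>m. is_image C f m) \<and>
    (\<forall>f e e' q. is_eff_epi C e \<and> is_pullback C f e e' q \<longrightarrow> is_eff_epi C e') \<and>
    (\<forall>x\<in>Obj C. \<forall>S. S \<subseteq> monos_into C x \<and> |S| <o \<kappa> \<longrightarrow>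
      (\<exists>m. is_union C x S m) \<and>
      (\<forall>m f m' q. is_union C x S m \<and> is_pullback C f m m' q \<longrightarrow>
        is_union C (Dom C f) (pullbacks_along C f S) m')) \<and>
    transfinite_composition \<kappa> C"

definition kcoherent_functor ::
  "'k rel \<Rightarrow> ('o, 'm) cat \<Rightarrow> ('p, 'n) cat \<Rightarrow> ('o, 'm, 'p, 'n) fctr \<Rightarrow> bool" where
  "kcoherent_functor \<kappa> C D M \<longleftrightarrow> is_functor C D M \<and>
    (\<forall>(J :: ('k, 'k) cat) F c \<pi>. is_functor J C F \<and> |Arr J| <o \<kappa> \<and> is_limit C J F c \<pi> \<longrightarrow>
      is_limit D J (fctr_comp M F) (fobj M c) (\<lambda>j. farr M (\<pi> j))) \<and>
    (\<forall>e. is_eff_epi C e \<longrightarrow> is_eff_epi D (farr M e)) \<and>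
    (\<forall>x\<in>Obj C. \<forall>S m. |S| <o \<kappa> \<and> is_union C x S m \<longrightarrow>
      is_union D (fobj M x) (farr M ` S) (farr M m))"

definition has_small_disjoint_coproducts :: "'k rel \<Rightarrow> ('o, 'm) cat \<Rightarrow> bool" where
  "has_small_disjoint_coproducts \<kappa> C \<longleftrightarrow>
    (\<forall>(I :: 'k set) X. |I| <o \<kappa> \<and> (\<forall>i\<in>I. X i \<in> Obj C) \<longrightarrow>
      (\<exists>c \<iota>. is_coproduct C I X c \<iota> \<and> (\<forall>i\<in>I. is_mono C (\<iota> i)) \<and>
        (\<forall>i\<in>I. \<forall>j\<in>I. i \<noteq> j \<longrightarrow>
          (\<forall>p q. is_pullback C (\<iota> i) (\<iota> j) p q \<longrightarrow> is_initial C (Dom C p)))))"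


section \<open>Sheaves for the \<open>\<kappa>\<close>-coherent topology\<close>

text \<open>Presheaves on the poset \<open>'b\<close> with sections in an arbitrary type \<open>'s\<close>. Representable sheaves
  and subsheaves exist for every \<open>'s\<close>, so limits and unions formed in the category of
  \<open>'s\<close>-valued sheaves are those of sheaves of arbitrary sets; so are effective epimorphisms whose
  kernel pair is \<open>'s\<close>-valued, e.g. images of effective epimorphisms under limit-preserving
  functors. \<open>res F b c\<close> is restriction from \<open>b\<close> to
  \<open>c \<le> b\<close>. Values of \<open>res\<close> off the section sets are irrelevant: varying them only gives
  isomorphic copies of the same object. Components of maps are extensional, so that equality of
  arrows is equality of natural transformations.\<close>

record ('b, 's) psh =
  sec :: "'b \<Rightarrow> 's set"
  res :: "'b \<Rightarrow> 'b \<Rightarrow> 's \<Rightarrow> 's"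

record ('b, 's) psh_map =
  src :: "('b, 's) psh"
  tgt :: "('b, 's) psh"
  cmp :: "'b \<Rightarrow> 's \<Rightarrow> 's"

definition is_presheaf :: "('b::order, 's) psh \<Rightarrow> bool" where
  "is_presheaf F \<longleftrightarrow>
    (\<forall>b c. c \<le> b \<longrightarrow> res F b c \<in> sec F b \<rightarrow> sec F c) \<and>
    (\<forall>b. \<forall>x\<in>sec F b. res F b b x = x) \<and>
    (\<forall>b c d. d \<le> c \<and> c \<le> b \<longrightarrow> (\<forall>x\<in>sec F b. res F c d (res F b c x) = res F b d x))"

definition is_cover :: "'k rel \<Rightarrow> 'b::order \<Rightarrow> 'b set \<Rightarrow> bool" where
  "is_cover \<kappa> b S \<longleftrightarrow> |S| <o \<kappa> \<and> (\<forall>s\<in>S. s \<le> b) \<and> (\<forall>c. (\<forall>s\<in>S. s \<le> c) \<longrightarrow> b \<le> c)"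

definition is_sheaf :: "'k rel \<Rightarrow> ('b::order, 's) psh \<Rightarrow> bool" where
  "is_sheaf \<kappa> F \<longleftrightarrow> is_presheaf F \<and>
    (\<forall>b S x. is_cover \<kappa> b S \<and> (\<forall>s\<in>S. x s \<in> sec F s) \<and>
      (\<forall>s\<in>S. \<forall>t\<in>S. \<forall>c. c \<le> s \<and> c \<le> t \<longrightarrow> res F s c (x s) = res F t c (x t)) \<longrightarrow>
      (\<exists>!y. y \<in> sec F b \<and> (\<forall>s\<in>S. res F b s y = x s)))"

definition is_psh_map :: "('b::order, 's) psh_map \<Rightarrow> bool" where
  "is_psh_map \<eta> \<longleftrightarrow> (\<forall>b. cmp \<eta> b \<in> sec (src \<eta>) b \<rightarrow>\<^sub>E sec (tgt \<eta>) b) \<and>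
    (\<forall>b c. c \<le> b \<longrightarrow>
      (\<forall>x\<in>sec (src \<eta>) b. cmp \<eta> c (res (src \<eta>) b c x) = res (tgt \<eta>) b c (cmp \<eta> b x)))"

definition sheaf_cat :: "'k rel \<Rightarrow> (('b::order, 's) psh, ('b, 's) psh_map) cat" where
  "sheaf_cat \<kappa> = \<lparr>Obj = {F. is_sheaf \<kappa> F},
    Arr = {\<eta>. is_sheaf \<kappa> (src \<eta>) \<and> is_sheaf \<kappa> (tgt \<eta>) \<and> is_psh_map \<eta>},
    Dom = src, Cod = tgt,
    Ident = (\<lambda>F. \<lparr>src = F, tgt = F, cmp = (\<lambda>b. restrict id (sec F b))\<rparr>),
    Comp = (\<lambda>\<theta> \<eta>. \<lparr>src = src \<eta>, tgt = tgt \<theta>,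
      cmp = (\<lambda>b. compose (sec (src \<eta>) b) (cmp \<theta> b) (cmp \<eta> b))\<rparr>)\<rparr>"

definition strongly_positively_closed ::
  "('o, 'm) cat \<Rightarrow> ('p, 'n) cat \<Rightarrow> ('o, 'm, 'p, 'n) fctr \<Rightarrow> bool" where
  "strongly_positively_closed C D M \<longleftrightarrow>
    (\<forall>x\<in>Obj C. \<forall>u\<in>monos_into C x.
      is_union D (fobj M x)
        (insert (farr M u) (farr M ` {v\<in>monos_into C x. sub_disjoint C x v u}))
        (Ident D (fobj M x)))"


section \<open>The lattice \<open>L\<^sup>1\<close>\<close>

text \<open>A functor to sets is given by the sets \<open>fobj F x\<close> and the functions \<open>farr F f\<close>
  (relevant only on \<open>fobj F (Dom C f)\<close>).\<close>

definition global_sections ::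
  "('o, 'm, ('b::boolean_algebra, 's) psh, ('b, 's) psh_map) fctr \<Rightarrow>
    ('o, 'm, 's set, 's \<Rightarrow> 's) fctr" where
  "global_sections M =
    \<lparr>fobj = (\<lambda>x. sec (fobj M x) top_class.top), farr = (\<lambda>f. cmp (farr M f) top_class.top)\<rparr>"

definition elements :: "('o, 'm) cat \<Rightarrow> ('o, 'm, 's set, 's \<Rightarrow> 's) fctr \<Rightarrow>
    ('o \<times> 's, ('o \<times> 's) \<times> 'm \<times> ('o \<times> 's)) cat" where
  "elements C F = \<lparr>Obj = (SIGMA x:Obj C. fobj F x),
    Arr = {((x, a), f, (y, b)). f \<in> hom C x y \<and> a \<in> fobj F x \<and> b \<in> fobj F y \<and> farr F f a = b},
    Dom = (\<lambda>(p, f, q). p), Cod = (\<lambda>(p, f, q). q),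
    Ident = (\<lambda>(x, a). ((x, a), Ident C x, (x, a))),
    Comp = (\<lambda>(q, g, r) (p, f, q'). (p, g \<cdot>\<^bsub>C\<^esub> f, r))\<rparr>"

text \<open>Filtered colimit of the lattices \<open>L j\<close> with transition maps \<open>tr u\<close>, as the usual quotient of the
  disjoint union. The lattice structure is recorded by its order: one element is below another iff
  this holds for representatives at some stage.\<close>

definition filtered_colim :: "('j, 'u) cat \<Rightarrow> ('j \<Rightarrow> 'a gorder) \<Rightarrow> ('u \<Rightarrow> 'a \<Rightarrow> 'a) \<Rightarrow>
    ('j \<times> 'a) set gorder" where
  "filtered_colim J L tr = \<lparr>
    carrier = (SIGMA j:Obj J. carrier (L j)) //
      {((i, u), (j, v)). i \<in> Obj J \<and> u \<in> carrier (L i) \<and> j \<in> Obj J \<and> v \<in> carrier (L j) \<and>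
        (\<exists>k. \<exists>f\<in>hom J i k. \<exists>g\<in>hom J j k. tr f u = tr g v)},
    eq = (=),
    le = (\<lambda>U V. \<exists>(i, u)\<in>U. \<exists>(j, v)\<in>V. \<exists>k. \<exists>f\<in>hom J i k. \<exists>g\<in>hom J j k.
      tr f u \<sqsubseteq>\<^bsub>L k\<^esub> tr g v)\<rparr>"

definition L1 :: "('o, 'm) cat \<Rightarrow> ('o, 'm, 's set, 's \<Rightarrow> 's) fctr \<Rightarrow>
    (('o \<times> 's) \<times> 'm set) set gorder" where
  "L1 C F = filtered_colim (op_cat (elements C F)) (\<lambda>(x, a). Sub C x)
    (\<lambda>(p, f, q). pullbacks_along C f)"

definition is_boolean_lattice :: "'a gorder \<Rightarrow> bool" where
  "is_boolean_lattice L \<longleftrightarrow> bounded_lattice L \<and>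
    (\<forall>x\<in>carrier L. \<forall>y\<in>carrier L. \<forall>z\<in>carrier L.
      x \<sqinter>\<^bsub>L\<^esub> (y \<squnion>\<^bsub>L\<^esub> z) = (x \<sqinter>\<^bsub>L\<^esub> y) \<squnion>\<^bsub>L\<^esub> (x \<sqinter>\<^bsub>L\<^esub> z)) \<and>
    (\<forall>x\<in>carrier L. \<exists>y\<in>carrier L. x \<sqinter>\<^bsub>L\<^esub> y = \<bottom>\<^bsub>L\<^esub> \<and> x \<squnion>\<^bsub>L\<^esub> y = \<top>\<^bsub>L\<^esub>)"

text \<open>Lattice isomorphisms are the same as order isomorphisms.\<close>

definition lattice_isomorphic :: "'a gorder \<Rightarrow> 'c gorder \<Rightarrow> bool" where
  "lattice_isomorphic L K \<longleftrightarrow> (\<exists>\<phi>. bij_betw \<phi> (carrier L) (carrier K) \<and>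
    (\<forall>x\<in>carrier L. \<forall>y\<in>carrier L. x \<sqsubseteq>\<^bsub>L\<^esub> y \<longleftrightarrow> \<phi> x \<sqsubseteq>\<^bsub>K\<^esub> \<phi> y))"

definition order_of_type :: "'b::order gorder" where
  "order_of_type = \<lparr>carrier = UNIV, eq = (=), le = (\<le>)\<rparr>"

end

theory Submission
  imports Defs
begin

text \<open>For a global section \<open>a\<close> of \<open>M x\<close> and a subobject \<open>u\<close> of \<open>x\<close>, let the support of \<open>(x, a, u)\<close> be
  the set of those \<open>b \<in> B\<close> for which \<open>a\<close> restricted to \<open>b\<close> lies in \<open>M u\<close>. It depends only on
  the class of \<open>(x, a, u)\<close> in \<open>L\<^sup>1\<close>. If \<open>M\<close> is strongly positively closed, a cover of \<open>\<top>\<close> on whose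
  members \<open>a\<close> lies in \<open>M u\<close> or in some \<open>M v\<close> with \<open>v\<close> disjoint from \<open>u\<close> yields a single such \<open>v\<close>
  and an element \<open>\<beta>\<close> with \<open>a\<close> in \<open>M u\<close> on \<open>\<beta>\<close> and in \<open>M v\<close> on \<open>- \<beta>\<close>; so the support is the principal
  ideal of \<open>\<beta>\<close>, and sending the class to \<open>\<beta>\<close> is an isomorphism onto \<open>B\<close>; surjectivity uses
  the global sections of \<open>M (1 + 1)\<close>. Conversely, a section of \<open>M x\<close> over \<open>b\<close> extends to a global section
  of \<open>M (x + 1)\<close>, and a complement in \<open>L\<^sup>1\<close> of \<open>u\<close> at this section is realized at some stage
  \<open>z \<rightarrow> x + 1\<close>; the images in \<open>x\<close> of the part of \<open>z\<close> disjoint from \<open>u\<close> give the required \<open>v\<close>.\<close>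

section \<open>Factorization, pullbacks and empty objects\<close>

text \<open>Two mismatches shape the proof. \<open>L1\<close> only records global sections, while
  strong positive closedness concerns sections over every \<open>b\<close>; the terminal summand of
  x + 1 absorbs the part over \<open>- b\<close>, where nothing is prescribed. The subobjects v
  disjoint from u may be too many for a union in \<open>C\<close>, but a cover has fewer than
  \<kappa> members and so involves only \<kappa>-small many of them, whose union exists and is still
  disjoint from u. Relations in a filtered colimit hold only at some later stage, reached along two
  arrows that may differ even when both indices agree. Subobjects are therefore compared through
  generalized elements: an arrow g into x belongs to u when it factors through u, and pullback,
  intersection and disjointness become statements about all such arrows. Limits, monos and unions of
  sheaves are likewise given by universal properties only; arrows from representable sheaves, or
  comparison with an explicit subsheaf, turn them into statements about sections.\<close>

lemma hom_iff: "f \<in> hom C x y \<longleftrightarrow> f \<in> Arr C \<and> Dom C f = x \<and> Cod C f = y"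
  by (simp add: hom_def)

lemma monos_into_iff: "m \<in> monos_into C x \<longleftrightarrow> is_mono C m \<and> Cod C m = x"
  by (simp add: monos_into_def)

lemma is_monoD:
  "is_mono C m \<Longrightarrow> g \<in> hom C z (Dom C m) \<Longrightarrow> h \<in> hom C z (Dom C m) \<Longrightarrow> m \<cdot>\<^bsub>C\<^esub> g = m \<cdot>\<^bsub>C\<^esub> h \<Longrightarrow> g = h"
  unfolding is_mono_def by blast

lemma is_mono_hom: "is_mono C m \<Longrightarrow> m \<in> hom C (Dom C m) (Cod C m)"
  by (simp add: is_mono_def hom_iff)

lemma monos_into_hom: "m \<in> monos_into C x \<Longrightarrow> m \<in> hom C (Dom C m) x"
  by (auto simp: is_mono_def hom_iff monos_into_iff)

lemma is_unionD:
  assumes "is_union C x S m"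
  shows "S \<subseteq> monos_into C x" "m \<in> monos_into C x" "\<And>s. s \<in> S \<Longrightarrow> sub_le C s m"
    "\<And>n. n \<in> monos_into C x \<Longrightarrow> (\<And>s. s \<in> S \<Longrightarrow> sub_le C s n) \<Longrightarrow> sub_le C m n"
  using assms unfolding is_union_def by blast+

lemma is_pullbackD:
  assumes "is_pullback C f g p q"
  shows "p \<in> hom C (Dom C p) (Dom C f)" "q \<in> hom C (Dom C p) (Dom C g)"
    "f \<in> hom C (Dom C f) (Cod C f)" "g \<in> hom C (Dom C g) (Cod C f)"
    "f \<cdot>\<^bsub>C\<^esub> p = g \<cdot>\<^bsub>C\<^esub> q"
  using assms unfolding is_pullback_def is_commuting_square_def hom_iff by auto

lemma is_pullback_lift:
  assumes "is_pullback C f g p q" "p' \<in> hom C t (Dom C f)" "q' \<in> hom C t (Dom C g)"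
    "f \<cdot>\<^bsub>C\<^esub> p' = g \<cdot>\<^bsub>C\<^esub> q'"
  shows "\<exists>!h. h \<in> hom C t (Dom C p) \<and> p \<cdot>\<^bsub>C\<^esub> h = p' \<and> q \<cdot>\<^bsub>C\<^esub> h = q'"
proof -
  have "is_commuting_square C f g p' q'"
    using assms unfolding is_pullback_def is_commuting_square_def hom_iff by auto
  then have "\<exists>!h. h \<in> hom C (Dom C p') (Dom C p) \<and> p \<cdot>\<^bsub>C\<^esub> h = p' \<and> q \<cdot>\<^bsub>C\<^esub> h = q'"
    using assms(1) unfolding is_pullback_def by blast
  then show ?thesis using assms(2) by (simp add: hom_iff)
qed

lemma is_pullbackI:
  assumes "f \<in> hom C x z" "g \<in> hom C y z" "p \<in> hom C s x" "q \<in> hom C s y"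
    "f \<cdot>\<^bsub>C\<^esub> p = g \<cdot>\<^bsub>C\<^esub> q"
    "\<And>t p' q'. p' \<in> hom C t x \<Longrightarrow> q' \<in> hom C t y \<Longrightarrow> f \<cdot>\<^bsub>C\<^esub> p' = g \<cdot>\<^bsub>C\<^esub> q' \<Longrightarrow>
      \<exists>!h. h \<in> hom C t s \<and> p \<cdot>\<^bsub>C\<^esub> h = p' \<and> q \<cdot>\<^bsub>C\<^esub> h = q'"
  shows "is_pullback C f g p q"
  unfolding is_pullback_def
proof (intro conjI allI impI)
  show "is_commuting_square C f g p q"
    using assms(1-5) unfolding is_commuting_square_def hom_iff by auto
  fix p' q' assume "is_commuting_square C f g p' q'"
  then have "p' \<in> hom C (Dom C p') x" "q' \<in> hom C (Dom C p') y" "f \<cdot>\<^bsub>C\<^esub> p' = g \<cdot>\<^bsub>C\<^esub> q'"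
    using assms(1,2) unfolding is_commuting_square_def hom_iff by auto
  then have "\<exists>!h. h \<in> hom C (Dom C p') s \<and> p \<cdot>\<^bsub>C\<^esub> h = p' \<and> q \<cdot>\<^bsub>C\<^esub> h = q'"
    by (rule assms(6))
  moreover have "Dom C p = s" using assms(3) by (simp add: hom_iff)
  ultimately show "\<exists>!h. h \<in> hom C (Dom C p') (Dom C p) \<and> p \<cdot>\<^bsub>C\<^esub> h = p' \<and> q \<cdot>\<^bsub>C\<^esub> h = q'"
    by simp
qed

text \<open>The empty subobject is the union of the empty family, as in \<open>sub_disjoint\<close>;
  an object is empty when this union is the whole object, so that its only subobject is
  itself.\<close>

definition is_empty_obj :: "('o, 'm) cat \<Rightarrow> 'o \<Rightarrow> bool" where
  "is_empty_obj C y \<longleftrightarrow> is_union C y {} (Ident C y)"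

context category
begin

lemma comp_in: "g \<in> hom C y z \<Longrightarrow> f \<in> hom C x y \<Longrightarrow> g \<cdot> f \<in> hom C x z"
  by (rule Comp_in)

lemma hom_obj: "f \<in> hom C x y \<Longrightarrow> x \<in> Obj C \<and> y \<in> Obj C"
  using Dom_in Cod_in by (auto simp: hom_iff)

lemma assoc:
  "h \<in> hom C y z \<Longrightarrow> g \<in> hom C x y \<Longrightarrow> f \<in> hom C w x \<Longrightarrow> (h \<cdot> g) \<cdot> f = h \<cdot> (g \<cdot> f)"
  by (rule Comp_assoc)

lemma Ident_mono: "x \<in> Obj C \<Longrightarrow> Ident C x \<in> monos_into C x"
  using Ident_in[of x] Ident_Comp[of _ _ x] by (simp add: monos_into_iff is_mono_def hom_iff) metis

lemma is_mono_comp: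
  assumes "is_mono C m" "is_mono C n" "Cod C n = Dom C m"
  shows "is_mono C (m \<cdot> n)"
proof -
  have m: "m \<in> hom C (Dom C m) (Cod C m)" and n: "n \<in> hom C (Dom C n) (Dom C m)"
    using assms is_mono_hom by (auto simp: hom_iff is_mono_def)
  have mn: "m \<cdot> n \<in> hom C (Dom C n) (Cod C m)" using comp_in[OF m n] .
  show ?thesis unfolding is_mono_def
  proof (intro conjI allI impI, goal_cases)
    case 1 show ?case using mn by (simp add: hom_iff)
  next
    case (2 z g h)
    then have g: "g \<in> hom C z (Dom C n)" and h: "h \<in> hom C z (Dom C n)"
      and e: "m \<cdot> n \<cdot> g = m \<cdot> n \<cdot> h" using mn by (auto simp: hom_iff)
    have "m \<cdot> (n \<cdot> g) = m \<cdot> (n \<cdot> h)" using e assoc[OF m n g] assoc[OF m n h] by simp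
    then have "n \<cdot> g = n \<cdot> h"
      using is_monoD[OF assms(1)] comp_in[OF n g] comp_in[OF n h] by blast
    then show ?case using is_monoD[OF assms(2)] g h by blast
  qed
qed

text \<open>Here \<open>g\<close> may be any arrow, not only a mono: \<open>sub_le C g u\<close> is
  then membership of the generalized element \<open>g\<close> in \<open>u\<close>. The lemmas below
  are the rules for this membership relation.\<close>

lemma sub_le_iff:
  "g \<in> hom C t x \<Longrightarrow> u \<in> hom C y x \<Longrightarrow> sub_le C g u \<longleftrightarrow> (\<exists>h\<in>hom C t y. u \<cdot> h = g)"
  by (simp add: sub_le_def hom_iff)

lemma sub_le_refl: "g \<in> hom C t x \<Longrightarrow> sub_le C g g"
  using sub_le_iff[of g t x g t] Comp_Ident[of g t x] Ident_in hom_obj by blast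

lemma sub_le_trans:
  assumes "sub_le C g u" "sub_le C u v" "v \<in> hom C w x"
  shows "sub_le C g v"
proof -
  obtain h where h: "h \<in> hom C (Dom C g) (Dom C u)" "u \<cdot> h = g"
    using assms(1) unfolding sub_le_def by auto
  obtain k where k: "k \<in> hom C (Dom C u) (Dom C v)" "v \<cdot> k = u"
    using assms(2) unfolding sub_le_def by auto
  have v: "v \<in> hom C (Dom C v) x" using assms(3) by (auto simp: hom_iff)
  have "v \<cdot> (k \<cdot> h) = g" using assoc[OF v k(1) h(1)] h k by simp
  then show ?thesis unfolding sub_le_def using comp_in[OF k(1) h(1)] by blast
qed

lemma sub_le_comp:
  assumes "sub_le C g u" "g \<in> hom C t x" "u \<in> hom C y x" "p \<in> hom C s t"
  shows "sub_le C (g \<cdot> p) u"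
proof -
  obtain h where h: "h \<in> hom C t y" "u \<cdot> h = g" using assms sub_le_iff by blast
  have "u \<cdot> (h \<cdot> p) = g \<cdot> p" using assoc[OF assms(3) h(1) assms(4)] h by simp
  then show ?thesis using sub_le_iff[OF comp_in[OF assms(2,4)] assms(3)] comp_in[OF h(1) assms(4)]
    by blast
qed

lemma sub_le_self_comp:
  "u \<in> hom C y x \<Longrightarrow> p \<in> hom C s y \<Longrightarrow> sub_le C (u \<cdot> p) u"
  by (blast intro: sub_le_comp sub_le_refl)

lemma sub_le_mono_postcomp:
  assumes "is_mono C i" "i \<in> hom C x c" "g \<in> hom C t x" "u \<in> hom C y x"
  shows "sub_le C (i \<cdot> g) (i \<cdot> u) \<longleftrightarrow> sub_le C g u"
proof -
  have *: "(i \<cdot> u) \<cdot> h = i \<cdot> g \<longleftrightarrow> u \<cdot> h = g" if h: "h \<in> hom C t y" for h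
    using assoc[OF assms(2,4) h] is_monoD[OF assms(1)] comp_in[OF assms(4) h] assms(2,3)
    by (auto simp: hom_iff)
  show ?thesis
    using sub_le_iff[OF comp_in[OF assms(2,3)] comp_in[OF assms(2,4)]] sub_le_iff[OF assms(3,4)] *
    by blast
qed

lemma pullback_factor:
  assumes "is_pullback C f m n q" "p \<in> hom C t (Dom C f)"
  shows "sub_le C p n \<longleftrightarrow> sub_le C (f \<cdot> p) m"
proof -
  note pb = is_pullbackD[OF assms(1)]
  have fp: "f \<cdot> p \<in> hom C t (Cod C f)" using comp_in[OF pb(3) assms(2)] .
  show ?thesis
  proof
    assume "sub_le C p n"
    then obtain h where h: "h \<in> hom C t (Dom C n)" "n \<cdot> h = p"
      using sub_le_iff[OF assms(2) pb(1)] by blast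
    have "m \<cdot> (q \<cdot> h) = f \<cdot> p"
      using assoc[OF pb(4,2) h(1)] assoc[OF pb(3,1) h(1)] h pb(5) by simp
    then show "sub_le C (f \<cdot> p) m"
      using sub_le_iff[OF fp pb(4)] comp_in[OF pb(2) h(1)] by blast
  next
    assume "sub_le C (f \<cdot> p) m"
    then obtain h where h: "h \<in> hom C t (Dom C m)" "m \<cdot> h = f \<cdot> p"
      using sub_le_iff[OF fp pb(4)] by blast
    then show "sub_le C p n"
      using is_pullback_lift[OF assms(1,2) h(1)] sub_le_iff[OF assms(2) pb(1)] by auto
  qed
qed

lemma pullback_mono:
  assumes pb: "is_pullback C f m n q" and m: "is_mono C m"
  shows "n \<in> monos_into C (Dom C f)"
proof -
  note D = is_pullbackD[OF pb]
  have "is_mono C n" unfolding is_mono_def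
  proof (intro conjI allI impI, goal_cases)
    case 1 show ?case using D(1) by (simp add: hom_iff)
  next
    case (2 z g h)
    then have g: "g \<in> hom C z (Dom C n)" and h: "h \<in> hom C z (Dom C n)" and e: "n \<cdot> g = n \<cdot> h" by auto
    have "m \<cdot> (q \<cdot> g) = f \<cdot> n \<cdot> g" "m \<cdot> (q \<cdot> h) = f \<cdot> n \<cdot> h"
      using assoc[OF D(4,2)] g h D(5) by auto
    then have "m \<cdot> (q \<cdot> g) = m \<cdot> (q \<cdot> h)" using e assoc[OF D(3,1) g] assoc[OF D(3,1) h] by simp
    then have "q \<cdot> g = q \<cdot> h" using is_monoD[OF m] comp_in[OF D(2)] g h by blast
    moreover have "f \<cdot> (n \<cdot> g) = m \<cdot> (q \<cdot> g)" using assoc[OF D(4,2) g] assoc[OF D(3,1) g] D(5) by simp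
    ultimately show ?case
      using is_pullback_lift[OF pb comp_in[OF D(1) g] comp_in[OF D(2) g]] e g h by metis
  qed
  then show ?thesis using D(1) by (auto simp: monos_into_iff hom_iff)
qed

text \<open>Pulling back a subobject is taking the preimage of generalized elements. Applied to
  \<open>n\<close> itself, the equivalence produces the second projection \<open>q\<close>; the two
  monos make the lift unique and compatible with \<open>q\<close>.\<close>

lemma pullback_of_mono_iff:
  assumes f: "f \<in> hom C z x" and m: "m \<in> monos_into C x"
  shows "(\<exists>q. is_pullback C f m n q) \<longleftrightarrow>
    n \<in> monos_into C z \<and> (\<forall>t. \<forall>p\<in>hom C t z. sub_le C p n \<longleftrightarrow> sub_le C (f \<cdot> p) m)"
proof
  assume "\<exists>q. is_pullback C f m n q"
  then show "n \<in> monos_into C z \<and> (\<forall>t. \<forall>p\<in>hom C t z. sub_le C p n \<longleftrightarrow> sub_le C (f \<cdot> p) m)"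
    using pullback_factor pullback_mono f m by (auto simp: hom_iff monos_into_iff)
next
  assume r: "n \<in> monos_into C z \<and> (\<forall>t. \<forall>p\<in>hom C t z. sub_le C p n \<longleftrightarrow> sub_le C (f \<cdot> p) m)"
  have n: "n \<in> hom C (Dom C n) z" "is_mono C n"
    using r by (auto simp: monos_into_hom monos_into_iff)
  have mh: "m \<in> hom C (Dom C m) x" "is_mono C m" using m by (auto simp: monos_into_hom monos_into_iff)
  have "sub_le C (f \<cdot> n) m" using r n sub_le_refl by blast
  then obtain q where q: "q \<in> hom C (Dom C n) (Dom C m)" "m \<cdot> q = f \<cdot> n"
    using sub_le_iff[OF comp_in[OF f n(1)] mh(1)] by blast
  have "is_pullback C f m n q"
  proof (rule is_pullbackI[OF f mh(1) n(1) q(1)])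
    show "f \<cdot> n = m \<cdot> q" using q by simp
    fix t p' q' assume A: "p' \<in> hom C t z" "q' \<in> hom C t (Dom C m)" "f \<cdot> p' = m \<cdot> q'"
    have "sub_le C (f \<cdot> p') m" using sub_le_iff[OF comp_in[OF f A(1)] mh(1)] A by auto
    then have "sub_le C p' n" using r A by blast
    then obtain h where h: "h \<in> hom C t (Dom C n)" "n \<cdot> h = p'"
      using sub_le_iff[OF A(1) n(1)] by blast
    have "m \<cdot> (q \<cdot> h) = m \<cdot> q'"
      using assoc[OF mh(1) q(1) h(1)] assoc[OF f n(1) h(1)] h q A(3) by simp
    then have "q \<cdot> h = q'" using is_monoD[OF mh(2) comp_in[OF q(1) h(1)] A(2)] by blast
    then show "\<exists>!h. h \<in> hom C t (Dom C n) \<and> n \<cdot> h = p' \<and> q \<cdot> h = q'"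
      using h is_monoD[OF n(2)] by blast
  qed
  then show "\<exists>q. is_pullback C f m n q" ..
qed

lemma initial_empty:
  assumes "is_initial C x"
  shows "is_empty_obj C x"
  unfolding is_empty_obj_def is_union_def
proof (intro conjI ballI impI)
  have x: "x \<in> Obj C" using assms by (simp add: is_initial_def)
  show "Ident C x \<in> monos_into C x" using Ident_mono[OF x] .
  fix n assume "n \<in> monos_into C x"
  then have n: "n \<in> hom C (Dom C n) x" by (rule monos_into_hom)
  obtain h where h: "h \<in> hom C x (Dom C n)"
    using assms hom_obj[OF n] unfolding is_initial_def by blast
  have "n \<cdot> h = Ident C x"
    using assms comp_in[OF n h] Ident_in[OF x] x unfolding is_initial_def by blast
  then show "sub_le C (Ident C x) n" using sub_le_iff[OF Ident_in[OF x] n] h by blast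
qed auto

end

section \<open>Finite limits from diagrams indexed by the cardinal\<close>

definition is_terminal :: "('o, 'm) cat \<Rightarrow> 'o \<Rightarrow> bool" where
  "is_terminal C x \<longleftrightarrow> x \<in> Obj C \<and> (\<forall>y\<in>Obj C. \<exists>!f. f \<in> hom C y x)"

definition empty_shape :: "('k, 'k) cat" where
  "empty_shape = \<lparr>Obj = {}, Arr = {}, Dom = id, Cod = id, Ident = id, Comp = (\<lambda>g f. f)\<rparr>"

text \<open>Limits are available for shapes with objects and arrows in \<open>'k\<close>, so a
  cospan is coded by five elements of \<open>'k\<close>: \<open>e 0\<close>, \<open>e 1\<close>,
  \<open>e 2\<close> serve as objects and as their identities, \<open>e 3\<close> and
  \<open>e 4\<close> are the legs into \<open>e 2\<close>. In a composable pair at least one arrow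
  is an identity, which is what \<open>Comp\<close> uses.\<close>

definition cospan_shape :: "(nat \<Rightarrow> 'k) \<Rightarrow> ('k, 'k) cat" where
  "cospan_shape e = \<lparr>Obj = e ` {0, 1, 2}, Arr = e ` {0, 1, 2, 3, 4},
    Dom = (\<lambda>k. if k = e 3 then e 0 else if k = e 4 then e 1 else k),
    Cod = (\<lambda>k. if k = e 3 \<or> k = e 4 then e 2 else k),
    Ident = id, Comp = (\<lambda>g f. if g \<in> e ` {0, 1, 2} then f else g)\<rparr>"

definition cospan :: "('o, 'm) cat \<Rightarrow> (nat \<Rightarrow> 'k) \<Rightarrow> 'm \<Rightarrow> 'm \<Rightarrow> ('k, 'k, 'o, 'm) fctr" where
  "cospan C e f g =
    \<lparr>fobj = (\<lambda>k. if k = e 0 then Dom C f else if k = e 1 then Dom C g else Cod C f),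
     farr = (\<lambda>k. if k = e 3 then f else if k = e 4 then g
       else Ident C (if k = e 0 then Dom C f else if k = e 1 then Dom C g else Cod C f))\<rparr>"

lemma empty_shape_functor: "category C \<Longrightarrow> is_functor empty_shape C F"
  unfolding is_functor_def by (auto simp: empty_shape_def category_def hom_iff)

lemma empty_shape_limit:
  "is_limit C empty_shape F c \<pi> \<longleftrightarrow> is_terminal C c"
  unfolding is_limit_def is_cone_def is_terminal_def by (auto simp: empty_shape_def)

context
  fixes e :: "nat \<Rightarrow> 'k"
  assumes inj: "inj e"
begin

lemma cospan_shape_simps:
  "Obj (cospan_shape e) = {e 0, e 1, e 2}"
  "Arr (cospan_shape e) = {e 0, e 1, e 2, e 3, e 4}"
  "Dom (cospan_shape e) (e 0) = e 0" "Dom (cospan_shape e) (e 1) = e 1"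
  "Dom (cospan_shape e) (e 2) = e 2" "Dom (cospan_shape e) (e 3) = e 0"
  "Dom (cospan_shape e) (e 4) = e 1"
  "Cod (cospan_shape e) (e 0) = e 0" "Cod (cospan_shape e) (e 1) = e 1"
  "Cod (cospan_shape e) (e 2) = e 2" "Cod (cospan_shape e) (e 3) = e 2"
  "Cod (cospan_shape e) (e 4) = e 2"
  "Ident (cospan_shape e) k = k"
  "Comp (cospan_shape e) (e 0) k = k" "Comp (cospan_shape e) (e 1) k = k"
  "Comp (cospan_shape e) (e 2) k = k" "Comp (cospan_shape e) (e 3) k = e 3"
  "Comp (cospan_shape e) (e 4) k = e 4"
  using inj by (auto simp: cospan_shape_def inj_eq)

lemma cospan_shape_category: "category (cospan_shape e)"
  by unfold_locales
    (auto simp: hom_iff cospan_shape_simps inj_eq[OF inj] simp del: One_nat_def)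

lemma cospan_functor:
  assumes "category C" "f \<in> hom C x z" "g \<in> hom C y z"
  shows "is_functor (cospan_shape e) C (cospan C e f g)"
proof -
  interpret category C by fact
  have o: "x \<in> Obj C" "y \<in> Obj C" "z \<in> Obj C" using hom_obj assms(2,3) by auto
  note i = Ident_in[OF o(1)] Ident_in[OF o(2)] Ident_in[OF o(3)]
  have s: "Dom C f = x" "Cod C f = z" "Dom C g = y" "Cod C g = z"
    using assms by (auto simp: hom_iff)
  have c: "f \<cdot>\<^bsub>C\<^esub> Ident C x = f" "Ident C z \<cdot>\<^bsub>C\<^esub> f = f" "g \<cdot>\<^bsub>C\<^esub> Ident C y = g" "Ident C z \<cdot>\<^bsub>C\<^esub> g = g"
    "\<And>w. w \<in> Obj C \<Longrightarrow> Ident C w \<cdot>\<^bsub>C\<^esub> Ident C w = Ident C w"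
    using Comp_Ident[OF assms(2)] Comp_Ident[OF assms(3)] Ident_Comp[OF assms(2)] Ident_Comp[OF assms(3)]
      Ident_Comp[OF Ident_in] by auto
  show ?thesis
    unfolding is_functor_def using cospan_shape_category assms i o c
    by (simp add: cospan_shape_simps cospan_def s inj_eq[OF inj] del: One_nat_def)
qed

text \<open>Stated for any functor on the cospan, because it serves for diagrams in \<open>C\<close>
  and also for their composites with \<open>M\<close> in the sheaf category. The component at
  \<open>e 2\<close> is forced by the other two.\<close>

lemma cospan_limit_iff:
  assumes F: "is_functor (cospan_shape e) C F"
  shows "is_limit C (cospan_shape e) F c \<pi> \<longleftrightarrow>
    is_pullback C (farr F (e 3)) (farr F (e 4)) (\<pi> (e 0)) (\<pi> (e 1)) \<and>
    \<pi> (e 2) = farr F (e 3) \<cdot>\<^bsub>C\<^esub> \<pi> (e 0) \<and> Dom C (\<pi> (e 0)) = c"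
proof -
  let ?f = "farr F (e 3)" and ?g = "farr F (e 4)"
  interpret category C using F by (simp add: is_functor_def)
  have f: "?f \<in> hom C (fobj F (e 0)) (fobj F (e 2))" and g: "?g \<in> hom C (fobj F (e 1)) (fobj F (e 2))"
    using F unfolding is_functor_def by (auto simp: cospan_shape_simps)
  have id: "farr F (e 0) = Ident C (fobj F (e 0))" "farr F (e 1) = Ident C (fobj F (e 1))"
    "farr F (e 2) = Ident C (fobj F (e 2))"
    using F unfolding is_functor_def by (auto simp: cospan_shape_simps)
  have cone: "is_cone C (cospan_shape e) F d \<rho> \<longleftrightarrow> \<rho> (e 0) \<in> hom C d (fobj F (e 0)) \<and>
      \<rho> (e 1) \<in> hom C d (fobj F (e 1)) \<and> ?f \<cdot>\<^bsub>C\<^esub> \<rho> (e 0) = ?g \<cdot>\<^bsub>C\<^esub> \<rho> (e 1) \<and> \<rho> (e 2) = ?f \<cdot>\<^bsub>C\<^esub> \<rho> (e 0)"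
    (is "?l \<longleftrightarrow> ?r") for d \<rho>
  proof -
    have "?l \<longleftrightarrow> d \<in> Obj C \<and> (\<rho> (e 0) \<in> hom C d (fobj F (e 0)) \<and>
      \<rho> (e 1) \<in> hom C d (fobj F (e 1)) \<and> \<rho> (e 2) \<in> hom C d (fobj F (e 2))) \<and>
      Ident C (fobj F (e 0)) \<cdot>\<^bsub>C\<^esub> \<rho> (e 0) = \<rho> (e 0) \<and> Ident C (fobj F (e 1)) \<cdot>\<^bsub>C\<^esub> \<rho> (e 1) = \<rho> (e 1) \<and>
      Ident C (fobj F (e 2)) \<cdot>\<^bsub>C\<^esub> \<rho> (e 2) = \<rho> (e 2) \<and>
      ?f \<cdot>\<^bsub>C\<^esub> \<rho> (e 0) = \<rho> (e 2) \<and> ?g \<cdot>\<^bsub>C\<^esub> \<rho> (e 1) = \<rho> (e 2)"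
      unfolding is_cone_def by (simp add: cospan_shape_simps id del: One_nat_def)
    also have "\<dots> \<longleftrightarrow> ?r"
      using comp_in[OF f, of "\<rho> (e 0)" d] Ident_Comp[of "\<rho> (e 0)" d] Ident_Comp[of "\<rho> (e 1)" d]
        Ident_Comp[of "\<rho> (e 2)" d] hom_obj[of "\<rho> (e 0)" d] by metis
    finally show ?thesis .
  qed
  have s: "Dom C ?f = fobj F (e 0)" "Dom C ?g = fobj F (e 1)" using f g by (auto simp: hom_iff)
  show ?thesis
  proof
    assume L: "is_limit C (cospan_shape e) F c \<pi>"
    then have c: "\<pi> (e 0) \<in> hom C c (fobj F (e 0))" "\<pi> (e 1) \<in> hom C c (fobj F (e 1))"
      "?f \<cdot>\<^bsub>C\<^esub> \<pi> (e 0) = ?g \<cdot>\<^bsub>C\<^esub> \<pi> (e 1)" "\<pi> (e 2) = ?f \<cdot>\<^bsub>C\<^esub> \<pi> (e 0)"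
      unfolding is_limit_def cone by auto
    have "is_pullback C ?f ?g (\<pi> (e 0)) (\<pi> (e 1))"
    proof (rule is_pullbackI[OF f g c(1-3)])
      fix t p' q' assume A: "p' \<in> hom C t (fobj F (e 0))" "q' \<in> hom C t (fobj F (e 1))"
        "?f \<cdot>\<^bsub>C\<^esub> p' = ?g \<cdot>\<^bsub>C\<^esub> q'"
      define \<rho> where "\<rho> k = (if k = e 0 then p' else if k = e 1 then q' else ?f \<cdot>\<^bsub>C\<^esub> p')" for k
      have \<rho>: "\<rho> (e 0) = p'" "\<rho> (e 1) = q'" "\<rho> (e 2) = ?f \<cdot>\<^bsub>C\<^esub> p'"
        by (simp_all add: \<rho>_def inj_eq[OF inj])
      have "is_cone C (cospan_shape e) F t \<rho>" unfolding cone \<rho> using A by auto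
      then have ex: "\<exists>!h. h \<in> hom C t c \<and> (\<forall>j\<in>Obj (cospan_shape e). \<pi> j \<cdot>\<^bsub>C\<^esub> h = \<rho> j)"
        using L unfolding is_limit_def by blast
      have "(\<forall>j\<in>Obj (cospan_shape e). \<pi> j \<cdot>\<^bsub>C\<^esub> h = \<rho> j) \<longleftrightarrow> \<pi> (e 0) \<cdot>\<^bsub>C\<^esub> h = p' \<and> \<pi> (e 1) \<cdot>\<^bsub>C\<^esub> h = q'"
        if "h \<in> hom C t c" for h
        using assoc[OF f c(1) that] by (auto simp: cospan_shape_simps \<rho> c(4) simp del: One_nat_def)
      with ex show "\<exists>!h. h \<in> hom C t c \<and> \<pi> (e 0) \<cdot>\<^bsub>C\<^esub> h = p' \<and> \<pi> (e 1) \<cdot>\<^bsub>C\<^esub> h = q'"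
        by (metis (no_types, lifting))
    qed
    then show "is_pullback C ?f ?g (\<pi> (e 0)) (\<pi> (e 1)) \<and> \<pi> (e 2) = ?f \<cdot>\<^bsub>C\<^esub> \<pi> (e 0) \<and> Dom C (\<pi> (e 0)) = c"
      using c by (auto simp: hom_iff)
  next
    assume R: "is_pullback C ?f ?g (\<pi> (e 0)) (\<pi> (e 1)) \<and> \<pi> (e 2) = ?f \<cdot>\<^bsub>C\<^esub> \<pi> (e 0) \<and> Dom C (\<pi> (e 0)) = c"
    then have pb: "is_pullback C ?f ?g (\<pi> (e 0)) (\<pi> (e 1))" and c: "Dom C (\<pi> (e 0)) = c"
      and e2: "\<pi> (e 2) = ?f \<cdot>\<^bsub>C\<^esub> \<pi> (e 0)" by auto
    note D = is_pullbackD[OF pb, unfolded c s]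
    show "is_limit C (cospan_shape e) F c \<pi>" unfolding is_limit_def
    proof (intro conjI allI impI)
      show "is_cone C (cospan_shape e) F c \<pi>" unfolding cone using D e2 by auto
      fix t \<rho> assume "is_cone C (cospan_shape e) F t \<rho>"
      then have r: "\<rho> (e 0) \<in> hom C t (fobj F (e 0))" "\<rho> (e 1) \<in> hom C t (fobj F (e 1))"
        "?f \<cdot>\<^bsub>C\<^esub> \<rho> (e 0) = ?g \<cdot>\<^bsub>C\<^esub> \<rho> (e 1)" "\<rho> (e 2) = ?f \<cdot>\<^bsub>C\<^esub> \<rho> (e 0)"
        unfolding cone by auto
      have "(\<forall>j\<in>Obj (cospan_shape e). \<pi> j \<cdot>\<^bsub>C\<^esub> h = \<rho> j) \<longleftrightarrow> \<pi> (e 0) \<cdot>\<^bsub>C\<^esub> h = \<rho> (e 0) \<and> \<pi> (e 1) \<cdot>\<^bsub>C\<^esub> h = \<rho> (e 1)"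
        if "h \<in> hom C t c" for h
        using assoc[OF f D(1) that] by (auto simp: cospan_shape_simps r(4) e2 simp del: One_nat_def)
      then show "\<exists>!h. h \<in> hom C t c \<and> (\<forall>j\<in>Obj (cospan_shape e). \<pi> j \<cdot>\<^bsub>C\<^esub> h = \<rho> j)"
        using is_pullback_lift[OF pb, unfolded s c, OF r(1-3)] by (metis (no_types, lifting))
    qed
  qed
qed

end

section \<open>Disjointness in coherent categories\<close>

text \<open>Disjointness by generalized elements: whatever factors through both arrows has empty
  domain. Unlike \<open>sub_disjoint\<close> it makes sense for arrows that are not monic, so
  disjointness can be passed from an arrow to its image.\<close>

definition disjoint_arrows :: "('o, 'm) cat \<Rightarrow> 'm \<Rightarrow> 'm \<Rightarrow> bool" where
  "disjoint_arrows C f g \<longleftrightarrow>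
    (\<forall>t. \<forall>p\<in>hom C t (Dom C f). sub_le C (f \<cdot>\<^bsub>C\<^esub> p) g \<longrightarrow> is_empty_obj C t)"

lemma disjoint_arrowsD:
  assumes "disjoint_arrows C f g" "f \<in> hom C x y" "p \<in> hom C t x" "sub_le C (f \<cdot>\<^bsub>C\<^esub> p) g"
  shows "is_empty_obj C t"
proof -
  have "Dom C f = x" using assms(2) by (simp add: hom_iff)
  then show ?thesis using assms unfolding disjoint_arrows_def by blast
qed

lemma Cinfinite_inj_nat:
  assumes "Cinfinite (\<kappa> :: 'k rel)"
  obtains e :: "nat \<Rightarrow> 'k" where "inj e"
proof -
  have "infinite (UNIV :: 'k set)" using assms finite_subset[OF subset_UNIV] unfolding cinfinite_def by blast
  then show thesis using infinite_countable_subset that by blast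
qed

lemma finite_ordLess_Cinfinite: "Cinfinite \<kappa> \<Longrightarrow> finite A \<Longrightarrow> |A| <o \<kappa>"
  by (rule Cfinite_ordLess_Cinfinite) (simp_all add: cfinite_def Field_card_of card_of_card_order_on)

locale regular_cardinal =
  fixes \<kappa> :: "'k rel"
  assumes Cinf: "Cinfinite \<kappa>" and regular: "regularCard \<kappa>"
begin

lemmas finite_less = finite_ordLess_Cinfinite[OF Cinf]

end

locale kcoherent_category = regular_cardinal \<kappa>
  for \<kappa> :: "'k rel" and C :: "('o, 'm) cat" (structure) +
  assumes kcoh: "kcoherent \<kappa> C"
begin

sublocale category C using kcoh by (simp add: kcoherent_def)

lemma small_limits: "has_small_limits \<kappa> C"
  using kcoh by (simp add: kcoherent_def)

lemma eff_epi_stable: "is_eff_epi C e \<Longrightarrow> is_pullback C f e e' q \<Longrightarrow> is_eff_epi C e'"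
proof -
  have "\<forall>f e e' q. is_eff_epi C e \<and> is_pullback C f e e' q \<longrightarrow> is_eff_epi C e'"
    using kcoh by (simp add: kcoherent_def)
  then show "is_eff_epi C e \<Longrightarrow> is_pullback C f e e' q \<Longrightarrow> is_eff_epi C e'" by blast
qed

section \<open>Finite limits, intersections and unions of subobjects\<close>

lemma terminal_ex: "\<exists>x. is_terminal C x"
proof -
  have "|Arr (empty_shape :: ('k, 'k) cat)| <o \<kappa>" by (rule finite_less) (simp add: empty_shape_def)
  then have "\<exists>c \<pi>. is_limit C (empty_shape :: ('k, 'k) cat) undefined c \<pi>"
    using small_limits[unfolded has_small_limits_def, rule_format,
        OF conjI[OF empty_shape_functor[OF category_axioms]]] by blast
  then show ?thesis by (simp add: empty_shape_limit)
qed

lemma pullback_ex: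
  assumes f: "f \<in> hom C x z" and g: "g \<in> hom C y z"
  obtains t p q where "p \<in> hom C t x" "q \<in> hom C t y" "is_pullback C f g p q"
proof -
  obtain e :: "nat \<Rightarrow> 'k" where e: "inj e" using Cinfinite_inj_nat[OF Cinf] .
  note F = cospan_functor[OF e category_axioms f g]
  have "|Arr (cospan_shape e)| <o \<kappa>" by (rule finite_less) (simp add: cospan_shape_def)
  then obtain c \<pi> where "is_limit C (cospan_shape e) (cospan C e f g) c \<pi>"
    using small_limits[unfolded has_small_limits_def, rule_format, OF conjI[OF F]] by blast
  then have "is_pullback C f g (\<pi> (e 0)) (\<pi> (e 1))"
    unfolding cospan_limit_iff[OF e F] by (simp add: cospan_def inj_eq[OF e])
  then show thesis using that is_pullbackD[of C f g] f g by (auto simp: hom_iff)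
qed

lemma pullback_mono_ex:
  assumes "f \<in> hom C z x" "u \<in> monos_into C x"
  obtains n q where "is_pullback C f u n q" "n \<in> monos_into C z"
    "\<And>t p. p \<in> hom C t z \<Longrightarrow> sub_le C p n \<longleftrightarrow> sub_le C (f \<cdot> p) u"
  using pullback_ex[OF assms(1) monos_into_hom[OF assms(2)]] pullback_of_mono_iff[OF assms] by metis

lemma inter_ex:
  assumes "u \<in> monos_into C x" "v \<in> monos_into C x"
  obtains p q where "is_pullback C u v p q" "u \<cdot> p \<in> monos_into C x"
    "\<And>t f. f \<in> hom C t x \<Longrightarrow> sub_le C f (u \<cdot> p) \<longleftrightarrow> sub_le C f u \<and> sub_le C f v"
proof -
  have u: "u \<in> hom C (Dom C u) x" "is_mono C u" and v: "v \<in> hom C (Dom C v) x"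
    using assms by (auto simp: monos_into_hom monos_into_iff)
  obtain p q where pb: "is_pullback C u v p q" and pm: "p \<in> monos_into C (Dom C u)"
    and p: "\<And>t g. g \<in> hom C t (Dom C u) \<Longrightarrow> sub_le C g p \<longleftrightarrow> sub_le C (u \<cdot> g) v"
    using pullback_mono_ex[OF u(1) assms(2)] by metis
  have ph: "p \<in> hom C (Dom C p) (Dom C u)" using pm by (rule monos_into_hom)
  have up: "u \<cdot> p \<in> hom C (Dom C p) x" using comp_in[OF u(1) ph] .
  have m: "u \<cdot> p \<in> monos_into C x"
    using is_mono_comp[OF u(2)] pm up by (auto simp: monos_into_iff hom_iff)
  have "sub_le C f (u \<cdot> p) \<longleftrightarrow> sub_le C f u \<and> sub_le C f v" if f: "f \<in> hom C t x" for t f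
  proof -
    have upv: "sub_le C (u \<cdot> p) v" using p[OF ph] sub_le_refl[OF ph] by simp
    have "sub_le C f (u \<cdot> p)" if "sub_le C f u" "sub_le C f v"
    proof -
      obtain g where g: "g \<in> hom C t (Dom C u)" "u \<cdot> g = f"
        using \<open>sub_le C f u\<close> sub_le_iff[OF f u(1)] by blast
      then show ?thesis using p[OF g(1)] that sub_le_mono_postcomp[OF u(2,1) g(1) ph] by simp
    qed
    then show ?thesis using sub_le_trans[OF _ sub_le_self_comp[OF u(1) ph] u(1)] sub_le_trans[OF _ upv v]
      by blast
  qed
  then show thesis using that pb m by blast
qed

lemma union_ex: "x \<in> Obj C \<Longrightarrow> S \<subseteq> monos_into C x \<Longrightarrow> |S| <o \<kappa> \<Longrightarrow> \<exists>m. is_union C x S m"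
  using kcoh unfolding kcoherent_def by blast

lemma union_stable:
  assumes "is_union C x S m" "|S| <o \<kappa>" "is_pullback C f m m' q"
  shows "is_union C (Dom C f) (pullbacks_along C f S) m'"
proof -
  have "x \<in> Obj C" using hom_obj[OF monos_into_hom[OF is_unionD(2)[OF assms(1)]]] by simp
  moreover have "\<forall>x\<in>Obj C. \<forall>S. S \<subseteq> monos_into C x \<and> |S| <o \<kappa> \<longrightarrow>
      (\<forall>m f m' q. is_union C x S m \<and> is_pullback C f m m' q \<longrightarrow>
        is_union C (Dom C f) (pullbacks_along C f S) m')"
    using kcoh unfolding kcoherent_def by simp
  ultimately show ?thesis using is_unionD(1)[OF assms(1)] assms by blast
qed

text \<open>Reasoning by cases over a union. Since \<open>g\<close> factors through
  \<open>n\<close>, the pullback of \<open>n\<close> along \<open>g\<close> is all of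
  \<open>t\<close>, and stability makes \<open>t\<close> the union of the pullbacks of the members
  of \<open>S\<close>; each of these lies in \<open>k\<close> by \<open>le\<close>.\<close>

lemma union_factor:
  assumes un: "is_union C x S n" and S: "|S| <o \<kappa>" and g: "g \<in> hom C t x" and gn: "sub_le C g n"
    and k: "k \<in> monos_into C t"
    and le: "\<And>s r p. s \<in> S \<Longrightarrow> p \<in> hom C r t \<Longrightarrow> sub_le C (g \<cdot> p) s \<Longrightarrow> sub_le C p k"
  shows "sub_le C (Ident C t) k"
proof -
  have t: "t \<in> Obj C" using hom_obj[OF g] by simp
  have n: "n \<in> monos_into C x" using is_unionD(2)[OF un] .
  have "\<exists>q. is_pullback C g n (Ident C t) q"
    unfolding pullback_of_mono_iff[OF g n]
    using Ident_mono[OF t] sub_le_comp[OF gn g monos_into_hom[OF n]] Ident_Comp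
      sub_le_iff[OF _ Ident_in[OF t]] by blast
  then have un': "is_union C t (pullbacks_along C g S) (Ident C t)"
    using union_stable[OF un S] g by (auto simp: hom_iff)
  have "sub_le C n' k" if "n' \<in> pullbacks_along C g S" for n'
  proof -
    obtain s q where s: "s \<in> S" "is_pullback C g s n' q" using \<open>n' \<in> _\<close> unfolding pullbacks_along_def by auto
    have n': "n' \<in> hom C (Dom C n') t" using is_pullbackD(1)[OF s(2)] g by (auto simp: hom_iff)
    have "sub_le C (g \<cdot> n') s"
      using pullback_factor[OF s(2) is_pullbackD(1)[OF s(2)]] sub_le_refl[OF n'] by simp
    then show ?thesis using le s n' by blast
  qed
  then show ?thesis using is_unionD(4)[OF un' k] by blast
qed

section \<open>Empty objects\<close>

lemma sub_le_Ident: "f \<in> hom C t x \<Longrightarrow> sub_le C f (Ident C x)"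
  using sub_le_iff[of f t x "Ident C x" x] Ident_in Ident_Comp hom_obj by blast

lemma empty_obj_obj: "is_empty_obj C y \<Longrightarrow> y \<in> Obj C"
  using is_unionD(2) monos_into_hom hom_obj unfolding is_empty_obj_def by metis

lemma empty_objI:
  "y \<in> Obj C \<Longrightarrow> (\<And>n. n \<in> monos_into C y \<Longrightarrow> sub_le C (Ident C y) n) \<Longrightarrow> is_empty_obj C y"
  unfolding is_empty_obj_def is_union_def using Ident_mono by auto

text \<open>Strictness of empty objects: the empty union on \<open>z\<close> pulls back along
  \<open>f\<close> to the empty union on \<open>y\<close>.\<close>

lemma empty_obj_hom:
  assumes "is_empty_obj C z" "f \<in> hom C y z"
  shows "is_empty_obj C y"
proof (rule empty_objI)
  show "y \<in> Obj C" using hom_obj assms(2) by blast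
  fix n assume "n \<in> monos_into C y"
  then show "sub_le C (Ident C y) n"
    using union_factor[of z "{}" "Ident C z" f y n] assms sub_le_Ident[OF assms(2)] finite_less
    unfolding is_empty_obj_def by auto
qed

lemma empty_obj_sub_le:
  assumes y: "is_empty_obj C y" and f: "f \<in> hom C y x" and u: "u \<in> monos_into C x"
  shows "sub_le C f u"
proof -
  obtain n q where "n \<in> monos_into C y"
    and n: "\<And>t p. p \<in> hom C t y \<Longrightarrow> sub_le C p n \<longleftrightarrow> sub_le C (f \<cdot> p) u"
    using pullback_mono_ex[OF f u] by metis
  then have "sub_le C (Ident C y) n" using is_unionD(4)[OF y[unfolded is_empty_obj_def]] by blast
  then show ?thesis using n[OF Ident_in] Comp_Ident[OF f] hom_obj[OF f] by simp
qed

lemma empty_union_obj: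
  assumes "is_union C x {} m"
  shows "is_empty_obj C (Dom C m)"
proof -
  have m: "m \<in> hom C (Dom C m) x" "is_mono C m"
    using is_unionD(2)[OF assms] by (auto simp: monos_into_hom monos_into_iff)
  have o: "Dom C m \<in> Obj C" using hom_obj[OF m(1)] by simp
  show ?thesis
  proof (rule empty_objI[OF o])
    fix n assume n: "n \<in> monos_into C (Dom C m)"
    then have nh: "n \<in> hom C (Dom C n) (Dom C m)" by (rule monos_into_hom)
    have "m \<cdot> n \<in> monos_into C x"
      using is_mono_comp[OF m(2)] n comp_in[OF m(1) nh] by (auto simp: monos_into_iff hom_iff)
    then have "sub_le C (m \<cdot> Ident C (Dom C m)) (m \<cdot> n)"
      using is_unionD(4)[OF assms] Comp_Ident[OF m(1)] by simp
    then show "sub_le C (Ident C (Dom C m)) n"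
      using sub_le_mono_postcomp[OF m(2,1) Ident_in[OF o] nh] by simp
  qed
qed

lemma empty_sub_ex:
  assumes "x \<in> Obj C"
  obtains m where "m \<in> monos_into C x" "is_empty_obj C (Dom C m)"
proof -
  obtain m where "is_union C x {} m" using union_ex[OF assms, of "{}"] finite_less[of "{} :: 'm set"] by auto
  then show thesis using that empty_union_obj is_unionD(2) by metis
qed

text \<open>If \<open>e\<close> factors as \<open>u\<close> after \<open>h\<close>, then
  \<open>h\<close> has equal composites with the kernel pair of \<open>e\<close>, because
  \<open>u\<close> is monic; the arrow it induces on the coequalizer is a section of
  \<open>u\<close>.\<close>

lemma eff_epi_extremal:
  assumes e: "is_eff_epi C e" "e \<in> hom C y z" and u: "u \<in> monos_into C z" and le: "sub_le C e u"
  shows "sub_le C (Ident C z) u"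
proof -
  have uh: "u \<in> hom C (Dom C u) z" "is_mono C u" using u by (auto simp: monos_into_hom monos_into_iff)
  have z: "z \<in> Obj C" using hom_obj[OF e(2)] by simp
  obtain h where h: "h \<in> hom C y (Dom C u)" "u \<cdot> h = e" using le sub_le_iff[OF e(2) uh(1)] by blast
  obtain p q where pb: "is_pullback C e e p q" and ce: "is_coequalizer C p q e"
    using e(1) unfolding is_eff_epi_def by blast
  have D: "p \<in> hom C (Dom C p) y" "q \<in> hom C (Dom C p) y" "e \<cdot> p = e \<cdot> q"
    using is_pullbackD[OF pb] e(2) by (auto simp: hom_iff)
  have uniq: "\<exists>!k. k \<in> hom C z w \<and> k \<cdot> e = g" if "g \<in> hom C y w" "g \<cdot> p = g \<cdot> q" for g w
    using ce that e(2) unfolding is_coequalizer_def by (auto simp: hom_iff)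
  have "u \<cdot> (h \<cdot> p) = u \<cdot> (h \<cdot> q)" using assoc[OF uh(1) h(1) D(1)] assoc[OF uh(1) h(1) D(2)] h(2) D(3) by simp
  then have "h \<cdot> p = h \<cdot> q" using is_monoD[OF uh(2) comp_in[OF h(1) D(1)] comp_in[OF h(1) D(2)]] by blast
  then obtain k where k: "k \<in> hom C z (Dom C u)" "k \<cdot> e = h" using uniq[OF h(1)] by blast
  have "(u \<cdot> k) \<cdot> e = e" using assoc[OF uh(1) k(1) e(2)] k h by simp
  then have "u \<cdot> k = Ident C z"
    using uniq[OF e(2) D(3)] comp_in[OF uh(1) k(1)] Ident_in[OF z] Ident_Comp[OF e(2)] by blast
  then show ?thesis using sub_le_iff[OF Ident_in[OF z] uh(1)] k(1) by blast
qed

lemma empty_obj_eff_epi: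
  assumes "is_eff_epi C e" "e \<in> hom C y z" "is_empty_obj C y"
  shows "is_empty_obj C z"
  using eff_epi_extremal[OF assms(1,2)] empty_obj_sub_le[OF assms(3,2)] hom_obj[OF assms(2)]
  by (blast intro: empty_objI)

section \<open>Disjoint subobjects, images and unions\<close>

lemma disjoint_arrows_pullback:
  assumes "is_pullback C u v p q" "is_empty_obj C (Dom C p)"
  shows "disjoint_arrows C u v"
  unfolding disjoint_arrows_def
proof (intro allI ballI impI)
  fix t f assume f: "f \<in> hom C t (Dom C u)" "sub_le C (u \<cdot> f) v"
  then have "sub_le C f p" using pullback_factor[OF assms(1) f(1)] by simp
  then show "is_empty_obj C t"
    using sub_le_iff[OF f(1) is_pullbackD(1)[OF assms(1)]] empty_obj_hom[OF assms(2)] by blast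
qed

lemma sub_disjoint_iff:
  assumes "u \<in> monos_into C x" "v \<in> monos_into C x"
  shows "sub_disjoint C x u v \<longleftrightarrow> disjoint_arrows C u v"
proof
  have u: "u \<in> hom C (Dom C u) x" and v: "v \<in> hom C (Dom C v) x"
    using assms by (auto simp: monos_into_hom)
  {
    assume "sub_disjoint C x u v"
    then obtain p q where pb: "is_pullback C u v p q" and un: "is_union C x {} (u \<cdot> p)"
      unfolding sub_disjoint_def by blast
    note D = is_pullbackD[OF pb]
    have e: "is_empty_obj C (Dom C p)"
      using empty_union_obj[OF un] comp_in[OF u D(1)] by (simp add: hom_iff)
    show "disjoint_arrows C u v" by (rule disjoint_arrows_pullback[OF pb e])
  next
    assume d: "disjoint_arrows C u v"
    obtain p q where pb: "is_pullback C u v p q" and m: "u \<cdot> p \<in> monos_into C x"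
      and le: "\<And>t f. f \<in> hom C t x \<Longrightarrow> sub_le C f (u \<cdot> p) \<longleftrightarrow> sub_le C f u \<and> sub_le C f v"
      using inter_ex[OF assms] by metis
    note D = is_pullbackD[OF pb]
    have up: "u \<cdot> p \<in> hom C (Dom C p) x" using comp_in[OF u D(1)] .
    have "is_empty_obj C (Dom C p)" using d le[OF up] sub_le_refl[OF up] D(1) unfolding disjoint_arrows_def by blast
    then have "is_union C x {} (u \<cdot> p)" unfolding is_union_def using m empty_obj_sub_le[OF _ up] by auto
    then show "sub_disjoint C x u v" unfolding sub_disjoint_def using pb by blast
  }
qed

lemma disjoint_arrows_sym:
  assumes "disjoint_arrows C f g" "f \<in> hom C y x" "g \<in> hom C z x"
  shows "disjoint_arrows C g f"
  unfolding disjoint_arrows_def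
proof (intro allI ballI impI)
  fix t p assume p: "p \<in> hom C t (Dom C g)" "sub_le C (g \<cdot> p) f"
  have p': "p \<in> hom C t z" using p assms(3) by (auto simp: hom_iff)
  obtain q where q: "q \<in> hom C t y" "f \<cdot> q = g \<cdot> p"
    using p sub_le_iff[OF comp_in[OF assms(3) p'] assms(2)] by blast
  then show "is_empty_obj C t"
    using disjoint_arrowsD[OF assms(1,2) q(1)] sub_le_self_comp[OF assms(3) p'] by simp
qed

text \<open>Intersection distributes over \<kappa>-small unions: an object mapping into both
  \<open>f\<close> and \<open>n\<close> is covered by the pullbacks of the members of
  \<open>S\<close>, and those are empty.\<close>

lemma disjoint_union:
  assumes un: "is_union C x S n" and S: "|S| <o \<kappa>" and f: "f \<in> hom C y x"
    and d: "\<And>s. s \<in> S \<Longrightarrow> disjoint_arrows C f s"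
  shows "disjoint_arrows C f n"
  unfolding disjoint_arrows_def
proof (intro allI ballI impI)
  fix t p assume "p \<in> hom C t (Dom C f)" and le: "sub_le C (f \<cdot> p) n"
  then have p: "p \<in> hom C t y" using f by (auto simp: hom_iff)
  have fp: "f \<cdot> p \<in> hom C t x" using comp_in[OF f p] .
  show "is_empty_obj C t"
  proof (rule empty_objI)
    show "t \<in> Obj C" using hom_obj[OF p] by simp
    fix k assume k: "k \<in> monos_into C t"
    show "sub_le C (Ident C t) k"
    proof (rule union_factor[OF un S fp le k])
      fix s r p' assume A: "s \<in> S" "p' \<in> hom C r t" "sub_le C (f \<cdot> p \<cdot> p') s"
      then have "is_empty_obj C r"
        using disjoint_arrowsD[OF d f comp_in[OF p A(2)]] assoc[OF f p A(2)] by simp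
      then show "sub_le C p' k" using empty_obj_sub_le A(2) k by blast
    qed
  qed
qed

lemma image_ex:
  assumes "f \<in> hom C y x"
  obtains m e where "m \<in> monos_into C x" "e \<in> hom C y (Dom C m)" "is_eff_epi C e" "m \<cdot> e = f"
proof -
  obtain m where "is_image C f m" using kcoh assms unfolding kcoherent_def by (auto simp: hom_iff)
  then obtain e where e: "is_mono C m" "e \<in> hom C y (Dom C m)" "is_eff_epi C e" "m \<cdot> e = f"
    using assms unfolding is_image_def by (auto simp: hom_iff)
  have "Cod C m = x" using comp_in[OF is_mono_hom[OF e(1)] e(2)] e(4) assms by (simp add: hom_iff)
  then show thesis using that e by (simp add: monos_into_iff)
qed

text \<open>A common generalized element of \<open>m\<close> and \<open>u\<close> on
  \<open>t\<close> lifts to \<open>m \<cdot> e\<close> after pulling \<open>e\<close> back; the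
  lifted domain is empty, and it covers \<open>t\<close> by an effective epimorphism, so
  \<open>t\<close> is empty as well.\<close>

lemma disjoint_image:
  assumes e: "is_eff_epi C e" "e \<in> hom C y w" and m: "m \<in> hom C w x" and u: "u \<in> hom C z x"
    and d: "disjoint_arrows C (m \<cdot> e) u"
  shows "disjoint_arrows C m u"
  unfolding disjoint_arrows_def
proof (intro allI ballI impI)
  fix t p assume p': "p \<in> hom C t (Dom C m)" and le: "sub_le C (m \<cdot> p) u"
  then have p: "p \<in> hom C t w" using m by (auto simp: hom_iff)
  obtain s e' q where q: "e' \<in> hom C s t" "q \<in> hom C s y" "is_pullback C p e e' q"
    using pullback_ex[OF p e(2)] by metis
  have "is_eff_epi C e'" using eff_epi_stable e(1) q(3) .
  moreover have "is_empty_obj C s"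
  proof (rule disjoint_arrowsD[OF d comp_in[OF m e(2)] q(2)])
    have "m \<cdot> e \<cdot> q = (m \<cdot> p) \<cdot> e'"
      using assoc[OF m e(2) q(2)] assoc[OF m p q(1)] is_pullbackD(5)[OF q(3)] by simp
    then show "sub_le C (m \<cdot> e \<cdot> q) u" using sub_le_comp[OF le comp_in[OF m p] u q(1)] by simp
  qed
  ultimately show "is_empty_obj C t" using empty_obj_eff_epi q(1) by blast
qed

text \<open>A disjunctive syllogism: the part of \<open>t\<close> lying over \<open>j\<close> is
  empty, so the part over \<open>i\<close> is all of it.\<close>

lemma union_disjoint_factor:
  assumes un: "is_union C x {i, j} k" and g: "g \<in> hom C t x" "sub_le C g k"
    and m: "m \<in> hom C y x" "sub_le C g m" "disjoint_arrows C m j"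
  shows "sub_le C g i"
proof -
  have i: "i \<in> monos_into C x" and j: "j \<in> monos_into C x" using is_unionD(1)[OF un] by auto
  obtain n q where n: "n \<in> monos_into C t" "\<And>r p. p \<in> hom C r t \<Longrightarrow> sub_le C p n \<longleftrightarrow> sub_le C (g \<cdot> p) i"
    using pullback_mono_ex[OF g(1) i] by metis
  obtain h where h: "h \<in> hom C t y" "m \<cdot> h = g" using m(2) sub_le_iff[OF g(1) m(1)] by blast
  have "sub_le C (Ident C t) n"
  proof (rule union_factor[OF un finite_less g n(1)])
    fix s r p assume s: "s \<in> {i, j}" and p: "p \<in> hom C r t" and le: "sub_le C (g \<cdot> p) s"
    show "sub_le C p n"
    proof (cases "s = i")
      case True
      then show ?thesis using n(2)[OF p] le by simp
    next
      case False
      then have "sub_le C (m \<cdot> (h \<cdot> p)) j" using s le assoc[OF m(1) h(1) p] h(2) by simp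
      then have "is_empty_obj C r" by (rule disjoint_arrowsD[OF m(3,1) comp_in[OF h(1) p]])
      then show ?thesis using empty_obj_sub_le[OF _ p n(1)] by blast
    qed
  qed simp
  then show ?thesis using n(2)[OF Ident_in] Comp_Ident[OF g(1)] hom_obj[OF g(1)] by simp
qed

lemma disjoint_arrows_sub_le:
  assumes "disjoint_arrows C f g" "sub_le C h g" "g \<in> hom C y x"
  shows "disjoint_arrows C f h"
  using assms sub_le_trans[OF _ assms(2,3)] unfolding disjoint_arrows_def by blast

end

section \<open>Sheaves\<close>

text \<open>Stability of covers amounts to distributivity of meet over a possibly infinite join. In
  a Boolean algebra it follows by moving \<open>c\<close> across: \<open>inf t c \<le> d\<close> iff
  \<open>t \<le> sup d (- c)\<close>.\<close>

lemma is_cover_meet: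
  fixes b :: "'b::boolean_algebra"
  assumes "is_cover \<kappa> b T" "c \<le> b"
  shows "is_cover \<kappa> c ((\<lambda>t. inf t c) ` T)"
proof -
  have "c \<le> d" if d: "\<forall>t\<in>T. inf t c \<le> d" for d
  proof -
    have "t \<le> sup d (- c)" if "t \<in> T" for t
    proof -
      have "t = sup (inf t c) (inf t (- c))" by (simp flip: inf_sup_distrib1)
      also have "\<dots> \<le> sup d (- c)" using d that by (blast intro: sup_mono inf_le2)
      finally show ?thesis .
    qed
    then have "b \<le> sup d (- c)" using assms(1) unfolding is_cover_def by blast
    then have "inf b c \<le> inf (sup d (- c)) c" by (blast intro: inf_mono order_refl)
    also have "\<dots> \<le> d" by (simp add: inf_sup_distrib2)
    finally show ?thesis using assms(2) by (simp add: inf_absorb2)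
  qed
  moreover have "|(\<lambda>t. inf t c) ` T| <o \<kappa>"
    using assms(1) ordLeq_ordLess_trans[OF card_of_image] unfolding is_cover_def by blast
  ultimately show ?thesis unfolding is_cover_def by auto
qed

lemma is_cover_empty_bot: "is_cover \<kappa> (b :: 'b::boolean_algebra) {} \<Longrightarrow> b = bot"
  unfolding is_cover_def by (metis bot.extremum_uniqueI empty_iff)

text \<open>The value \<open>undefined\<close> is an arbitrary inhabitant of \<open>'s\<close>, used
  as the single section over each element below \<open>b\<close>; thus these presheaves exist for
  every section type. They are sheaves because a join of elements below \<open>b\<close> is below
  \<open>b\<close>.\<close>

definition representable :: "'b::order \<Rightarrow> ('b, 's) psh" where
  "representable b = \<lparr>sec = (\<lambda>c. if c \<le> b then {undefined} else {}), res = (\<lambda>_ _ x. x)\<rparr>"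

definition yoneda :: "('b::order, 's) psh \<Rightarrow> 'b \<Rightarrow> 's \<Rightarrow> ('b, 's) psh_map" where
  "yoneda F b s = \<lparr>src = representable b, tgt = F,
    cmp = (\<lambda>c. restrict (\<lambda>_. res F b c s) (sec (representable b :: ('b, 's) psh) c))\<rparr>"

section \<open>Morphisms of sheaves and their action on sections\<close>

lemma sheaf_hom_iff:
  "\<eta> \<in> hom (sheaf_cat \<kappa>) F G \<longleftrightarrow>
    is_sheaf \<kappa> F \<and> is_sheaf \<kappa> G \<and> src \<eta> = F \<and> tgt \<eta> = G \<and> is_psh_map \<eta>"
  by (auto simp: hom_iff sheaf_cat_def)

lemma sheaf_cat_simps [simp]:
  "Dom (sheaf_cat \<kappa>) = src" "Cod (sheaf_cat \<kappa>) = tgt" "F \<in> Obj (sheaf_cat \<kappa>) \<longleftrightarrow> is_sheaf \<kappa> F"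
  by (simp_all add: sheaf_cat_def)

lemma cmp_in: "\<eta> \<in> hom (sheaf_cat \<kappa>) F G \<Longrightarrow> s \<in> sec F b \<Longrightarrow> cmp \<eta> b s \<in> sec G b"
  unfolding sheaf_hom_iff is_psh_map_def by (blast intro: PiE_mem)

lemma cmp_res:
  "\<eta> \<in> hom (sheaf_cat \<kappa>) F G \<Longrightarrow> s \<in> sec F b \<Longrightarrow> c \<le> b \<Longrightarrow>
    cmp \<eta> c (res F b c s) = res G b c (cmp \<eta> b s)"
  unfolding sheaf_hom_iff is_psh_map_def by blast

lemma cmp_comp:
  "s \<in> sec (src \<eta>) b \<Longrightarrow> cmp (\<theta> \<cdot>\<^bsub>sheaf_cat \<kappa>\<^esub> \<eta>) b s = cmp \<theta> b (cmp \<eta> b s)"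
  by (simp add: sheaf_cat_def compose_def)

lemma cmp_Ident: "s \<in> sec F b \<Longrightarrow> cmp (Ident (sheaf_cat \<kappa>) F) b s = s"
  by (simp add: sheaf_cat_def)

lemma psh_map_eqI:
  assumes "is_psh_map \<eta>" "is_psh_map \<theta>" "src \<eta> = src \<theta>" "tgt \<eta> = tgt \<theta>"
    "\<And>b s. s \<in> sec (src \<eta>) b \<Longrightarrow> cmp \<eta> b s = cmp \<theta> b s"
  shows "\<eta> = \<theta>"
proof -
  have "cmp \<eta> b = cmp \<theta> b" for b
    using assms unfolding is_psh_map_def by (metis PiE_ext)
  then have "cmp \<eta> = cmp \<theta>" by blast
  then show ?thesis using assms(3,4) by simp
qed

lemma res_in: "is_sheaf \<kappa> F \<Longrightarrow> s \<in> sec F b \<Longrightarrow> c \<le> b \<Longrightarrow> res F b c s \<in> sec F c"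
  unfolding is_sheaf_def is_presheaf_def by blast

lemma res_res: "is_sheaf \<kappa> F \<Longrightarrow> s \<in> sec F b \<Longrightarrow> c \<le> b \<Longrightarrow> d \<le> c \<Longrightarrow> res F c d (res F b c s) = res F b d s"
  unfolding is_sheaf_def is_presheaf_def by blast

lemma res_id: "is_sheaf \<kappa> F \<Longrightarrow> s \<in> sec F b \<Longrightarrow> res F b b s = s"
  unfolding is_sheaf_def is_presheaf_def by blast

lemma sheaf_glue:
  assumes "is_sheaf \<kappa> F" "is_cover \<kappa> b S" "\<And>s. s \<in> S \<Longrightarrow> x s \<in> sec F s"
    "\<And>s t c. s \<in> S \<Longrightarrow> t \<in> S \<Longrightarrow> c \<le> s \<Longrightarrow> c \<le> t \<Longrightarrow> res F s c (x s) = res F t c (x t)"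
  shows "\<exists>!y. y \<in> sec F b \<and> (\<forall>s\<in>S. res F b s y = x s)"
  using assms unfolding is_sheaf_def by blast

lemma is_cover_le: "is_cover \<kappa> b S \<Longrightarrow> s \<in> S \<Longrightarrow> s \<le> b"
  unfolding is_cover_def by blast

lemma sheaf_eqI:
  assumes F: "is_sheaf \<kappa> F" and S: "is_cover \<kappa> b S" and st: "s \<in> sec F b" "t \<in> sec F b"
    and eq: "\<And>c. c \<in> S \<Longrightarrow> res F b c s = res F b c t"
  shows "s = t"
proof -
  have "\<exists>!y. y \<in> sec F b \<and> (\<forall>c\<in>S. res F b c y = res F b c s)"
    by (rule sheaf_glue[OF F S]) (simp_all add: res_in[OF F st(1)] res_res[OF F st(1)] is_cover_le[OF S])
  then show ?thesis using st eq by metis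
qed

lemma representable_sheaf:
  fixes b :: "'a::order"
  shows "is_sheaf \<kappa> (representable b :: ('a, 's) psh)"
  unfolding is_sheaf_def
proof (intro conjI allI impI)
  show "is_presheaf (representable b :: ('a, 's) psh)" by (auto simp: is_presheaf_def representable_def split: if_splits)
  fix c S and x :: "'a \<Rightarrow> 's" assume A: "is_cover \<kappa> c S \<and> (\<forall>s\<in>S. x s \<in> sec (representable b) s) \<and>
    (\<forall>s\<in>S. \<forall>t\<in>S. \<forall>d. d \<le> s \<and> d \<le> t \<longrightarrow> res (representable b) s d (x s) = res (representable b) t d (x t))"
  have "s \<le> b \<and> x s = undefined" if "s \<in> S" for s
  proof -
    have "x s \<in> (if s \<le> b then {undefined} else {})" using A that by (simp add: representable_def)
    then show ?thesis by (simp split: if_splits)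
  qed
  then have x: "\<And>s. s \<in> S \<Longrightarrow> s \<le> b" "\<And>s. s \<in> S \<Longrightarrow> x s = undefined" by blast+
  have "c \<le> b" using conjunct1[OF A] x(1) unfolding is_cover_def by blast
  then show "\<exists>!y. y \<in> sec (representable b) c \<and> (\<forall>s\<in>S. res (representable b) c s y = x s)"
    using x by (auto simp: representable_def)
qed

lemma yoneda_hom:
  fixes F :: "('b::order, 's) psh"
  assumes F: "is_sheaf \<kappa> F" and s: "s \<in> sec F b"
  shows "yoneda F b s \<in> hom (sheaf_cat \<kappa>) (representable b) F"
  unfolding sheaf_hom_iff is_psh_map_def using F representable_sheaf res_in[OF F s] res_res[OF F s]
  by (auto simp: yoneda_def representable_def)

lemma sec_representable: "undefined \<in> sec (representable b) b"
  by (simp add: representable_def)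

lemma cmp_yoneda:
  assumes "is_sheaf \<kappa> F" "s \<in> sec F b"
  shows "cmp (yoneda F b s) b undefined = s"
  using res_id[OF assms] by (simp add: yoneda_def representable_def)

lemma comp_yoneda:
  assumes h: "\<eta> \<in> hom (sheaf_cat \<kappa>) F G" and s: "s \<in> sec F b"
  shows "\<eta> \<cdot>\<^bsub>sheaf_cat \<kappa>\<^esub> yoneda F b s = yoneda G b (cmp \<eta> b s)"
proof -
  have "tgt \<eta> = G" using h by (simp add: sheaf_hom_iff)
  moreover have "compose (sec (representable b) c) (cmp \<eta> c) (cmp (yoneda F b s) c) =
      cmp (yoneda G b (cmp \<eta> b s)) c" for c
    using cmp_res[OF h s] by (auto simp: compose_def yoneda_def representable_def fun_eq_iff)
  ultimately show ?thesis by (simp add: sheaf_cat_def yoneda_def)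
qed

text \<open>Sections over \<open>b\<close> correspond to arrows from \<open>representable b\<close>,
  so the universal property of the pullback can be tested on them; the sections \<open>s\<close> and
  \<open>t\<close> become a compatible pair of arrows.\<close>

lemma sheaf_pullback:
  assumes pb: "is_pullback (sheaf_cat \<kappa>) f g p q"
    and s: "s \<in> sec (src f) b" and t: "t \<in> sec (src g) b" and eq: "cmp f b s = cmp g b t"
  shows "\<exists>r\<in>sec (src p) b. cmp p b r = s \<and> cmp q b r = t"
proof -
  note D = is_pullbackD[OF pb, simplified]
  have F: "is_sheaf \<kappa> (src f)" "is_sheaf \<kappa> (src g)" using D(3,4) by (simp_all add: sheaf_hom_iff)
  note ys = yoneda_hom[OF F(1) s] and yt = yoneda_hom[OF F(2) t]
  have "f \<cdot>\<^bsub>sheaf_cat \<kappa>\<^esub> yoneda (src f) b s = g \<cdot>\<^bsub>sheaf_cat \<kappa>\<^esub> yoneda (src g) b t"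
    using comp_yoneda[OF D(3) s] comp_yoneda[OF D(4) t] eq by simp
  then obtain h where h: "h \<in> hom (sheaf_cat \<kappa>) (representable b) (src p)"
    "p \<cdot>\<^bsub>sheaf_cat \<kappa>\<^esub> h = yoneda (src f) b s" "q \<cdot>\<^bsub>sheaf_cat \<kappa>\<^esub> h = yoneda (src g) b t"
    using is_pullback_lift[OF pb, simplified, OF ys yt] by blast
  have u: "undefined \<in> sec (src h) b" using h(1) sec_representable by (simp add: sheaf_hom_iff)
  show ?thesis
    using cmp_in[OF h(1) sec_representable] cmp_comp[OF u, where \<theta> = p] cmp_comp[OF u, where \<theta> = q]
      cmp_yoneda[OF F(1) s] cmp_yoneda[OF F(2) t] h(2,3) by metis
qed

lemma sheaf_mono_iff:
  assumes h: "\<eta> \<in> hom (sheaf_cat \<kappa>) F G"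
  shows "is_mono (sheaf_cat \<kappa>) \<eta> \<longleftrightarrow> (\<forall>b. inj_on (cmp \<eta> b) (sec F b))"
proof
  have F: "is_sheaf \<kappa> F" and src: "src \<eta> = F" using h by (simp_all add: sheaf_hom_iff)
  {
    assume m: "is_mono (sheaf_cat \<kappa>) \<eta>"
    show "\<forall>b. inj_on (cmp \<eta> b) (sec F b)"
    proof (intro allI inj_onI)
      fix b s t assume st: "s \<in> sec F b" "t \<in> sec F b" and eq: "cmp \<eta> b s = cmp \<eta> b t"
      have "yoneda F b s = yoneda F b t"
        using is_monoD[OF m, simplified, unfolded src, OF yoneda_hom[OF F st(1)] yoneda_hom[OF F st(2)]]
          comp_yoneda[OF h st(1)] comp_yoneda[OF h st(2)] eq by simp
      then show "s = t" using cmp_yoneda[OF F st(1)] cmp_yoneda[OF F st(2)] by metis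
    qed
  next
    assume inj: "\<forall>b. inj_on (cmp \<eta> b) (sec F b)"
    show "is_mono (sheaf_cat \<kappa>) \<eta>" unfolding is_mono_def
    proof (intro conjI allI impI, goal_cases)
      case 1 show ?case using h by (simp add: hom_iff)
    next
      case (2 Z g k)
      then have g: "g \<in> hom (sheaf_cat \<kappa>) Z F" and k: "k \<in> hom (sheaf_cat \<kappa>) Z F"
        and e: "\<eta> \<cdot>\<^bsub>sheaf_cat \<kappa>\<^esub> g = \<eta> \<cdot>\<^bsub>sheaf_cat \<kappa>\<^esub> k" by (simp_all add: src)
      have gs: "is_psh_map g" "is_psh_map k" "src g = Z" "src k = Z" "tgt g = tgt k"
        using g k by (simp_all add: sheaf_hom_iff)
      show ?case
      proof (rule psh_map_eqI[OF gs(1,2)])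
        fix b s assume "s \<in> sec (src g) b"
        then have s: "s \<in> sec Z b" "s \<in> sec (src g) b" "s \<in> sec (src k) b" using gs by simp_all
        have "cmp \<eta> b (cmp g b s) = cmp \<eta> b (cmp k b s)"
          using cmp_comp[OF s(2), where \<theta> = \<eta> and \<kappa> = \<kappa>] cmp_comp[OF s(3), where \<theta> = \<eta> and \<kappa> = \<kappa>] e by simp
        then show "cmp g b s = cmp k b s"
          using inj cmp_in[OF g s(1)] cmp_in[OF k s(1)] by (blast dest: inj_onD)
      qed (use gs in simp_all)
    qed
  }
qed

lemma sheaf_terminal:
  assumes "is_terminal (sheaf_cat \<kappa> :: (('b::order, 's) psh, _) cat) T"
  shows "\<exists>!s. s \<in> sec T b"
proof -
  have T: "is_sheaf \<kappa> T" using assms by (simp add: is_terminal_def)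
  have u: "\<exists>!f. f \<in> hom (sheaf_cat \<kappa>) (representable b) T"
    using assms representable_sheaf[of \<kappa> b, where ?'s = 's] by (simp add: is_terminal_def)
  have "\<exists>s. s \<in> sec T b" using u cmp_in sec_representable by metis
  moreover have "s = t" if "s \<in> sec T b" "t \<in> sec T b" for s t
    using u yoneda_hom[OF T that(1)] yoneda_hom[OF T that(2)] cmp_yoneda[OF T that(1)] cmp_yoneda[OF T that(2)]
    by metis
  ultimately show ?thesis by blast
qed

text \<open>Belonging to a subsheaf is a local property. The preimages over the members of the cover
  are unique because the components of a mono are injective, so they agree on overlaps and
  glue.\<close>

lemma sheaf_glue_image:
  assumes h: "\<eta> \<in> hom (sheaf_cat \<kappa>) G F" and m: "is_mono (sheaf_cat \<kappa>) \<eta>"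
    and T: "is_cover \<kappa> b T" and t: "t \<in> sec F b"
    and im: "\<And>c. c \<in> T \<Longrightarrow> res F b c t \<in> cmp \<eta> c ` sec G c"
  shows "t \<in> cmp \<eta> b ` sec G b"
proof -
  have G: "is_sheaf \<kappa> G" and F: "is_sheaf \<kappa> F" using h by (simp_all add: sheaf_hom_iff)
  have inj: "inj_on (cmp \<eta> d) (sec G d)" for d using m sheaf_mono_iff[OF h] by blast
  have "\<forall>c\<in>T. \<exists>r. r \<in> sec G c \<and> cmp \<eta> c r = res F b c t" using im by fastforce
  then obtain r where r: "\<And>c. c \<in> T \<Longrightarrow> r c \<in> sec G c" "\<And>c. c \<in> T \<Longrightarrow> cmp \<eta> c (r c) = res F b c t"
    by metis
  have "\<exists>!y. y \<in> sec G b \<and> (\<forall>c\<in>T. res G b c y = r c)"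
  proof (rule sheaf_glue[OF G T r(1)])
    fix c d e assume A: "c \<in> T" "d \<in> T" "e \<le> c" "e \<le> d"
    have "cmp \<eta> e (res G c' e (r c')) = res F b e t" if "c' \<in> T" "e \<le> c'" for c'
      using cmp_res[OF h r(1)[OF that(1)] that(2)] r(2)[OF that(1)] res_res[OF F t is_cover_le[OF T that(1)] that(2)]
      by simp
    then show "res G c e (r c) = res G d e (r d)"
      using inj_onD[OF inj] res_in[OF G r(1)] A by metis
  qed
  then obtain y where y: "y \<in> sec G b" "\<And>c. c \<in> T \<Longrightarrow> res G b c y = r c" by blast
  have "cmp \<eta> b y = t"
  proof (rule sheaf_eqI[OF F T cmp_in[OF h y(1)] t])
    fix c assume "c \<in> T"
    then show "res F b c (cmp \<eta> b y) = res F b c t"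
      using cmp_res[OF h y(1) is_cover_le[OF T]] y(2) r(2) by metis
  qed
  then show ?thesis using y(1) by blast
qed

section \<open>Gluing over covers and sections of unions of subsheaves\<close>

context regular_cardinal
begin

lemma is_cover_compl: "is_cover \<kappa> (top_class.top :: 'b::boolean_algebra) {b, - b}"
proof -
  have "top_class.top \<le> c" if "b \<le> c" "- b \<le> c" for c
    using sup_least[OF that] by simp
  moreover have "|{b, - b}| <o \<kappa>" by (rule finite_less) simp
  ultimately show ?thesis unfolding is_cover_def by simp
qed

lemma is_cover_bot: "is_cover \<kappa> (bot :: 'b::boolean_algebra) {}"
  unfolding is_cover_def by (simp add: finite_less)

lemma is_cover_single: "is_cover \<kappa> b {b}"
  unfolding is_cover_def by (simp add: finite_less)

text \<open>Refining each member of a cover again gives a \<kappa>-small family: an infinite regular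
  cardinal is closed under unions of fewer than \<kappa> sets of size less than \<kappa>.\<close>

lemma is_cover_UN:
  assumes "is_cover \<kappa> b T" "\<And>t. t \<in> T \<Longrightarrow> is_cover \<kappa> t (U t)"
  shows "is_cover \<kappa> b (\<Union>t\<in>T. U t)"
  unfolding is_cover_def
proof (intro conjI allI impI ballI)
  have "stable \<kappa>" using regularCard_stable Cinf regular unfolding cinfinite_def by blast
  moreover have "|T| <o \<kappa>" "\<And>t. t \<in> T \<Longrightarrow> |U t| <o \<kappa>" using assms unfolding is_cover_def by simp_all
  ultimately show "|\<Union>t\<in>T. U t| <o \<kappa>" by (rule stable_UNION)
  show "s \<le> b" if "s \<in> (\<Union>t\<in>T. U t)" for s
    using that is_cover_le[OF assms(1)] is_cover_le[OF assms(2)] order_trans by blast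
  fix c assume c: "\<forall>s\<in>\<Union>t\<in>T. U t. s \<le> c"
  have "t \<le> c" if "t \<in> T" for t using c assms(2)[OF that] that unfolding is_cover_def by blast
  then show "b \<le> c" using assms(1) unfolding is_cover_def by blast
qed

lemma sheaf_sec_bot:
  fixes F :: "('b::boolean_algebra, 's) psh"
  shows "is_sheaf \<kappa> F \<Longrightarrow> s \<in> sec F bot \<Longrightarrow> t \<in> sec F bot \<Longrightarrow> s = t"
  by (rule sheaf_eqI[OF _ is_cover_bot]) simp_all

text \<open>Since \<open>b\<close> and \<open>- b\<close> meet in \<open>bot\<close>, over which the
  empty cover allows only one section, any two sections over them are compatible.\<close>

lemma sheaf_glue_compl:
  fixes F :: "('b::boolean_algebra, 's) psh"
  assumes F: "is_sheaf \<kappa> F" and s: "s \<in> sec F b" and t: "t \<in> sec F (- b)"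
  shows "\<exists>y\<in>sec F top_class.top. res F top_class.top b y = s \<and> res F top_class.top (- b) y = t"
proof -
  define x where "x c = (if c = b then s else t)" for c
  \<comment> \<open>The family \<open>x\<close> is indexed by the members of the cover, so both
    prescriptions must agree if \<open>b\<close> and \<open>- b\<close> coincide; this forces
    \<open>b = bot\<close>, where sections are unique.\<close>
  have tb: "b = - b \<Longrightarrow> s = t"
  proof -
    assume "b = - b"
    then have "b = bot" using inf_compl_bot[of b] by simp
    then show "s = t" using sheaf_sec_bot[OF F] s t \<open>b = - b\<close> by metis
  qed
  then have x: "x b = s" "x (- b) = t" by (auto simp: x_def)
  have "\<exists>!y. y \<in> sec F top_class.top \<and> (\<forall>c\<in>{b, - b}. res F top_class.top c y = x c)"
  proof (rule sheaf_glue[OF F is_cover_compl])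
    show in_x: "x c \<in> sec F c" if "c \<in> {b, - b}" for c using that x s t by auto
    fix c d e assume A: "c \<in> {b, - b}" "d \<in> {b, - b}" "e \<le> c" "e \<le> d"
    show "res F c e (x c) = res F d e (x d)"
    proof (cases "c = d")
      case False
      then have "e \<le> b" "e \<le> - b" using A by auto
      then have "e \<le> inf b (- b)" by (rule le_infI)
      then have "e = bot" by (simp add: bot_unique)
      then show ?thesis using sheaf_sec_bot[OF F] res_in[OF F in_x] A by metis
    qed simp
  qed
  then show ?thesis using x by auto
qed

text \<open>The sections lying locally in one of the images form a subsheaf, by regularity of \<open>\<kappa>\<close>.\<close>

lemma union_sections:
  fixes F :: "('b::boolean_algebra, 's) psh"
  assumes un: "is_union (sheaf_cat \<kappa>) F S m" and r: "r \<in> sec (src m) b"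
  shows "\<exists>T. is_cover \<kappa> b T \<and> (\<forall>c\<in>T. \<exists>s\<in>S. res F b c (cmp m b r) \<in> cmp s c ` sec (src s) c)"
proof -
  let ?D = "sheaf_cat \<kappa> :: (('b, 's) psh, ('b, 's) psh_map) cat"
  define loc where "loc b t \<longleftrightarrow> (\<exists>T. is_cover \<kappa> b T \<and> (\<forall>c\<in>T. \<exists>s\<in>S. res F b c t \<in> cmp s c ` sec (src s) c))" for b t
  \<comment> \<open>Only the universal property of the union \<open>m\<close> is available. Its
    sections are bounded by showing that this subpresheaf is a sheaf containing all members of
    \<open>S\<close>, hence containing \<open>m\<close>.\<close>
  define N where "N = F\<lparr>sec := \<lambda>b. {t \<in> sec F b. loc b t}\<rparr>"
  have m: "m \<in> hom ?D (src m) F" using monos_into_hom[OF is_unionD(2)[OF un]] by simp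
  have F: "is_sheaf \<kappa> F" using m by (simp add: sheaf_hom_iff)
  have S: "s \<in> hom ?D (src s) F" if "s \<in> S" for s using monos_into_hom is_unionD(1)[OF un] that by fastforce
  have secN: "sec N b = {t \<in> sec F b. loc b t}" and resN: "res N = res F" for b by (simp_all add: N_def)
  have loc_res: "loc c (res F b c t)" if t: "t \<in> sec F b" "loc b t" "c \<le> b" for b c t
  proof -
    obtain T where T: "is_cover \<kappa> b T" "\<forall>c\<in>T. \<exists>s\<in>S. res F b c t \<in> cmp s c ` sec (src s) c"
      using t(2) unfolding loc_def by blast
    have "\<exists>s\<in>S. res F c (inf d c) (res F b c t) \<in> cmp s (inf d c) ` sec (src s) (inf d c)" if d: "d \<in> T" for d
    proof -
      obtain s x where s: "s \<in> S" "x \<in> sec (src s) d" "res F b d t = cmp s d x" using T(2) d by blast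
      have "res F c (inf d c) (res F b c t) = res F d (inf d c) (res F b d t)"
        using res_res[OF F t(1,3)] res_res[OF F t(1) is_cover_le[OF T(1) d]] by simp
      also have "\<dots> = cmp s (inf d c) (res (src s) d (inf d c) x)"
        using cmp_res[OF S[OF s(1)] s(2)] s(3) by simp
      finally show ?thesis using s(1,2) res_in[of \<kappa> "src s" x d "inf d c"] S[OF s(1)]
        by (auto simp: sheaf_hom_iff)
    qed
    then show ?thesis unfolding loc_def
      by (intro exI[of _ "(\<lambda>d. inf d c) ` T"]) (use is_cover_meet[OF T(1) t(3)] in auto)
  qed
  have N: "is_sheaf \<kappa> N"
    unfolding is_sheaf_def
  proof (intro conjI allI impI)
    show "is_presheaf N" unfolding is_presheaf_def secN resN
      using loc_res res_in[OF F] res_id[OF F] res_res[OF F] by auto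
    fix b T x assume A: "is_cover \<kappa> b T \<and> (\<forall>s\<in>T. x s \<in> sec N s) \<and>
      (\<forall>s\<in>T. \<forall>t\<in>T. \<forall>c. c \<le> s \<and> c \<le> t \<longrightarrow> res N s c (x s) = res N t c (x t))"
    then have T: "is_cover \<kappa> b T" and x: "\<And>s. s \<in> T \<Longrightarrow> x s \<in> sec F s" and l: "\<And>s. s \<in> T \<Longrightarrow> loc s (x s)"
      by (auto simp: secN)
    have ex1: "\<exists>!y. y \<in> sec F b \<and> (\<forall>s\<in>T. res F b s y = x s)"
    proof (rule sheaf_glue[OF F T x])
      show "res F s c (x s) = res F t c (x t)" if "s \<in> T" "t \<in> T" "c \<le> s" "c \<le> t" for s t c
        using conjunct2[OF conjunct2[OF A]] that unfolding resN by blast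
    qed
    then obtain y where y: "y \<in> sec F b" "\<And>s. s \<in> T \<Longrightarrow> res F b s y = x s" by blast
    have "\<forall>t\<in>T. \<exists>U. is_cover \<kappa> t U \<and> (\<forall>c\<in>U. \<exists>s\<in>S. res F t c (x t) \<in> cmp s c ` sec (src s) c)"
      using l unfolding loc_def by blast
    then obtain U where U: "\<And>t. t \<in> T \<Longrightarrow> is_cover \<kappa> t (U t)"
      "\<And>t c. t \<in> T \<Longrightarrow> c \<in> U t \<Longrightarrow> \<exists>s\<in>S. res F t c (x t) \<in> cmp s c ` sec (src s) c" by metis
    have "\<exists>s\<in>S. res F b c y \<in> cmp s c ` sec (src s) c" if c: "c \<in> U t" and t: "t \<in> T" for c t
      using U(2)[OF t c] res_res[OF F y(1) is_cover_le[OF T t] is_cover_le[OF U(1)[OF t] c]] y(2)[OF t] by simp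
    then have "\<forall>c\<in>\<Union>t\<in>T. U t. \<exists>s\<in>S. res F b c y \<in> cmp s c ` sec (src s) c" by blast
    then have "loc b y" unfolding loc_def using is_cover_UN[OF T U(1)] by blast
    show "\<exists>!y. y \<in> sec N b \<and> (\<forall>s\<in>T. res N b s y = x s)"
    proof (rule ex1I)
      show "y \<in> sec N b \<and> (\<forall>s\<in>T. res N b s y = x s)" using y \<open>loc b y\<close> by (simp add: secN resN)
      fix z assume "z \<in> sec N b \<and> (\<forall>s\<in>T. res N b s z = x s)"
      then have "z \<in> sec F b \<and> (\<forall>s\<in>T. res F b s z = x s)" by (simp add: secN resN)
      then show "z = y" using ex1 y by blast
    qed
  qed
  define i where "i = \<lparr>src = N, tgt = F, cmp = (\<lambda>b. restrict id (sec N b))\<rparr>"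
  have si: "src i = N" by (simp add: i_def)
  have ih: "i \<in> hom ?D N F"
    unfolding sheaf_hom_iff is_psh_map_def
    using N F loc_res res_in[OF F] by (auto simp: i_def secN resN)
  have "is_mono ?D i" unfolding sheaf_mono_iff[OF ih] by (simp add: i_def inj_on_def)
  then have im: "i \<in> monos_into ?D F" by (simp add: monos_into_iff) (simp add: i_def)
  have "sub_le ?D s i" if s: "s \<in> S" for s
  proof -
    \<comment> \<open>The same components as \<open>s\<close>, with the codomain narrowed to the
      subsheaf \<open>N\<close>.\<close>
    define h where "h = s\<lparr>tgt := N\<rparr>"
    have "loc b (cmp s b x)" if "x \<in> sec (src s) b" for b x
      unfolding loc_def using is_cover_single s that res_id[OF F cmp_in[OF S[OF s] that]]
      by (intro exI[of _ "{b}"]) auto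
    then have inN: "cmp s b x \<in> sec N b" if "x \<in> sec (src s) b" for b x
      using that cmp_in[OF S[OF s]] by (auto simp: secN)
    have "cmp s b \<in> sec (src s) b \<rightarrow>\<^sub>E sec N b" for b
      using inN S[OF s] unfolding sheaf_hom_iff is_psh_map_def by (auto simp: PiE_iff)
    then have hh: "h \<in> hom ?D (src s) N"
      using S[OF s] N unfolding sheaf_hom_iff is_psh_map_def by (auto simp: h_def resN)
    have "compose (sec (src s) b) (restrict id (sec N b)) (cmp s b) = cmp s b" for b
      using inN S[OF s] unfolding sheaf_hom_iff is_psh_map_def
      by (auto simp: compose_def fun_eq_iff PiE_def extensional_def)
    moreover have "tgt s = F" using S[OF s] by (simp add: sheaf_hom_iff)
    ultimately have "i \<cdot>\<^bsub>?D\<^esub> h = s" by (simp add: sheaf_cat_def i_def h_def)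
    then show ?thesis unfolding sub_le_def using hh si by auto
  qed
  then have "sub_le ?D m i" using is_unionD(4)[OF un im] by blast
  then obtain h where h: "h \<in> hom ?D (src m) N" "i \<cdot>\<^bsub>?D\<^esub> h = m" using si by (auto simp: sub_le_def)
  have "r \<in> sec (src h) b" using r h(1) by (simp add: sheaf_hom_iff)
  then have "cmp m b r = cmp i b (cmp h b r)" using cmp_comp[of r h b, where \<theta> = i and \<kappa> = \<kappa>] h(2) by simp
  then have "cmp m b r \<in> sec N b" using cmp_in[OF h(1) r] by (simp add: i_def)
  then show ?thesis by (simp add: secN loc_def)
qed

end

section \<open>Boolean lattices in terms of their order\<close>

text \<open>The order of \<open>L1\<close> is accessible through representatives, so a complement is
  restated by the order alone: what lies below both elements is below everything, and what lies
  above both is above everything.\<close>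

lemma boolean_lattice_complement:
  assumes L: "is_boolean_lattice L" and X: "X \<in> carrier L"
  obtains Y where "Y \<in> carrier L"
    "\<And>Z W. Z \<in> carrier L \<Longrightarrow> W \<in> carrier L \<Longrightarrow> Z \<sqsubseteq>\<^bsub>L\<^esub> X \<Longrightarrow> Z \<sqsubseteq>\<^bsub>L\<^esub> Y \<Longrightarrow> Z \<sqsubseteq>\<^bsub>L\<^esub> W"
    "\<And>Z W. Z \<in> carrier L \<Longrightarrow> W \<in> carrier L \<Longrightarrow> X \<sqsubseteq>\<^bsub>L\<^esub> Z \<Longrightarrow> Y \<sqsubseteq>\<^bsub>L\<^esub> Z \<Longrightarrow> W \<sqsubseteq>\<^bsub>L\<^esub> Z"
proof -
  interpret bounded_lattice L using L by (simp add: is_boolean_lattice_def)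
  obtain Y where Y: "Y \<in> carrier L" "X \<sqinter>\<^bsub>L\<^esub> Y = \<bottom>\<^bsub>L\<^esub>" "X \<squnion>\<^bsub>L\<^esub> Y = \<top>\<^bsub>L\<^esub>"
    using L X unfolding is_boolean_lattice_def by blast
  have "Z \<sqsubseteq>\<^bsub>L\<^esub> W" if "Z \<in> carrier L" "W \<in> carrier L" "Z \<sqsubseteq>\<^bsub>L\<^esub> X" "Z \<sqsubseteq>\<^bsub>L\<^esub> Y" for Z W
    using meet_le[OF that(3,4) X Y(1) that(1)] bottom_lower[OF that(2)] Y(2)
      le_trans[of Z "\<bottom>\<^bsub>L\<^esub>" W] that(1,2) by simp
  moreover have "W \<sqsubseteq>\<^bsub>L\<^esub> Z" if "Z \<in> carrier L" "W \<in> carrier L" "X \<sqsubseteq>\<^bsub>L\<^esub> Z" "Y \<sqsubseteq>\<^bsub>L\<^esub> Z" for Z W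
    using join_le[OF that(3,4) X Y(1) that(1)] top_higher[OF that(2)] Y(3)
      le_trans[of W "\<top>\<^bsub>L\<^esub>" Z] that(1,2) by simp
  ultimately show thesis using that Y(1) by blast
qed

text \<open>The operations of a \<open>gorder\<close> are computed from its order. Transporting
  those of \<open>'b\<close> along the bijection gives greatest lower and least upper bounds, which
  uniqueness identifies with the chosen ones; the assumption \<open>eq\<close> turns uniqueness up
  to equivalence into equality.\<close>

lemma boolean_lattice_of_isomorphic:
  fixes L :: "'a gorder"
  assumes eq: "eq L = (=)" and iso: "lattice_isomorphic L (order_of_type :: 'b::boolean_algebra gorder)"
  shows "is_boolean_lattice L"
proof -
  obtain \<phi> :: "'a \<Rightarrow> 'b" where bij: "bij_betw \<phi> (carrier L) UNIV"
    and le: "\<And>x y. x \<in> carrier L \<Longrightarrow> y \<in> carrier L \<Longrightarrow> x \<sqsubseteq>\<^bsub>L\<^esub> y \<longleftrightarrow> \<phi> x \<le> \<phi> y"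
    using iso unfolding lattice_isomorphic_def order_of_type_def by auto
  have inj: "x = y \<longleftrightarrow> \<phi> x = \<phi> y" if "x \<in> carrier L" "y \<in> carrier L" for x y
    using bij that unfolding bij_betw_def inj_on_def by blast
  define \<psi> where "\<psi> = inv_into (carrier L) \<phi>"
  have \<psi>: "\<psi> b \<in> carrier L" "\<phi> (\<psi> b) = b" for b
    using bij unfolding \<psi>_def bij_betw_def by (auto intro: inv_into_into f_inv_into_f)
  have inf: "greatest L (\<psi> (inf (\<phi> x) (\<phi> y))) (Lower L {x, y})" if "x \<in> carrier L" "y \<in> carrier L" for x y
    using that by (auto simp: greatest_def Lower_def le \<psi>)
  have sup: "least L (\<psi> (sup (\<phi> x) (\<phi> y))) (Upper L {x, y})" if "x \<in> carrier L" "y \<in> carrier L" for x y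
    using that by (auto simp: least_def Upper_def le \<psi>)
  have bot: "least L (\<psi> bot) (carrier L)" by (auto simp: least_def le \<psi>)
  have top: "greatest L (\<psi> top_class.top) (carrier L)" by (auto simp: greatest_def le \<psi>)
  interpret bounded_lattice L
  proof unfold_locales
    show "\<exists>s. least L s (Upper L {x, y})" if "x \<in> carrier L" "y \<in> carrier L" for x y
      using sup that by blast
    show "\<exists>s. greatest L s (Lower L {x, y})" if "x \<in> carrier L" "y \<in> carrier L" for x y
      using inf that by blast
    show "\<exists>x. least L x (carrier L)" using bot by blast
    show "\<exists>x. greatest L x (carrier L)" using top by blast
  qed (auto simp: eq le inj)
  have meet: "x \<sqinter>\<^bsub>L\<^esub> y = \<psi> (inf (\<phi> x) (\<phi> y))" if "x \<in> carrier L" "y \<in> carrier L" for x y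
    unfolding meet_def Lattice.inf_def
    using someI[of "\<lambda>z. greatest L z (Lower L {x, y})", OF inf[OF that]] greatest_unique inf[OF that] by blast
  have join: "x \<squnion>\<^bsub>L\<^esub> y = \<psi> (sup (\<phi> x) (\<phi> y))" if "x \<in> carrier L" "y \<in> carrier L" for x y
    unfolding join_def Lattice.sup_def
    using someI[of "\<lambda>z. least L z (Upper L {x, y})", OF sup[OF that]] least_unique sup[OF that] by blast
  have "\<bottom>\<^bsub>L\<^esub> = \<psi> bot" using least_unique[OF bottom_least bot] .
  moreover have "\<top>\<^bsub>L\<^esub> = \<psi> top_class.top" using greatest_unique[OF top_greatest top] .
  moreover have "\<exists>y\<in>carrier L. x \<sqinter>\<^bsub>L\<^esub> y = \<psi> bot \<and> x \<squnion>\<^bsub>L\<^esub> y = \<psi> top_class.top" if "x \<in> carrier L" for x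
    using that by (intro bexI[of _ "\<psi> (- \<phi> x)"]) (simp_all add: meet join \<psi>)
  ultimately show ?thesis
    unfolding is_boolean_lattice_def using bounded_lattice_axioms
    by (simp add: meet join \<psi> inf_sup_distrib1)
qed

section \<open>Models in sheaves\<close>

text \<open>The type class gives \<open>'b\<close> only finite joins; \<kappa>-small ones come from
  \<kappa>-coherence of the algebra as a category. Every arrow of a poset is monic, so subobjects of
  \<open>top\<close> are the elements of the algebra and unions are joins.\<close>

lemma (in regular_cardinal) is_cover_of_ex:
  fixes T :: "'b::boolean_algebra set"
  assumes B: "kcoherent \<kappa> (order_cat :: ('b, 'b \<times> 'b) cat)" and T: "|T| <o \<kappa>"
  shows "\<exists>\<beta>. is_cover \<kappa> \<beta> T"
proof -
  let ?B = "order_cat :: ('b, 'b \<times> 'b) cat"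
  interpret B: kcoherent_category \<kappa> ?B by unfold_locales (rule B)
  have mono: "(c, top_class.top) \<in> monos_into ?B top_class.top" for c :: 'b
    by (auto simp: monos_into_def is_mono_def hom_def order_cat_def preorder_cat_def)
  have "|(\<lambda>c. (c, top_class.top :: 'b)) ` T| <o \<kappa>"
    using ordLeq_ordLess_trans[OF card_of_image T] .
  then obtain m where m: "is_union ?B top_class.top ((\<lambda>c. (c, top_class.top)) ` T) m"
    using B.union_ex[of top_class.top "(\<lambda>c. (c, top_class.top)) ` T"] mono
    by (auto simp: order_cat_def preorder_cat_def)
  have le: "sub_le ?B n n' \<longleftrightarrow> fst n \<le> fst n'"
    if "n \<in> monos_into ?B top_class.top" "n' \<in> monos_into ?B top_class.top" for n n'
    using that by (auto simp: sub_le_def monos_into_def hom_def order_cat_def preorder_cat_def prod_eq_iff)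
  have "is_cover \<kappa> (fst m) T"
    unfolding is_cover_def
  proof (intro conjI ballI allI impI T)
    fix s assume "s \<in> T"
    then show "s \<le> fst m" using is_unionD(3)[OF m] le[OF mono is_unionD(2)[OF m]] by fastforce
  next
    fix c assume c: "\<forall>s\<in>T. s \<le> c"
    have "sub_le ?B m (c, top_class.top)"
      by (rule is_unionD(4)[OF m mono]) (use c le[OF mono mono] in auto)
    then show "fst m \<le> c" using le[OF is_unionD(2)[OF m] mono] by simp
  qed
  then show ?thesis ..
qed

locale kcoherent_model = kcoherent_category \<kappa> C for \<kappa> :: "'k rel" and C :: "('o, 'm) cat" (structure) +
  fixes M :: "('o, 'm, ('b::boolean_algebra, 's) psh, ('b, 's) psh_map) fctr"
  assumes base: "kcoherent \<kappa> (order_cat :: ('b, 'b \<times> 'b) cat)"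
    and model: "kcoherent_functor \<kappa> C (sheaf_cat \<kappa>) M"
begin

abbreviation D :: "(('b, 's) psh, ('b, 's) psh_map) cat" where "D \<equiv> sheaf_cat \<kappa>"

abbreviation S where "S x \<equiv> sec (fobj M x)"
abbreviation R where "R x \<equiv> res (fobj M x)"
abbreviation A where "A f \<equiv> cmp (farr M f)"

section \<open>Action of the model on sections\<close>

lemma M_functor: "is_functor C D M"
  using model by (simp add: kcoherent_functor_def)

sublocale D: category D
  using M_functor by (simp add: is_functor_def)

lemma M_sheaf: "x \<in> Obj C \<Longrightarrow> is_sheaf \<kappa> (fobj M x)"
  using M_functor by (simp add: is_functor_def)

lemma M_hom: "f \<in> hom C x y \<Longrightarrow> farr M f \<in> hom D (fobj M x) (fobj M y)"
  using M_functor unfolding is_functor_def by (auto simp: hom_iff)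

lemma M_src: "f \<in> hom C x y \<Longrightarrow> src (farr M f) = fobj M x"
  using M_hom by (simp add: sheaf_hom_iff)

lemma M_comp: "g \<in> hom C y z \<Longrightarrow> f \<in> hom C x y \<Longrightarrow> farr M (g \<cdot> f) = farr M g \<cdot>\<^bsub>D\<^esub> farr M f"
  using M_functor unfolding is_functor_def by (auto simp: hom_iff)

lemma M_Ident: "x \<in> Obj C \<Longrightarrow> farr M (Ident C x) = Ident D (fobj M x)"
  using M_functor unfolding is_functor_def by simp

lemma act_in: "f \<in> hom C x y \<Longrightarrow> s \<in> S x b \<Longrightarrow> A f b s \<in> S y b"
  by (rule cmp_in[OF M_hom])

lemma act_res: "f \<in> hom C x y \<Longrightarrow> s \<in> S x b \<Longrightarrow> c \<le> b \<Longrightarrow> A f c (R x b c s) = R y b c (A f b s)"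
  by (rule cmp_res[OF M_hom])

lemma act_comp: "g \<in> hom C y z \<Longrightarrow> f \<in> hom C x y \<Longrightarrow> s \<in> S x b \<Longrightarrow> A (g \<cdot> f) b s = A g b (A f b s)"
  by (simp add: M_comp cmp_comp M_src)

lemma act_Ident: "x \<in> Obj C \<Longrightarrow> s \<in> S x b \<Longrightarrow> A (Ident C x) b s = s"
  by (simp add: M_Ident cmp_Ident)

lemma M_limit:
  fixes J :: "('k, 'k) cat"
  assumes "is_functor J C F" "|Arr J| <o \<kappa>" "is_limit C J F c \<pi>"
  shows "is_limit D J (fctr_comp M F) (fobj M c) (\<lambda>j. farr M (\<pi> j))"
proof -
  have "\<forall>(J :: ('k, 'k) cat) F c \<pi>. is_functor J C F \<and> |Arr J| <o \<kappa> \<and> is_limit C J F c \<pi> \<longrightarrow>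
      is_limit D J (fctr_comp M F) (fobj M c) (\<lambda>j. farr M (\<pi> j))"
    using model unfolding kcoherent_functor_def by simp
  then show ?thesis using assms by blast
qed

lemma functor_comp: "is_functor J C F \<Longrightarrow> is_functor J D (fctr_comp M F)"
  using M_functor unfolding is_functor_def by (auto simp: fctr_comp_def hom_iff)

text \<open>A pullback square is read as a limit cone over the cospan shape, which \<open>M\<close>
  preserves, and the image cone is read back as a square of sheaves.\<close>

lemma M_pullback:
  assumes pb: "is_pullback C f g p q"
  shows "is_pullback D (farr M f) (farr M g) (farr M p) (farr M q)"
proof -
  obtain e :: "nat \<Rightarrow> 'k" where e: "inj e" using Cinfinite_inj_nat[OF Cinf] .
  note P = is_pullbackD[OF pb]
  let ?F = "cospan C e f g"
  define \<pi> where "\<pi> k = (if k = e 0 then p else if k = e 1 then q else f \<cdot> p)" for k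
  have s: "farr ?F (e 3) = f" "farr ?F (e 4) = g" "\<pi> (e 0) = p" "\<pi> (e 1) = q" "\<pi> (e 2) = f \<cdot> p"
    by (simp_all add: cospan_def \<pi>_def inj_eq[OF e])
  note F = cospan_functor[OF e category_axioms P(3,4)]
  have "is_limit C (cospan_shape e) ?F (Dom C p) \<pi>"
    using pb unfolding cospan_limit_iff[OF e F] s by simp
  moreover have "|Arr (cospan_shape e)| <o \<kappa>" by (rule finite_less) (simp add: cospan_shape_def)
  ultimately have "is_limit D (cospan_shape e) (fctr_comp M ?F) (fobj M (Dom C p)) (\<lambda>j. farr M (\<pi> j))"
    using M_limit[OF F] by blast
  then have "is_pullback D (farr (fctr_comp M ?F) (e 3)) (farr (fctr_comp M ?F) (e 4))
      (farr M (\<pi> (e 0))) (farr M (\<pi> (e 1)))"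
    unfolding cospan_limit_iff[OF e functor_comp[OF F]] by (rule conjunct1)
  then show ?thesis by (simp only: fctr_comp_def fctr.simps comp_def s)
qed

lemma act_pullback:
  assumes pb: "is_pullback C f g p q" and h: "f \<in> hom C x z" "g \<in> hom C y z" "p \<in> hom C t x"
    and s: "s \<in> S x b" "s' \<in> S y b" "A f b s = A g b s'"
  obtains r where "r \<in> S t b" "A p b r = s" "A q b r = s'"
  using sheaf_pullback[OF M_pullback[OF pb], of s b s'] s M_src h by auto

lemma act_terminal:
  assumes "is_terminal C x"
  shows "\<exists>!s. s \<in> S x b"
proof -
  let ?J = "empty_shape :: ('k, 'k) cat"
  have "|Arr ?J| <o \<kappa>" by (rule finite_less) (simp add: empty_shape_def)
  then have "is_limit D ?J (fctr_comp M undefined) (fobj M x) (\<lambda>j. farr M (undefined j))"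
    using M_limit[OF empty_shape_functor[OF category_axioms]] assms empty_shape_limit by metis
  then show ?thesis by (rule sheaf_terminal[OF iffD1[OF empty_shape_limit]])
qed

text \<open>A mono is recognized by its kernel pair: the square of \<open>m\<close> with itself and
  two identities is a pullback, and \<open>M\<close> preserves it.\<close>

lemma act_mono:
  assumes "m \<in> monos_into C x"
  shows "inj_on (A m b) (S (Dom C m) b)"
proof (rule inj_onI)
  have m: "m \<in> hom C (Dom C m) x" using assms by (rule monos_into_hom)
  then have o: "Dom C m \<in> Obj C" using hom_obj by blast
  have "\<exists>q. is_pullback C m m (Ident C (Dom C m)) q"
    unfolding pullback_of_mono_iff[OF m assms]
    using Ident_mono[OF o] sub_le_Ident sub_le_self_comp[OF m] by blast
  then obtain q where pb: "is_pullback C m m (Ident C (Dom C m)) q" ..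
  have q: "q \<in> hom C (Dom C m) (Dom C m)"
    using is_pullbackD(2)[OF pb] Ident_in[OF o] by (simp add: hom_iff)
  have "m \<cdot> q = m \<cdot> Ident C (Dom C m)" using is_pullbackD(5)[OF pb] by simp
  then have q_id: "q = Ident C (Dom C m)"
    using is_monoD[of C m] assms q Ident_in[OF o] by (auto simp: monos_into_iff)
  fix s t assume st: "s \<in> S (Dom C m) b" "t \<in> S (Dom C m) b" "A m b s = A m b t"
  obtain r where "r \<in> S (Dom C m) b" "A (Ident C (Dom C m)) b r = s" "A q b r = t"
    using act_pullback[OF pb m m Ident_in[OF o] st] .
  then show "s = t" using act_Ident[OF o] q_id by simp
qed

lemma M_mono: "m \<in> monos_into C x \<Longrightarrow> farr M m \<in> monos_into D (fobj M x)"
  using sheaf_mono_iff[OF M_hom[OF monos_into_hom]] act_mono M_hom[OF monos_into_hom]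
  by (fastforce simp: monos_into_iff sheaf_hom_iff)

text \<open>For monic \<open>u\<close> with codomain x these are the sections over \<open>b\<close>
  of the subsheaf M u of M x. For an arbitrary arrow the image is taken section by section, without
  passing to local membership.\<close>

definition img :: "'m \<Rightarrow> 'b \<Rightarrow> 's set" where
  "img u b = A u b ` S (Dom C u) b"

lemma img_iff: "u \<in> hom C y x \<Longrightarrow> s \<in> img u b \<longleftrightarrow> (\<exists>r\<in>S y b. s = A u b r)"
  by (auto simp: img_def hom_iff)

lemma img_res:
  assumes "u \<in> hom C y x" "s \<in> img u b" "c \<le> b"
  shows "R x b c s \<in> img u c"
proof -
  obtain r where "r \<in> S y b" "s = A u b r" using assms img_iff by blast
  then show ?thesis using act_res[OF assms(1) _ assms(3)] res_in[OF M_sheaf _ assms(3)]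
      hom_obj[OF assms(1)] img_iff[OF assms(1)] by metis
qed

lemma img_sub_le:
  assumes "sub_le C u v" "u \<in> hom C y x" "v \<in> hom C z x" "s \<in> img u b"
  shows "s \<in> img v b"
proof -
  obtain h where h: "h \<in> hom C y z" "v \<cdot> h = u" using assms(1) sub_le_iff[OF assms(2,3)] by blast
  obtain r where r: "r \<in> S y b" "s = A u b r" using assms(2,4) img_iff by blast
  then have "s = A v b (A h b r)" using act_comp[OF assms(3) h(1) r(1)] h(2) by simp
  then show ?thesis using act_in[OF h(1) r(1)] img_iff[OF assms(3)] by blast
qed

lemma img_glue:
  assumes u: "u \<in> monos_into C x" and T: "is_cover \<kappa> b T" and s: "s \<in> S x b"
    and im: "\<And>c. c \<in> T \<Longrightarrow> R x b c s \<in> img u c"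
  shows "s \<in> img u b"
  using sheaf_glue_image[OF M_hom[OF monos_into_hom[OF u]] _ T s] M_mono[OF u] im
  unfolding img_def monos_into_iff by blast

lemma img_pullback:
  assumes pb: "is_pullback C f u n q" and f: "f \<in> hom C z x" and u: "u \<in> hom C y x" and s: "s \<in> S z b"
  shows "s \<in> img n b \<longleftrightarrow> A f b s \<in> img u b"
proof -
  have n: "n \<in> hom C (Dom C n) z" and q: "q \<in> hom C (Dom C n) y"
    using is_pullbackD[OF pb] f u by (auto simp: hom_iff)
  show ?thesis
  proof
    assume "s \<in> img n b"
    then obtain r where r: "r \<in> S (Dom C n) b" "s = A n b r" using img_iff[OF n] by blast
    have "A f b s = A u b (A q b r)"
      using act_comp[OF f n r(1)] act_comp[OF u q r(1)] r(2) is_pullbackD(5)[OF pb] by simp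
    then show "A f b s \<in> img u b" using act_in[OF q r(1)] img_iff[OF u] by blast
  next
    assume "A f b s \<in> img u b"
    then obtain r where r: "r \<in> S y b" "A f b s = A u b r" using img_iff[OF u] by blast
    obtain r' where "r' \<in> S (Dom C n) b" "A n b r' = s" using act_pullback[OF pb f u n s r] .
    then show "s \<in> img n b" using img_iff[OF n] by blast
  qed
qed

lemma img_inter:
  assumes pb: "is_pullback C u v p q" and u: "u \<in> hom C y x" and v: "v \<in> hom C z x"
    and s: "s \<in> img u b" "s \<in> img v b"
  shows "s \<in> img (u \<cdot> p) b"
proof -
  have p: "p \<in> hom C (Dom C p) y" using is_pullbackD(1)[OF pb] u by (simp add: hom_iff)
  obtain r where r: "r \<in> S y b" "s = A u b r" using s(1) img_iff[OF u] by blast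
  then have "r \<in> img p b" using img_pullback[OF pb u v r(1)] s(2) by simp
  then obtain r' where "r' \<in> S (Dom C p) b" "r = A p b r'" using img_iff[OF p] by blast
  then show ?thesis using act_comp[OF u p] r(2) img_iff[OF comp_in[OF u p]] by metis
qed

text \<open>Sections of a union need not lie in one of the members, but they do so locally:
  \<open>M\<close> turns the \<kappa>-small union into a union of subsheaves, to which
  \<open>union_sections\<close> applies.\<close>

lemma act_union:
  assumes un: "is_union C x U m" and U: "|U| <o \<kappa>" and s: "s \<in> img m b"
  obtains T where "is_cover \<kappa> b T" "\<And>c. c \<in> T \<Longrightarrow> \<exists>u\<in>U. R x b c s \<in> img u c"
proof -
  have m: "m \<in> hom C (Dom C m) x" by (rule monos_into_hom[OF is_unionD(2)[OF un]])
  have "\<forall>x\<in>Obj C. \<forall>S m. |S| <o \<kappa> \<and> is_union C x S m \<longrightarrow> is_union D (fobj M x) (farr M ` S) (farr M m)"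
    using model unfolding kcoherent_functor_def by simp
  then have un': "is_union D (fobj M x) (farr M ` U) (farr M m)" using un U hom_obj[OF m] by blast
  obtain r where r: "r \<in> S (Dom C m) b" "s = A m b r" using s img_iff[OF m] by blast
  then have "r \<in> sec (src (farr M m)) b" using M_src[OF m] by simp
  then obtain T where T: "is_cover \<kappa> b T"
    "\<forall>c\<in>T. \<exists>g\<in>farr M ` U. R x b c (A m b r) \<in> cmp g c ` sec (src g) c"
    using union_sections[OF un'] by blast
  have "\<exists>u\<in>U. R x b c s \<in> img u c" if c: "c \<in> T" for c
  proof -
    obtain u where u: "u \<in> U" "R x b c s \<in> A u c ` sec (src (farr M u)) c" using T(2) c r(2) by blast
    have "u \<in> hom C (Dom C u) x" by (rule monos_into_hom[OF subsetD[OF is_unionD(1)[OF un] u(1)]])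
    then have "R x b c s \<in> img u c" using u(2) M_src unfolding img_def by simp
    then show ?thesis using u(1) by blast
  qed
  then show thesis using that T(1) by blast
qed

text \<open>On an empty object the identity is the union of the empty family, so a section over
  \<open>b\<close> lies locally in a member of that family. Only the empty cover permits this, and
  it covers \<open>bot\<close> alone.\<close>

lemma act_empty:
  assumes "is_empty_obj C x" "s \<in> S x b"
  shows "b = bot"
proof -
  have x: "x \<in> Obj C" using empty_obj_obj[OF assms(1)] .
  have s: "s \<in> img (Ident C x) b" using img_iff[OF Ident_in[OF x]] act_Ident[OF x] assms(2) by metis
  obtain T where T: "is_cover \<kappa> b T" "\<And>c. c \<in> T \<Longrightarrow> \<exists>u\<in>{}. R x b c s \<in> img u c"
    by (rule act_union[OF assms(1)[unfolded is_empty_obj_def] finite_less[OF finite.emptyI] s]) blast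
  then have "T = {}" by blast
  then show ?thesis using is_cover_empty_bot T(1) by blast
qed

lemma img_disjoint:
  assumes d: "disjoint_arrows C u v" and u: "u \<in> hom C y x" and v: "v \<in> hom C z x"
    and s: "s \<in> img u b" "s \<in> img v b"
  shows "b = bot"
proof -
  obtain t p q where p: "p \<in> hom C t y" "q \<in> hom C t z" "is_pullback C u v p q"
    using pullback_ex[OF u v] .
  have "sub_le C (u \<cdot> p) v" using sub_le_self_comp[OF v p(2)] is_pullbackD(5)[OF p(3)] by simp
  then have "is_empty_obj C t" using disjoint_arrowsD[OF d u p(1)] by blast
  moreover obtain r where "r \<in> S t b"
    using img_inter[OF p(3) u v s] img_iff[OF comp_in[OF u p(1)]] by blast
  ultimately show ?thesis by (rule act_empty)
qed

text \<open>The product of \<open>x\<close> and \<open>y\<close>, as a pullback over the terminal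
  object, is a common stage for the two sections: their images agree because M of the terminal
  object has just one section over \<open>b\<close>.\<close>

lemma product_ex:
  assumes "x \<in> Obj C" "y \<in> Obj C" "a \<in> S x b" "a' \<in> S y b"
  obtains z f g c where "f \<in> hom C z x" "g \<in> hom C z y" "c \<in> S z b" "A f b c = a" "A g b c = a'"
proof -
  obtain w where w: "is_terminal C w" using terminal_ex ..
  obtain f g where f: "f \<in> hom C x w" "g \<in> hom C y w" using w assms(1,2) unfolding is_terminal_def by blast
  obtain z p q where p: "p \<in> hom C z x" "q \<in> hom C z y" "is_pullback C f g p q" using pullback_ex[OF f] .
  have "A f b a = A g b a'"
    using act_terminal[OF w] act_in[OF f(1) assms(3)] act_in[OF f(2) assms(4)] by blast
  then obtain r where "r \<in> S z b" "A p b r = a" "A q b r = a'"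
    using act_pullback[OF p(3) f p(1) assms(3,4)] by blast
  then show thesis using that p(1,2) by blast
qed

section \<open>The lattice \<open>L\<^sup>1\<close> of global sections\<close>

abbreviation L where "L \<equiv> L1 C (global_sections M)"

section \<open>Representatives of elements of the colimit\<close>

definition elem :: "'o \<Rightarrow> 's \<Rightarrow> 'm \<Rightarrow> bool" where
  "elem x a u \<longleftrightarrow> x \<in> Obj C \<and> a \<in> S x top_class.top \<and> u \<in> monos_into C x"

text \<open>\<open>Q\<close> is instantiated with \<open>(=)\<close> for equality in the colimit and
  with implication for its order, so both are developed at once. The span of \<open>f\<close> and
  \<open>g\<close> with section \<open>c\<close> is a common later stage, and the pullbacks of
  \<open>u\<close> and \<open>v\<close> to it are compared by their generalized elements, without
  choosing them.\<close>

definition related :: "(bool \<Rightarrow> bool \<Rightarrow> bool) \<Rightarrow> 'o \<Rightarrow> 's \<Rightarrow> 'm \<Rightarrow> 'o \<Rightarrow> 's \<Rightarrow> 'm \<Rightarrow> bool" where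
  "related Q x a u y b v \<longleftrightarrow> (\<exists>z f g. \<exists>c\<in>S z top_class.top. f \<in> hom C z x \<and> g \<in> hom C z y \<and>
    A f top_class.top c = a \<and> A g top_class.top c = b \<and>
    (\<forall>t. \<forall>p\<in>hom C t z. Q (sub_le C (f \<cdot> p) u) (sub_le C (g \<cdot> p) v)))"

definition sub_class :: "'o \<Rightarrow> 'm \<Rightarrow> 'm set" where
  "sub_class x u = {n \<in> monos_into C x. sub_le C u n \<and> sub_le C n u}"

definition L_class :: "'o \<Rightarrow> 's \<Rightarrow> 'm \<Rightarrow> (('o \<times> 's) \<times> 'm set) set" where
  "L_class x a u = {((y, b), sub_class y v) | y b v. elem y b v \<and> related (=) x a u y b v}"

lemma relatedI:
  assumes "f \<in> hom C z x" "g \<in> hom C z y" "c \<in> S z top_class.top"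
    "A f top_class.top c = a" "A g top_class.top c = b"
    "\<And>t p. p \<in> hom C t z \<Longrightarrow> Q (sub_le C (f \<cdot> p) u) (sub_le C (g \<cdot> p) v)"
  shows "related Q x a u y b v"
  using assms unfolding related_def by blast

lemma relatedE:
  assumes "related Q x a u y b v"
  obtains z f g c where "f \<in> hom C z x" "g \<in> hom C z y" "c \<in> S z top_class.top"
    "A f top_class.top c = a" "A g top_class.top c = b"
    "\<And>t p. p \<in> hom C t z \<Longrightarrow> Q (sub_le C (f \<cdot> p) u) (sub_le C (g \<cdot> p) v)"
  using assms unfolding related_def by blast

lemma related_mono: "related Q x a u y b v \<Longrightarrow> (\<And>P P'. Q P P' \<Longrightarrow> Q' P P') \<Longrightarrow> related Q' x a u y b v"
  unfolding related_def by blast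

lemma related_refl: "elem x a u \<Longrightarrow> (\<And>P. Q P P) \<Longrightarrow> related Q x a u x a u"
  unfolding elem_def by (rule relatedI[of "Ident C x" x x "Ident C x" x a]) (auto simp: Ident_in act_Ident)

lemma related_sym: "related (=) x a u y b v \<Longrightarrow> related (=) y b v x a u"
  unfolding related_def by metis

text \<open>Spans compose by pullback. The sections \<open>c\<close> and \<open>c'\<close> have the
  same image at the middle index, and since \<open>M\<close> preserves pullbacks they come from one
  section \<open>r\<close> of the composite stage.\<close>

lemma related_trans:
  assumes Q: "\<And>P P' P''. Q P P' \<Longrightarrow> Q P' P'' \<Longrightarrow> Q P P''"
    and "related Q x a u y b v" "related Q y b v w d n"
  shows "related Q x a u w d n"
proof -
  obtain z f g c where z: "f \<in> hom C z x" "g \<in> hom C z y" "c \<in> S z top_class.top"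
    "A f top_class.top c = a" "A g top_class.top c = b"
    "\<And>t p. p \<in> hom C t z \<Longrightarrow> Q (sub_le C (f \<cdot> p) u) (sub_le C (g \<cdot> p) v)" by (rule relatedE[OF assms(2)]) (rule that)
  obtain z' f' g' c' where z': "f' \<in> hom C z' y" "g' \<in> hom C z' w" "c' \<in> S z' top_class.top"
    "A f' top_class.top c' = b" "A g' top_class.top c' = d"
    "\<And>t p. p \<in> hom C t z' \<Longrightarrow> Q (sub_le C (f' \<cdot> p) v) (sub_le C (g' \<cdot> p) n)" by (rule relatedE[OF assms(3)]) (rule that)
  obtain s p q where p: "p \<in> hom C s z" "q \<in> hom C s z'" "is_pullback C g f' p q"
    using pullback_ex[OF z(2) z'(1)] .
  have "A g top_class.top c = A f' top_class.top c'" using z(5) z'(4) by simp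
  then obtain r where r: "r \<in> S s top_class.top" "A p top_class.top r = c" "A q top_class.top r = c'"
    by (rule act_pullback[OF p(3) z(2) z'(1) p(1) z(3) z'(3)])
  show ?thesis
  proof (rule relatedI[OF comp_in[OF z(1) p(1)] comp_in[OF z'(2) p(2)] r(1)])
    show "A (f \<cdot> p) top_class.top r = a" "A (g' \<cdot> q) top_class.top r = d"
      using act_comp[OF z(1) p(1) r(1)] act_comp[OF z'(2) p(2) r(1)] r(2,3) z(4) z'(5) by simp_all
    fix t h assume h: "h \<in> hom C t s"
    have eq: "g \<cdot> (p \<cdot> h) = f' \<cdot> (q \<cdot> h)"
      using assoc[OF z(2) p(1) h] assoc[OF z'(1) p(2) h] is_pullbackD(5)[OF p(3)] by simp
    have "Q (sub_le C (f \<cdot> (p \<cdot> h)) u) (sub_le C (g' \<cdot> (q \<cdot> h)) n)"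
      by (rule Q[OF z(6)[OF comp_in[OF p(1) h], unfolded eq] z'(6)[OF comp_in[OF p(2) h]]])
    then show "Q (sub_le C (f \<cdot> p \<cdot> h) u) (sub_le C (g' \<cdot> q \<cdot> h) n)"
      using assoc[OF z(1) p(1) h] assoc[OF z'(2) p(2) h] by simp
  qed
qed

section \<open>Transition maps, elements and order of the colimit\<close>

lemma sub_class_self: "u \<in> monos_into C x \<Longrightarrow> u \<in> sub_class x u"
  using sub_le_refl[OF monos_into_hom] by (simp add: sub_class_def)

lemma carrier_Sub: "carrier (Sub C x) = sub_class x ` monos_into C x"
  by (auto simp: Sub_def sub_class_def quotient_def)

lemma pullbacks_along_sub_class:
  assumes f: "f \<in> hom C z x" and u: "u \<in> monos_into C x"
  shows "pullbacks_along C f (sub_class x u) =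
    {n \<in> monos_into C z. \<forall>t. \<forall>p\<in>hom C t z. sub_le C p n \<longleftrightarrow> sub_le C (f \<cdot> p) u}"
proof -
  have "(\<exists>q. is_pullback C f m n q) \<longleftrightarrow> (\<exists>q. is_pullback C f u n q)" if m: "m \<in> sub_class x u" for m n
  proof -
    have m': "m \<in> monos_into C x" "sub_le C u m" "sub_le C m u" using m by (auto simp: sub_class_def)
    then have "sub_le C g m \<longleftrightarrow> sub_le C g u" for g
      using sub_le_trans monos_into_hom[OF m'(1)] monos_into_hom[OF u] by blast
    then show ?thesis unfolding pullback_of_mono_iff[OF f m'(1)] pullback_of_mono_iff[OF f u] by simp
  qed
  then have "pullbacks_along C f (sub_class x u) = {n. \<exists>q. is_pullback C f u n q}"
    unfolding pullbacks_along_def using sub_class_self[OF u] by blast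
  then show ?thesis unfolding pullback_of_mono_iff[OF f u] .
qed

lemma pullbacks_along_eq_iff:
  assumes f: "f \<in> hom C z x" "u \<in> monos_into C x" and g: "g \<in> hom C z y" "v \<in> monos_into C y"
  shows "pullbacks_along C f (sub_class x u) = pullbacks_along C g (sub_class y v) \<longleftrightarrow>
    (\<forall>t. \<forall>p\<in>hom C t z. sub_le C (f \<cdot> p) u \<longleftrightarrow> sub_le C (g \<cdot> p) v)"
proof
  assume eq: "pullbacks_along C f (sub_class x u) = pullbacks_along C g (sub_class y v)"
  obtain n q where "n \<in> monos_into C z" "\<And>t p. p \<in> hom C t z \<Longrightarrow> sub_le C p n \<longleftrightarrow> sub_le C (f \<cdot> p) u"
    using pullback_mono_ex[OF f] by metis
  then have "n \<in> pullbacks_along C g (sub_class y v)" "\<forall>t. \<forall>p\<in>hom C t z. sub_le C p n \<longleftrightarrow> sub_le C (f \<cdot> p) u"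
    using eq pullbacks_along_sub_class[OF f] by auto
  then show "\<forall>t. \<forall>p\<in>hom C t z. sub_le C (f \<cdot> p) u \<longleftrightarrow> sub_le C (g \<cdot> p) v"
    using pullbacks_along_sub_class[OF g] by blast
next
  assume "\<forall>t. \<forall>p\<in>hom C t z. sub_le C (f \<cdot> p) u \<longleftrightarrow> sub_le C (g \<cdot> p) v"
  then show "pullbacks_along C f (sub_class x u) = pullbacks_along C g (sub_class y v)"
    using pullbacks_along_sub_class[OF f] pullbacks_along_sub_class[OF g] by simp
qed

lemma pullbacks_along_le_iff:
  assumes f: "f \<in> hom C z x" "u \<in> monos_into C x" and g: "g \<in> hom C z y" "v \<in> monos_into C y"
  shows "pullbacks_along C f (sub_class x u) \<sqsubseteq>\<^bsub>Sub C z\<^esub> pullbacks_along C g (sub_class y v) \<longleftrightarrow>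
    (\<forall>t. \<forall>p\<in>hom C t z. sub_le C (f \<cdot> p) u \<longrightarrow> sub_le C (g \<cdot> p) v)" (is "?l \<longleftrightarrow> ?r")
proof -
  have l: "?l \<longleftrightarrow> (\<exists>m\<in>pullbacks_along C f (sub_class x u). \<exists>n\<in>pullbacks_along C g (sub_class y v). sub_le C m n)"
    by (simp add: Sub_def)
  show ?thesis
  proof
    assume ?l
    then obtain m n where mn: "sub_le C m n" and "m \<in> pullbacks_along C f (sub_class x u)"
      "n \<in> pullbacks_along C g (sub_class y v)" unfolding l by blast
    then have m: "m \<in> monos_into C z" "\<forall>t. \<forall>p\<in>hom C t z. sub_le C p m \<longleftrightarrow> sub_le C (f \<cdot> p) u"
      and n: "n \<in> monos_into C z" "\<forall>t. \<forall>p\<in>hom C t z. sub_le C p n \<longleftrightarrow> sub_le C (g \<cdot> p) v"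
      using pullbacks_along_sub_class[OF f] pullbacks_along_sub_class[OF g] by blast+
    then show ?r using sub_le_trans[OF _ mn monos_into_hom[OF n(1)]] by blast
  next
    assume r: ?r
    obtain m where m: "m \<in> monos_into C z" "\<And>t p. p \<in> hom C t z \<Longrightarrow> sub_le C p m \<longleftrightarrow> sub_le C (f \<cdot> p) u"
      using pullback_mono_ex[OF f] by metis
    obtain n where n: "n \<in> monos_into C z" "\<And>t p. p \<in> hom C t z \<Longrightarrow> sub_le C p n \<longleftrightarrow> sub_le C (g \<cdot> p) v"
      using pullback_mono_ex[OF g] by metis
    have "sub_le C m n" using m n r sub_le_refl[OF monos_into_hom[OF m(1)]] monos_into_hom[OF m(1)] by blast
    moreover have "m \<in> pullbacks_along C f (sub_class x u)" "n \<in> pullbacks_along C g (sub_class y v)"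
      unfolding pullbacks_along_sub_class[OF f] pullbacks_along_sub_class[OF g] using m n by auto
    ultimately show ?l unfolding l by blast
  qed
qed

abbreviation J where "J \<equiv> op_cat (elements C (global_sections M))"
abbreviation tr where "tr \<equiv> \<lambda>(p :: 'o \<times> 's, f, q :: 'o \<times> 's). pullbacks_along C f"

lemma hom_J_iff:
  "e \<in> hom J (x, a) k \<longleftrightarrow> (\<exists>z c f. k = (z, c) \<and> e = ((z, c), f, (x, a)) \<and> f \<in> hom C z x \<and>
    c \<in> S z top_class.top \<and> a \<in> S x top_class.top \<and> A f top_class.top c = a)"
  by (cases k) (auto simp: hom_def op_cat_def elements_def global_sections_def)

lemma Obj_J_iff: "(x, a) \<in> Obj J \<longleftrightarrow> x \<in> Obj C \<and> a \<in> S x top_class.top"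
  by (auto simp: op_cat_def elements_def global_sections_def)

text \<open>An index above both given ones in the opposite of the category of elements is a span in
  \<open>C\<close> carrying a global section. The predicate \<open>P\<close> lets one unfolding
  serve for equality and for the order.\<close>

lemma span_J_iff:
  assumes u: "elem x a u" and v: "elem y b v"
  shows "(\<exists>k. \<exists>f\<in>hom J (x, a) k. \<exists>g\<in>hom J (y, b) k. P k (tr f U) (tr g V)) \<longleftrightarrow>
    (\<exists>z f g. \<exists>c\<in>S z top_class.top. f \<in> hom C z x \<and> g \<in> hom C z y \<and>
      A f top_class.top c = a \<and> A g top_class.top c = b \<and>
      P (z, c) (pullbacks_along C f U) (pullbacks_along C g V))" (is "?l \<longleftrightarrow> ?r")
proof
  assume ?l
  then obtain k e e' where k: "e \<in> hom J (x, a) k" "e' \<in> hom J (y, b) k" "P k (tr e U) (tr e' V)"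
    by blast
  obtain z c f where f: "k = (z, c)" "e = ((z, c), f, (x, a))" "f \<in> hom C z x" "c \<in> S z top_class.top"
    "A f top_class.top c = a" using k(1) unfolding hom_J_iff by blast
  obtain g where g: "e' = ((z, c), g, (y, b))" "g \<in> hom C z y" "A g top_class.top c = b"
    using k(2) f(1) unfolding hom_J_iff by blast
  show ?r using f g k(3) by auto
next
  assume ?r
  then obtain z f g c where z: "c \<in> S z top_class.top" "f \<in> hom C z x" "g \<in> hom C z y"
    "A f top_class.top c = a" "A g top_class.top c = b"
    "P (z, c) (pullbacks_along C f U) (pullbacks_along C g V)" by blast
  have "((z, c), f, (x, a)) \<in> hom J (x, a) (z, c)" "((z, c), g, (y, b)) \<in> hom J (y, b) (z, c)"
    using z u v unfolding hom_J_iff elem_def by blast+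
  moreover have "P (z, c) (tr ((z, c), f, (x, a)) U) (tr ((z, c), g, (y, b)) V)" using z(6) by simp
  ultimately show ?l by blast
qed

lemma related_eq_iff:
  assumes u: "elem x a u" and v: "elem y b v"
  shows "(\<exists>k. \<exists>f\<in>hom J (x, a) k. \<exists>g\<in>hom J (y, b) k. tr f (sub_class x u) = tr g (sub_class y v)) \<longleftrightarrow>
    related (=) x a u y b v"
  unfolding span_J_iff[OF u v, where P = "\<lambda>_. (=)"] related_def
  using pullbacks_along_eq_iff u v unfolding elem_def by blast

lemma related_le_iff:
  assumes u: "elem x a u" and v: "elem y b v"
  shows "(\<exists>k. \<exists>f\<in>hom J (x, a) k. \<exists>g\<in>hom J (y, b) k.
      tr f (sub_class x u) \<sqsubseteq>\<^bsub>(\<lambda>(x, a). Sub C x) k\<^esub> tr g (sub_class y v)) \<longleftrightarrow>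
    related (\<longrightarrow>) x a u y b v"
  unfolding span_J_iff[OF u v, where P = "\<lambda>k. le ((\<lambda>(x, a). Sub C x) k)"] related_def
  using pullbacks_along_le_iff u v unfolding elem_def by (simp cong: conj_cong)

lemma carrier_L: "carrier L = {L_class x a u | x a u. elem x a u}"
proof -
  define E where "E i U j V \<longleftrightarrow> (\<exists>k. \<exists>f\<in>hom J i k. \<exists>g\<in>hom J j k. tr f U = tr g V)" for i U j V
  define r where "r = {((i, u), (j, v)). i \<in> Obj J \<and> u \<in> carrier ((\<lambda>(x, a). Sub C x) i) \<and> j \<in> Obj J \<and>
    v \<in> carrier ((\<lambda>(x, a). Sub C x) j) \<and> E i u j v}"
  have c: "carrier L = (SIGMA j:Obj J. carrier ((\<lambda>(x, a). Sub C x) j)) // r"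
    unfolding L1_def filtered_colim_def r_def E_def by simp
  have sig: "(SIGMA j:Obj J. carrier ((\<lambda>(x, a). Sub C x) j)) =
      {((x, a), sub_class x u) | x a u. elem x a u}"
    by (auto simp: Obj_J_iff carrier_Sub elem_def)
  have "r `` {((x, a), sub_class x u)} = L_class x a u" if u: "elem x a u" for x a u
  proof -
    have "(((x, a), sub_class x u), w) \<in> r \<longleftrightarrow> w \<in> L_class x a u" for w
    proof -
      have "(((x, a), sub_class x u), w) \<in> r \<longleftrightarrow> (\<exists>y b v. elem y b v \<and> w = ((y, b), sub_class y v) \<and>
          E (x, a) (sub_class x u) (y, b) (sub_class y v))"
        using u by (cases w, auto simp: r_def Obj_J_iff carrier_Sub elem_def, blast)
      then show ?thesis unfolding L_class_def E_def using related_eq_iff[OF u] by blast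
    qed
    then show ?thesis by blast
  qed
  then show ?thesis unfolding c quotient_def sig by fastforce
qed

lemma L_class_self:
  assumes "elem x a u"
  shows "((x, a), sub_class x u) \<in> L_class x a u"
proof -
  have "related (=) x a u x a u" by (rule related_refl[OF assms]) simp
  then show ?thesis unfolding L_class_def using assms by simp blast
qed

lemma L_class_eq_iff:
  assumes u: "elem x a u" and v: "elem y b v"
  shows "L_class x a u = L_class y b v \<longleftrightarrow> related (=) x a u y b v"
proof
  assume eq: "L_class x a u = L_class y b v"
  have "((y, b), sub_class y v) \<in> L_class x a u" unfolding eq by (rule L_class_self[OF v])
  \<comment> \<open>Membership records the subobject represented by \<open>v\<close>, not the mono
    itself, so it yields a possibly different mono \<open>v'\<close> of the same class, which must
    still be related to \<open>v\<close>.\<close>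
  then obtain v' where v': "elem y b v'" "sub_class y v' = sub_class y v" "related (=) x a u y b v'"
    unfolding L_class_def by auto
  have v'': "related (=) y b v' y b v"
    unfolding related_eq_iff[OF v'(1) v, symmetric] v'(2) unfolding related_eq_iff[OF v v]
    by (rule related_refl[OF v]) simp
  show "related (=) x a u y b v" by (rule related_trans[OF _ v'(3) v'']) simp
next
  assume r: "related (=) x a u y b v"
  have "related (=) x a u w d n \<longleftrightarrow> related (=) y b v w d n" for w d n
    using related_trans[OF _ r, of w d n] related_trans[OF _ related_sym[OF r], of w d n] by auto
  then show "L_class x a u = L_class y b v" unfolding L_class_def by simp
qed

lemma L_class_le_iff:
  assumes u: "elem x a u" and v: "elem y b v"
  shows "L_class x a u \<sqsubseteq>\<^bsub>L\<^esub> L_class y b v \<longleftrightarrow> related (\<longrightarrow>) x a u y b v"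
proof -
  define E where "E i U j V \<longleftrightarrow> (\<exists>k. \<exists>f\<in>hom J i k. \<exists>g\<in>hom J j k.
      tr f U \<sqsubseteq>\<^bsub>(\<lambda>(x, a). Sub C x) k\<^esub> tr g V)" for i U j V
  have le: "L_class x a u \<sqsubseteq>\<^bsub>L\<^esub> L_class y b v \<longleftrightarrow>
    (\<exists>(i, U)\<in>L_class x a u. \<exists>(j, V)\<in>L_class y b v. E i U j V)"
    unfolding L1_def filtered_colim_def E_def by simp
  show ?thesis
  proof
    assume "L_class x a u \<sqsubseteq>\<^bsub>L\<^esub> L_class y b v"
    then have "\<exists>(i, U)\<in>L_class x a u. \<exists>(j, V)\<in>L_class y b v. E i U j V" unfolding le .
    then obtain x' a' u' y' b' v' where u': "elem x' a' u'" "related (=) x a u x' a' u'"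
      and v': "elem y' b' v'" "related (=) y b v y' b' v'"
      and k: "E (x', a') (sub_class x' u') (y', b') (sub_class y' v')"
      unfolding L_class_def by auto
    have 1: "related (\<longrightarrow>) x' a' u' y' b' v'" using k unfolding E_def related_le_iff[OF u'(1) v'(1)] .
    have 2: "related (\<longrightarrow>) x a u x' a' u'" by (rule related_mono[OF u'(2)]) simp
    have 3: "related (\<longrightarrow>) y' b' v' y b v" by (rule related_mono[OF related_sym[OF v'(2)]]) simp
    have 4: "related (\<longrightarrow>) x a u y' b' v'" by (rule related_trans[OF _ 2 1]) simp
    show "related (\<longrightarrow>) x a u y b v" by (rule related_trans[OF _ 4 3]) simp
  next
    assume "related (\<longrightarrow>) x a u y b v"
    then have k: "E (x, a) (sub_class x u) (y, b) (sub_class y v)"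
      unfolding E_def related_le_iff[OF u v] .
    then show "L_class x a u \<sqsubseteq>\<^bsub>L\<^esub> L_class y b v"
      unfolding le using L_class_self[OF u] L_class_self[OF v] by blast
  qed
qed

lemma L_eq: "eq L = (=)"
  by (simp add: L1_def filtered_colim_def)

section \<open>Supports of subobjects at a global section\<close>

lemma inter_img_ex:
  assumes "u \<in> monos_into C x" "v \<in> monos_into C x"
  obtains i where "i \<in> monos_into C x"
    "\<And>t f. f \<in> hom C t x \<Longrightarrow> sub_le C f i \<longleftrightarrow> sub_le C f u \<and> sub_le C f v"
    "\<And>b s. s \<in> img i b \<longleftrightarrow> s \<in> img u b \<and> s \<in> img v b"
proof -
  note u = monos_into_hom[OF assms(1)] and v = monos_into_hom[OF assms(2)]
  obtain p q where pb: "is_pullback C u v p q" and m: "u \<cdot> p \<in> monos_into C x"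
    and le: "\<And>t f. f \<in> hom C t x \<Longrightarrow> sub_le C f (u \<cdot> p) \<longleftrightarrow> sub_le C f u \<and> sub_le C f v"
    using inter_ex[OF assms] by metis
  note i = monos_into_hom[OF m]
  have "sub_le C (u \<cdot> p) u" "sub_le C (u \<cdot> p) v" using le[OF i] sub_le_refl[OF i] by auto
  then have "s \<in> img (u \<cdot> p) b \<longleftrightarrow> s \<in> img u b \<and> s \<in> img v b" for s b
    using img_inter[OF pb u v] img_sub_le[OF _ i u] img_sub_le[OF _ i v] by blast
  then show thesis using that[OF m] le by blast
qed

lemma stage_pullback_ex:
  assumes f: "f \<in> hom C z x" and u: "u \<in> monos_into C x"
  obtains n where "n \<in> monos_into C z"
    "\<And>t p. p \<in> hom C t z \<Longrightarrow> sub_le C p n \<longleftrightarrow> sub_le C (f \<cdot> p) u"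
    "\<And>b s. s \<in> S z b \<Longrightarrow> s \<in> img n b \<longleftrightarrow> A f b s \<in> img u b"
proof -
  obtain n q where "is_pullback C f u n q" "n \<in> monos_into C z"
    "\<And>t p. p \<in> hom C t z \<Longrightarrow> sub_le C p n \<longleftrightarrow> sub_le C (f \<cdot> p) u"
    using pullback_mono_ex[OF f u] by metis
  then show thesis using that img_pullback[OF _ f monos_into_hom[OF u]] by blast
qed

lemma related_stage:
  assumes f: "f \<in> hom C z x" and c: "c \<in> S z top_class.top" "A f top_class.top c = a"
    and n: "\<And>t p. p \<in> hom C t z \<Longrightarrow> sub_le C p n \<longleftrightarrow> sub_le C (f \<cdot> p) u"
  shows "related (=) x a u z c n"
  using n Ident_Comp by (intro relatedI[OF f Ident_in c(1) c(2)]) (auto simp: act_Ident c(1) hom_obj[OF f])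

definition supp :: "'o \<Rightarrow> 's \<Rightarrow> 'm \<Rightarrow> 'b set" where
  "supp x a u = {b. R x top_class.top b a \<in> img u b}"

text \<open>At the common stage the pullback \<open>n\<close> of \<open>u\<close> contains the
  restricted section \<open>c\<close>. As \<open>f \<cdot> n\<close> belongs to \<open>u\<close>,
  the relation makes \<open>g \<cdot> n\<close> belong to \<open>v\<close>, and applying
  \<open>g\<close> puts the restriction of the section \<open>b\<close> into
  \<open>v\<close>.\<close>

lemma related_supp:
  assumes u: "elem x a u" and v: "elem y b v" and r: "related (\<longrightarrow>) x a u y b v"
  shows "supp x a u \<subseteq> supp y b v"
proof
  fix \<beta> assume "\<beta> \<in> supp x a u"
  obtain z f g c where z: "f \<in> hom C z x" "g \<in> hom C z y" "c \<in> S z top_class.top"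
    "A f top_class.top c = a" "A g top_class.top c = b"
    "\<And>t p. p \<in> hom C t z \<Longrightarrow> sub_le C (f \<cdot> p) u \<longrightarrow> sub_le C (g \<cdot> p) v"
    by (rule relatedE[OF r]) (rule that)
  have um: "u \<in> monos_into C x" and vm: "v \<in> monos_into C y" using u v by (auto simp: elem_def)
  obtain n where n: "n \<in> monos_into C z"
    "\<And>t p. p \<in> hom C t z \<Longrightarrow> sub_le C p n \<longleftrightarrow> sub_le C (f \<cdot> p) u"
    "\<And>b s. s \<in> S z b \<Longrightarrow> s \<in> img n b \<longleftrightarrow> A f b s \<in> img u b"
    using stage_pullback_ex[OF z(1) um] by metis
  note nh = monos_into_hom[OF n(1)]
  let ?c = "R z top_class.top \<beta> c"
  have c: "?c \<in> S z \<beta>" using res_in[OF M_sheaf z(3)] hom_obj[OF z(1)] by simp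
  have "A f \<beta> ?c \<in> img u \<beta>" using \<open>\<beta> \<in> supp x a u\<close> act_res[OF z(1,3)] z(4) by (simp add: supp_def)
  then have "?c \<in> img n \<beta>" using n(3)[OF c] by simp
  then obtain r where r: "r \<in> S (Dom C n) \<beta>" "?c = A n \<beta> r" using img_iff[OF nh] by blast
  have "sub_le C (g \<cdot> n) v" using n(2)[OF nh] sub_le_refl[OF nh] z(6)[OF nh] by simp
  moreover have "A g \<beta> ?c \<in> img (g \<cdot> n) \<beta>"
    using act_comp[OF z(2) nh r(1)] r img_iff[OF comp_in[OF z(2) nh]] by metis
  ultimately have "A g \<beta> ?c \<in> img v \<beta>"
    using img_sub_le[OF _ comp_in[OF z(2) nh] monos_into_hom[OF vm]] by blast
  then show "\<beta> \<in> supp y b v" using act_res[OF z(2,3)] z(5) by (simp add: supp_def)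
qed

lemma related_eq_supp:
  assumes u: "elem x a u" and v: "elem y b v" and r: "related (=) x a u y b v"
  shows "supp x a u = supp y b v"
  using related_supp[OF u v related_mono[OF r]] related_supp[OF v u related_mono[OF related_sym[OF r]]]
  by blast

text \<open>Over the part of a member of the support that lies below \<open>- \<beta>\<close> the
  section would be in \<open>u\<close> and in \<open>v\<close>; disjointness shrinks this part to
  \<open>bot\<close>.\<close>

lemma supp_complement:
  assumes u: "elem x a u" and v: "elem x a v" and d: "disjoint_arrows C u v"
    and \<beta>: "R x top_class.top \<beta> a \<in> img u \<beta>" "R x top_class.top (- \<beta>) a \<in> img v (- \<beta>)"
  shows "supp x a u = {b. b \<le> \<beta>}"
proof -
  have um: "u \<in> hom C (Dom C u) x" and vm: "v \<in> hom C (Dom C v) x" and x: "is_sheaf \<kappa> (fobj M x)"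
    and a: "a \<in> S x top_class.top"
    using u v M_sheaf by (auto simp: elem_def monos_into_hom)
  have rr: "R x c b (R x top_class.top c a) = R x top_class.top b a" if "b \<le> c" for b c
    using res_res[OF x a _ that] by simp
  have "b \<le> \<beta>" if "b \<in> supp x a u" for b
  proof -
    have "R x top_class.top (inf b (- \<beta>)) a \<in> img u (inf b (- \<beta>))"
      using img_res[OF um _ inf_le1, of "R x top_class.top b a" b "- \<beta>"] that rr[OF inf_le1[of b "- \<beta>"]]
      by (simp add: supp_def)
    moreover have "R x top_class.top (inf b (- \<beta>)) a \<in> img v (inf b (- \<beta>))"
      using img_res[OF vm \<beta>(2) inf_le2[of b]] rr[OF inf_le2[of b "- \<beta>"]] by simp
    ultimately have "inf b (- \<beta>) = bot" by (rule img_disjoint[OF d um vm])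
    then show ?thesis by (simp add: inf_shunt)
  qed
  moreover have "b \<in> supp x a u" if "b \<le> \<beta>" for b
    using img_res[OF um \<beta>(1) that] rr[OF that] by (simp add: supp_def)
  ultimately show ?thesis by blast
qed

subsection \<open>Strong positive closedness makes supports principal\<close>

lemma strongly_positively_closed_decomposition:
  assumes spc: "strongly_positively_closed C D M" and u: "elem x a u"
  obtains \<beta> v where "elem x a v" "disjoint_arrows C u v"
    "R x top_class.top \<beta> a \<in> img u \<beta>" "R x top_class.top (- \<beta>) a \<in> img v (- \<beta>)"
proof -
  have x: "x \<in> Obj C" and a: "a \<in> S x top_class.top" and um: "u \<in> monos_into C x"
    using u by (auto simp: elem_def)
  note F = M_sheaf[OF x] and uh = monos_into_hom[OF um]
  have rr: "R x c b (R x top_class.top c a) = R x top_class.top b a" if "b \<le> c" for b c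
    using res_res[OF F a _ that] by simp
  have ra: "R x top_class.top c a \<in> S x c" for c using res_in[OF F a] by simp
  define V where "V = {v \<in> monos_into C x. sub_disjoint C x v u}"
  have un: "is_union D (fobj M x) (insert (farr M u) (farr M ` V)) (Ident D (fobj M x))"
    using spc x um unfolding strongly_positively_closed_def V_def by blast
  have "a \<in> sec (src (Ident D (fobj M x))) top_class.top" using a by (simp add: sheaf_cat_def)
  then obtain T where T: "is_cover \<kappa> top_class.top T" and
    "\<forall>c\<in>T. \<exists>g\<in>insert (farr M u) (farr M ` V).
      R x top_class.top c (cmp (Ident D (fobj M x)) top_class.top a) \<in> cmp g c ` sec (src g) c"
    using union_sections[OF un] by blast
  then have loc: "\<forall>c\<in>T. \<exists>w\<in>insert u V. R x top_class.top c a \<in> A w c ` sec (src (farr M w)) c"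
    using cmp_Ident[OF a, where \<kappa> = \<kappa>] by simp
  have Vm: "v \<in> monos_into C x" "disjoint_arrows C u v" if "v \<in> V" for v
    using that sub_disjoint_iff[of v x u] um disjoint_arrows_sym[OF _ monos_into_hom uh] by (auto simp: V_def)
  have src: "A w c ` sec (src (farr M w)) c = img w c" if "w \<in> insert u V" for w c
    using M_src[OF monos_into_hom, of w x] Vm(1) um that unfolding img_def by auto
  \<comment> \<open>Members of the cover on which \<open>a\<close> lies in \<open>u\<close> go to
    \<open>T1\<close>; each of the others is assigned one subobject disjoint from
    \<open>u\<close>.\<close>
  define T1 where "T1 = {c \<in> T. R x top_class.top c a \<in> img u c}"
  define T2 where "T2 = T - T1"
  have "\<forall>c\<in>T2. \<exists>w. w \<in> V \<and> R x top_class.top c a \<in> img w c"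
    using loc src unfolding T1_def T2_def by blast
  then obtain w where w: "\<And>c. c \<in> T2 \<Longrightarrow> w c \<in> V" "\<And>c. c \<in> T2 \<Longrightarrow> R x top_class.top c a \<in> img (w c) c"
    by metis
  have Tless: "|T| <o \<kappa>" using T unfolding is_cover_def by simp
  have less: "|T1| <o \<kappa>" "|T2| <o \<kappa>"
    using ordLeq_ordLess_trans[OF card_of_mono1 Tless] unfolding T1_def T2_def by auto
  then have wless: "|w ` T2| <o \<kappa>" using ordLeq_ordLess_trans[OF card_of_image] by blast
  have "w ` T2 \<subseteq> monos_into C x" using w(1) Vm(1) by blast
  then obtain v where v: "is_union C x (w ` T2) v" using union_ex[OF x _ wless] by blast
  note vm = is_unionD(2)[OF v]
  note vh = monos_into_hom[OF vm]
  have dv: "disjoint_arrows C u v"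
    by (rule disjoint_union[OF v wless uh]) (use w(1) Vm(2) in auto)
  obtain \<beta> where \<beta>: "is_cover \<kappa> \<beta> T1" using is_cover_of_ex[OF base less(1)] by blast
  have im1: "R x top_class.top \<beta> a \<in> img u \<beta>"
  proof (rule img_glue[OF um \<beta> ra])
    fix c assume "c \<in> T1"
    then show "R x \<beta> c (R x top_class.top \<beta> a) \<in> img u c"
      using rr[OF is_cover_le[OF \<beta>]] by (simp add: T1_def)
  qed
  have im2: "R x top_class.top c a \<in> img v c" if "c \<in> T2" for c
    using img_sub_le[OF is_unionD(3)[OF v imageI[OF that]] monos_into_hom[OF Vm(1)[OF w(1)[OF that]]] vh w(2)[OF that]] .
  \<comment> \<open>Members of \<open>T2\<close> are disjoint from those of \<open>T1\<close>
    because \<open>a\<close> cannot lie in both \<open>u\<close> and \<open>v\<close> over a common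
    nonzero part; hence they lie below \<open>- \<beta>\<close>. They exhaust
    \<open>- \<beta>\<close> because \<open>T1\<close> and \<open>T2\<close> together cover
    \<open>top\<close>.\<close>
  have cover2: "is_cover \<kappa> (- \<beta>) T2"
    unfolding is_cover_def
  proof (intro conjI ballI allI impI less)
    fix c assume c: "c \<in> T2"
    have "t \<le> - c" if t: "t \<in> T1" for t
    proof -
      have "R x top_class.top t a \<in> img u t" using t by (simp add: T1_def)
      then have "R x top_class.top (inf t c) a \<in> img u (inf t c)"
        using img_res[OF uh _ inf_le1[of t c]] rr[OF inf_le1[of t c]] by metis
      moreover have "R x top_class.top (inf t c) a \<in> img v (inf t c)"
        using img_res[OF vh im2[OF c] inf_le2[of t c]] rr[OF inf_le2[of t c]] by simp
      ultimately have "inf t c = bot" by (rule img_disjoint[OF dv uh vh])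
      then show ?thesis by (simp add: inf_shunt)
    qed
    then have "\<beta> \<le> - c" using \<beta> unfolding is_cover_def by blast
    then show "c \<le> - \<beta>" by (simp add: compl_le_swap1)
  next
    fix d assume d: "\<forall>s\<in>T2. s \<le> d"
    have "t \<le> sup \<beta> d" if "t \<in> T" for t
      using that d is_cover_le[OF \<beta>, of t] le_supI1[of t \<beta> d] le_supI2[of t d \<beta>] unfolding T2_def by blast
    then have "top_class.top \<le> sup \<beta> d" using T unfolding is_cover_def by blast
    then have "sup \<beta> d = top_class.top" by (simp add: top_unique)
    then show "- \<beta> \<le> d" by (simp add: sup_shunt)
  qed
  have "R x top_class.top (- \<beta>) a \<in> img v (- \<beta>)"
  proof (rule img_glue[OF vm cover2 ra])
    fix c assume "c \<in> T2"
    then show "R x (- \<beta>) c (R x top_class.top (- \<beta>) a) \<in> img v c"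
      using rr[OF is_cover_le[OF cover2]] im2 by simp
  qed
  then show thesis using that[of v \<beta>] dv im1 x a vm by (simp add: elem_def)
qed

text \<open>With complements \<open>w\<^sub>1\<close>, \<open>w\<^sub>2\<close> of \<open>m\<^sub>1\<close>, \<open>m\<^sub>2\<close> at \<open>a\<close>, the section \<open>a\<close> lies in
  \<open>(m\<^sub>1 \<inter> m\<^sub>2) \<union> (w\<^sub>1 \<inter> w\<^sub>2)\<close>, and on that subobject \<open>m\<^sub>1\<close> and \<open>m\<^sub>2\<close> agree.\<close>

lemma related_same_stage:
  assumes spc: "strongly_positively_closed C D M"
    and m: "elem z c m\<^sub>1" "elem z c m\<^sub>2" and eq: "supp z c m\<^sub>1 = supp z c m\<^sub>2"
  shows "related (=) z c m\<^sub>1 z c m\<^sub>2"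
proof -
  obtain \<beta> w1 where w1: "elem z c w1" "disjoint_arrows C m\<^sub>1 w1"
    "R z top_class.top \<beta> c \<in> img m\<^sub>1 \<beta>" "R z top_class.top (- \<beta>) c \<in> img w1 (- \<beta>)"
    using strongly_positively_closed_decomposition[OF spc m(1)] by metis
  obtain \<beta>' w2 where w2: "elem z c w2" "disjoint_arrows C m\<^sub>2 w2"
    "R z top_class.top \<beta>' c \<in> img m\<^sub>2 \<beta>'" "R z top_class.top (- \<beta>') c \<in> img w2 (- \<beta>')"
    using strongly_positively_closed_decomposition[OF spc m(2)] by metis
  have "{b. b \<le> \<beta>} = {b. b \<le> \<beta>'}"
    using supp_complement[OF m(1) w1] supp_complement[OF m(2) w2] eq by simp
  then have \<beta>: "\<beta>' = \<beta>" by (metis (mono_tags) antisym mem_Collect_eq order_refl)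
  have z: "z \<in> Obj C" and c: "c \<in> S z top_class.top" and mm: "m\<^sub>1 \<in> monos_into C z" "m\<^sub>2 \<in> monos_into C z"
    and wm: "w1 \<in> monos_into C z" "w2 \<in> monos_into C z" using m w1(1) w2(1) by (auto simp: elem_def)
  obtain i where i: "i \<in> monos_into C z"
    "\<And>t f. f \<in> hom C t z \<Longrightarrow> sub_le C f i \<longleftrightarrow> sub_le C f m\<^sub>1 \<and> sub_le C f m\<^sub>2"
    "\<And>b s. s \<in> img i b \<longleftrightarrow> s \<in> img m\<^sub>1 b \<and> s \<in> img m\<^sub>2 b"
    by (rule inter_img_ex[OF mm]) (rule that)
  obtain j where j: "j \<in> monos_into C z"
    "\<And>t f. f \<in> hom C t z \<Longrightarrow> sub_le C f j \<longleftrightarrow> sub_le C f w1 \<and> sub_le C f w2"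
    "\<And>b s. s \<in> img j b \<longleftrightarrow> s \<in> img w1 b \<and> s \<in> img w2 b"
    by (rule inter_img_ex[OF wm]) (rule that)
  have "{i, j} \<subseteq> monos_into C z" using i(1) j(1) by simp
  then obtain k where k: "is_union C z {i, j} k"
    using union_ex[OF z] finite_less[of "{i, j}"] by blast
  note km = is_unionD(2)[OF k]
  note kh = monos_into_hom[OF km] and ih = monos_into_hom[OF i(1)] and jh = monos_into_hom[OF j(1)]
  have ij: "sub_le C i k" "sub_le C j k" using is_unionD(3)[OF k] by auto
  \<comment> \<open>Over \<open>\<beta>\<close> the section lies in \<open>i\<close>, over
    \<open>- \<beta>\<close> in \<open>j\<close>, and being in \<open>k\<close> is local; thus the
    domain of \<open>k\<close> is itself a stage from which \<open>c\<close> comes.\<close>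
  have "c \<in> img k top_class.top"
  proof (rule img_glue[OF km is_cover_compl c])
    fix b assume "b \<in> {\<beta>, - \<beta>}"
    then show "R z top_class.top b c \<in> img k b"
      using img_sub_le[OF ij(1) ih kh] img_sub_le[OF ij(2) jh kh] i(3) j(3) w1(3,4) w2(3,4) \<beta> by blast
  qed
  then obtain r where r: "r \<in> S (Dom C k) top_class.top" "A k top_class.top r = c"
    using img_iff[OF kh] by auto
  have "sub_le C j w1" "sub_le C j w2" using j(2)[OF jh] sub_le_refl[OF jh] by auto
  then have dj: "disjoint_arrows C m\<^sub>1 j" "disjoint_arrows C m\<^sub>2 j"
    using disjoint_arrows_sub_le w1(2) w2(2) monos_into_hom[OF wm(1)] monos_into_hom[OF wm(2)] by blast+
  show ?thesis
  proof (rule relatedI[OF kh kh r(1) r(2) r(2)])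
    fix t p assume p: "p \<in> hom C t (Dom C k)"
    note kp = comp_in[OF kh p] and le = sub_le_self_comp[OF kh p]
    \<comment> \<open>An element of \<open>k\<close> belonging to \<open>m\<^sub>1\<close> avoids
      \<open>j\<close>, so it belongs to \<open>i\<close> and hence to \<open>m\<^sub>2\<close>; the
      converse is symmetric.\<close>
    show "sub_le C (k \<cdot> p) m\<^sub>1 = sub_le C (k \<cdot> p) m\<^sub>2"
      using union_disjoint_factor[OF k kp le monos_into_hom[OF mm(1)] _ dj(1)]
        union_disjoint_factor[OF k kp le monos_into_hom[OF mm(2)] _ dj(2)] i(2)[OF kp] by blast
  qed
qed

lemma common_stage:
  assumes u: "elem x a u" and v: "elem y b v"
  obtains z c n n' where "elem z c n" "elem z c n'" "related (=) x a u z c n" "related (=) y b v z c n'"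
proof -
  have x: "x \<in> Obj C" "a \<in> S x top_class.top" "u \<in> monos_into C x"
    and y: "y \<in> Obj C" "b \<in> S y top_class.top" "v \<in> monos_into C y" using u v by (auto simp: elem_def)
  obtain z f g c where z: "f \<in> hom C z x" "g \<in> hom C z y" "c \<in> S z top_class.top"
    "A f top_class.top c = a" "A g top_class.top c = b" using product_ex[OF x(1) y(1) x(2) y(2)] by metis
  obtain n where n: "n \<in> monos_into C z" "\<And>t p. p \<in> hom C t z \<Longrightarrow> sub_le C p n \<longleftrightarrow> sub_le C (f \<cdot> p) u"
    using stage_pullback_ex[OF z(1) x(3)] by metis
  obtain n' where n': "n' \<in> monos_into C z" "\<And>t p. p \<in> hom C t z \<Longrightarrow> sub_le C p n' \<longleftrightarrow> sub_le C (g \<cdot> p) v"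
    using stage_pullback_ex[OF z(2) y(3)] by metis
  have "related (=) x a u z c n" by (rule related_stage[OF z(1,3,4) n(2)])
  moreover have "related (=) y b v z c n'" by (rule related_stage[OF z(2,3,5) n'(2)])
  moreover have "elem z c n" "elem z c n'" using n(1) n'(1) z(3) hom_obj[OF z(1)] by (auto simp: elem_def)
  ultimately show thesis using that by blast
qed

text \<open>Inclusion is reduced to equality: at a common stage \<open>n\<close> and its
  intersection with \<open>n'\<close> have the same support, so they have the same class, and the
  intersection lies below \<open>n'\<close>.\<close>

lemma related_le_of_supp:
  assumes spc: "strongly_positively_closed C D M" and u: "elem x a u" and v: "elem y b v"
    and le: "supp x a u \<subseteq> supp y b v"
  shows "related (\<longrightarrow>) x a u y b v"
proof -
  obtain z c n n' where e: "elem z c n" "elem z c n'"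
    and r: "related (=) x a u z c n" "related (=) y b v z c n'"
    by (rule common_stage[OF u v]) (rule that)
  have n: "n \<in> monos_into C z" "n' \<in> monos_into C z" and z: "z \<in> Obj C" "c \<in> S z top_class.top"
    using e by (auto simp: elem_def)
  obtain i where i: "i \<in> monos_into C z"
    "\<And>t f. f \<in> hom C t z \<Longrightarrow> sub_le C f i \<longleftrightarrow> sub_le C f n \<and> sub_le C f n'"
    "\<And>b s. s \<in> img i b \<longleftrightarrow> s \<in> img n b \<and> s \<in> img n' b"
    by (rule inter_img_ex[OF n]) (rule that)
  have ei: "elem z c i" using i(1) z by (simp add: elem_def)
  have "supp z c i = supp z c n \<inter> supp z c n'" using i(3) by (auto simp: supp_def)
  then have "supp z c n = supp z c i"
    using le related_eq_supp[OF u e(1) r(1)] related_eq_supp[OF v e(2) r(2)] by auto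
  then have "related (=) z c n z c i" by (rule related_same_stage[OF spc e(1) ei])
  then have 1: "related (\<longrightarrow>) z c n z c i" by (rule related_mono) simp
  have 2: "related (\<longrightarrow>) z c i z c n'"
    by (rule relatedI[OF Ident_in[OF z(1)] Ident_in[OF z(1)] z(2) act_Ident[OF z] act_Ident[OF z]])
      (use i(2) Ident_Comp in auto)
  have 3: "related (\<longrightarrow>) z c n' y b v" by (rule related_mono[OF related_sym[OF r(2)]]) simp
  have 4: "related (\<longrightarrow>) x a u z c n" by (rule related_mono[OF r(1)]) simp
  have 5: "related (\<longrightarrow>) x a u z c i" by (rule related_trans[OF _ 4 1]) simp
  have 6: "related (\<longrightarrow>) x a u z c n'" by (rule related_trans[OF _ 5 2]) simp
  show ?thesis by (rule related_trans[OF _ 6 3]) simp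
qed

lemma related_eq_of_supp:
  assumes spc: "strongly_positively_closed C D M" and u: "elem x a u" and v: "elem y b v"
    and eq: "supp x a u = supp y b v"
  shows "related (=) x a u y b v"
proof -
  obtain z c n n' where e: "elem z c n" "elem z c n'"
    and r: "related (=) x a u z c n" "related (=) y b v z c n'"
    by (rule common_stage[OF u v]) (rule that)
  have "supp z c n = supp z c n'"
    using eq related_eq_supp[OF u e(1) r(1)] related_eq_supp[OF v e(2) r(2)] by simp
  then have 1: "related (=) z c n z c n'" by (rule related_same_stage[OF spc e])
  have 2: "related (=) x a u z c n'" by (rule related_trans[OF _ r(1) 1]) simp
  show ?thesis by (rule related_trans[OF _ 2 related_sym[OF r(2)]]) simp
qed

text \<open>The object \<open>c\<close> is x + 1 and \<open>w\<close> is terminal, so that a section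
  over \<open>- b\<close> is available in the second summand; it is glued with \<open>s\<close>. The
  two summands then separate \<open>b\<close> from \<open>- b\<close>, which for terminal
  \<open>x\<close> yields a subobject whose support is the principal ideal of
  \<open>b\<close>.\<close>

lemma global_section_coproduct:
  assumes cop: "has_small_disjoint_coproducts \<kappa> C" and x: "x \<in> Obj C" and s: "s \<in> S x b"
  obtains w c i j a where "i \<in> monos_into C c" "j \<in> monos_into C c" "i \<in> hom C x c" "j \<in> hom C w c"
    "disjoint_arrows C i j" "a \<in> S c top_class.top" "R c top_class.top b a = A i b s"
    "R c top_class.top (- b) a \<in> img j (- b)"
proof -
  obtain w where w: "is_terminal C w" using terminal_ex ..
  obtain e :: "nat \<Rightarrow> 'k" where e: "inj e" using Cinfinite_inj_nat[OF Cinf] .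
  define X where "X k = (if k = e 0 then x else w)" for k
  let ?I = "{e 0, e 1}"
  have X: "X (e 0) = x" "X (e 1) = w" "e 0 \<noteq> e 1" by (simp_all add: X_def inj_eq[OF e])
  have "|?I| <o \<kappa>" by (rule finite_less) simp
  moreover have "\<forall>k\<in>?I. X k \<in> Obj C" using x w unfolding is_terminal_def by (simp add: X_def)
  ultimately have "\<exists>c \<iota>. is_coproduct C ?I X c \<iota> \<and> (\<forall>i\<in>?I. is_mono C (\<iota> i)) \<and>
      (\<forall>i\<in>?I. \<forall>j\<in>?I. i \<noteq> j \<longrightarrow> (\<forall>p q. is_pullback C (\<iota> i) (\<iota> j) p q \<longrightarrow> is_initial C (Dom C p)))"
    using cop[unfolded has_small_disjoint_coproducts_def, rule_format, of ?I X] by blast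
  then obtain c \<iota> where c: "is_coproduct C ?I X c \<iota>" "\<forall>i\<in>?I. is_mono C (\<iota> i)"
    "\<forall>i\<in>?I. \<forall>j\<in>?I. i \<noteq> j \<longrightarrow> (\<forall>p q. is_pullback C (\<iota> i) (\<iota> j) p q \<longrightarrow> is_initial C (Dom C p))" by blast
  have "\<forall>k\<in>?I. \<iota> k \<in> hom C (X k) c" using c(1) unfolding is_coproduct_def by blast
  then have i: "\<iota> (e 0) \<in> hom C x c" "\<iota> (e 1) \<in> hom C w c" using X by auto
  then have m: "\<iota> (e 0) \<in> monos_into C c" "\<iota> (e 1) \<in> monos_into C c"
    using c(2) by (auto simp: monos_into_iff hom_iff)
  obtain t p q where "p \<in> hom C t x" "q \<in> hom C t w" and pb: "is_pullback C (\<iota> (e 0)) (\<iota> (e 1)) p q"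
    using pullback_ex[OF i] .
  then have "is_initial C (Dom C p)" using c(3) X(3) by blast
  then have d: "disjoint_arrows C (\<iota> (e 0)) (\<iota> (e 1))"
    by (rule disjoint_arrows_pullback[OF pb initial_empty])
  obtain s' where s': "s' \<in> S w (- b)" using act_terminal[OF w] by blast
  have "is_sheaf \<kappa> (fobj M c)" using M_sheaf hom_obj[OF i(1)] by blast
  then obtain a where "a \<in> S c top_class.top" "R c top_class.top b a = A (\<iota> (e 0)) b s"
    "R c top_class.top (- b) a = A (\<iota> (e 1)) (- b) s'"
    using sheaf_glue_compl[OF _ act_in[OF i(1) s] act_in[OF i(2) s']] by blast
  then show thesis using that[OF m i d] img_iff[OF i(2)] s' by blast
qed

lemma spc_imp_isomorphic:
  assumes spc: "strongly_positively_closed C D M" and cop: "has_small_disjoint_coproducts \<kappa> C"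
  shows "lattice_isomorphic L (order_of_type :: 'b gorder)"
proof -
  \<comment> \<open>Classes determine supports and a principal ideal determines its generator, so
    the description is unique; existence comes from the decomposition.\<close>
  define \<phi> where "\<phi> X = (THE \<beta>. \<exists>x a u. elem x a u \<and> X = L_class x a u \<and> supp x a u = {b. b \<le> \<beta>})" for X
  have Collect_le: "{b. b \<le> \<beta>} \<subseteq> {b. b \<le> \<beta>'} \<longleftrightarrow> \<beta> \<le> \<beta>'" for \<beta> \<beta>' :: 'b by (auto intro: order_trans)
  have \<phi>I: "\<phi> (L_class x a u) = \<beta>" if u: "elem x a u" and s: "supp x a u = {b. b \<le> \<beta>}" for x a u \<beta>
    unfolding \<phi>_def
  proof (rule the_equality)
    show "\<exists>x' a' u'. elem x' a' u' \<and> L_class x a u = L_class x' a' u' \<and> supp x' a' u' = {b. b \<le> \<beta>}"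
      using u s by blast
    fix \<beta>' assume "\<exists>x' a' u'. elem x' a' u' \<and> L_class x a u = L_class x' a' u' \<and> supp x' a' u' = {b. b \<le> \<beta>'}"
    then obtain x' a' u' where v: "elem x' a' u'" "L_class x a u = L_class x' a' u'" "supp x' a' u' = {b. b \<le> \<beta>'}"
      by blast
    have "{b. b \<le> \<beta>} = {b. b \<le> \<beta>'}"
      using related_eq_supp[OF u v(1)] v(2,3) L_class_eq_iff[OF u v(1)] s by simp
    then show "\<beta>' = \<beta>" using Collect_le by (metis antisym order_refl)
  qed
  have \<phi>: "supp x a u = {b. b \<le> \<phi> (L_class x a u)}" if u: "elem x a u" for x a u
  proof -
    obtain \<beta> v where "elem x a v" "disjoint_arrows C u v"
      "R x top_class.top \<beta> a \<in> img u \<beta>" "R x top_class.top (- \<beta>) a \<in> img v (- \<beta>)"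
      using strongly_positively_closed_decomposition[OF spc u] by metis
    then have "supp x a u = {b. b \<le> \<beta>}" by (rule supp_complement[OF u])
    then show ?thesis using \<phi>I[OF u] by simp
  qed
  have le: "L_class x a u \<sqsubseteq>\<^bsub>L\<^esub> L_class y b v \<longleftrightarrow> \<phi> (L_class x a u) \<le> \<phi> (L_class y b v)"
    if u: "elem x a u" and v: "elem y b v" for x a u y b v
  proof -
    have "related (\<longrightarrow>) x a u y b v \<longleftrightarrow> supp x a u \<subseteq> supp y b v"
      using related_supp[OF u v] related_le_of_supp[OF spc u v] by blast
    then show ?thesis using L_class_le_iff[OF u v] Collect_le \<phi>[OF u] \<phi>[OF v] by simp
  qed
  have "inj_on \<phi> (carrier L)"
  proof (rule inj_onI)
    fix X Y assume "X \<in> carrier L" "Y \<in> carrier L" and eq: "\<phi> X = \<phi> Y"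
    then obtain x a u y b v where X: "X = L_class x a u" "elem x a u" and Y: "Y = L_class y b v" "elem y b v"
      unfolding carrier_L by blast
    have "supp x a u = supp y b v" using \<phi>[OF X(2)] \<phi>[OF Y(2)] eq X Y by simp
    then show "X = Y" using related_eq_of_supp[OF spc X(2) Y(2)] L_class_eq_iff[OF X(2) Y(2)] X Y by simp
  qed
  moreover have "\<beta> \<in> \<phi> ` carrier L" for \<beta>
  proof -
    obtain w where w: "is_terminal C w" using terminal_ex ..
    obtain s where s: "s \<in> S w \<beta>" using act_terminal[OF w] by blast
    have "w \<in> Obj C" using w by (simp add: is_terminal_def)
    then obtain w' c i j a where i: "i \<in> monos_into C c" "j \<in> monos_into C c" "i \<in> hom C w c" "j \<in> hom C w' c"
      "disjoint_arrows C i j" "a \<in> S c top_class.top" "R c top_class.top \<beta> a = A i \<beta> s"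
      "R c top_class.top (- \<beta>) a \<in> img j (- \<beta>)"
      by (rule global_section_coproduct[OF cop _ s]) (rule that)
    have e: "elem c a i" "elem c a j" using i hom_obj[OF i(3)] by (auto simp: elem_def)
    have "R c top_class.top \<beta> a \<in> img i \<beta>" using i(7) s img_iff[OF i(3)] by blast
    then have "supp c a i = {b. b \<le> \<beta>}" by (rule supp_complement[OF e i(5) _ i(8)])
    then have "\<phi> (L_class c a i) = \<beta>" by (rule \<phi>I[OF e(1)])
    moreover have "L_class c a i \<in> carrier L" using e(1) unfolding carrier_L by blast
    ultimately show ?thesis by blast
  qed
  ultimately have bij: "bij_betw \<phi> (carrier L) UNIV" unfolding bij_betw_def by blast
  have "\<forall>X\<in>carrier L. \<forall>Y\<in>carrier L. X \<sqsubseteq>\<^bsub>L\<^esub> Y \<longleftrightarrow> \<phi> X \<le> \<phi> Y"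
    using le unfolding carrier_L by blast
  then show ?thesis unfolding lattice_isomorphic_def order_of_type_def using bij by auto
qed

subsection \<open>Complements in \<open>L\<^sup>1\<close> give strong positive closedness\<close>

text \<open>This is the covering condition for one section. A complement of \<open>u\<close> exists
  only in the colimit, so it has to be brought down to an actual stage, and the part of it lying
  over \<open>x\<close> must be pushed forward to subobjects of \<open>x\<close>.\<close>

lemma boolean_imp_locally_decomposed:
  assumes bool: "is_boolean_lattice L" and cop: "has_small_disjoint_coproducts \<kappa> C"
    and u: "u \<in> monos_into C x" and s: "s \<in> S x b"
  shows "\<exists>T. is_cover \<kappa> b T \<and>
    (\<forall>d\<in>T. \<exists>w\<in>insert u {v \<in> monos_into C x. sub_disjoint C x v u}. R x b d s \<in> img w d)"
proof -
  note uh = monos_into_hom[OF u]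
  have x: "x \<in> Obj C" using hom_obj[OF uh] by simp
  obtain w0 c i0 j0 a where i0: "i0 \<in> monos_into C c" "j0 \<in> monos_into C c" "i0 \<in> hom C x c" "j0 \<in> hom C w0 c"
    "disjoint_arrows C i0 j0" "a \<in> S c top_class.top" "R c top_class.top b a = A i0 b s"
    "R c top_class.top (- b) a \<in> img j0 (- b)"
    by (rule global_section_coproduct[OF cop x s]) (rule that)
  have i0m: "is_mono C i0" using i0(1) by (simp add: monos_into_iff)
  have c: "c \<in> Obj C" using hom_obj[OF i0(3)] by simp
  \<comment> \<open>As a subobject of x + 1, \<open>u\<close> becomes \<open>U\<close>, and its
    complement is taken at the global section \<open>a\<close> that extends
    \<open>s\<close>.\<close>
  define U where "U = i0 \<cdot> u"
  have Uh: "U \<in> hom C (Dom C u) c" unfolding U_def by (rule comp_in[OF i0(3) uh])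
  have Um: "U \<in> monos_into C c"
    using is_mono_comp[OF i0m] u Uh i0(3) unfolding U_def by (auto simp: monos_into_iff hom_iff)
  have eU: "elem c a U" using c i0(6) Um by (simp add: elem_def)
  then have "L_class c a U \<in> carrier L" unfolding carrier_L by blast
  then obtain Y where Y: "Y \<in> carrier L"
    and meet: "\<And>Z W. Z \<in> carrier L \<Longrightarrow> W \<in> carrier L \<Longrightarrow> Z \<sqsubseteq>\<^bsub>L\<^esub> L_class c a U \<Longrightarrow> Z \<sqsubseteq>\<^bsub>L\<^esub> Y \<Longrightarrow> Z \<sqsubseteq>\<^bsub>L\<^esub> W"
    and join: "\<And>Z W. Z \<in> carrier L \<Longrightarrow> W \<in> carrier L \<Longrightarrow> L_class c a U \<sqsubseteq>\<^bsub>L\<^esub> Z \<Longrightarrow> Y \<sqsubseteq>\<^bsub>L\<^esub> Z \<Longrightarrow> W \<sqsubseteq>\<^bsub>L\<^esub> Z"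
    by (rule boolean_lattice_complement[OF bool]) (rule that)
  obtain y b' v where eV: "elem y b' v" and Y_def: "Y = L_class y b' v" using Y unfolding carrier_L by blast
  have y: "y \<in> Obj C" "b' \<in> S y top_class.top" "v \<in> monos_into C y" using eV by (auto simp: elem_def)
  obtain z f g c0 where z: "f \<in> hom C z c" "g \<in> hom C z y" "c0 \<in> S z top_class.top"
    "A f top_class.top c0 = a" "A g top_class.top c0 = b'" using product_ex[OF c y(1) i0(6) y(2)] by metis
  have zo: "z \<in> Obj C" using hom_obj[OF z(1)] by simp
  obtain n where n: "n \<in> monos_into C z" "\<And>t p. p \<in> hom C t z \<Longrightarrow> sub_le C p n \<longleftrightarrow> sub_le C (f \<cdot> p) U"
    by (rule stage_pullback_ex[OF z(1) Um]) (rule that)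
  obtain n' where n': "n' \<in> monos_into C z" "\<And>t p. p \<in> hom C t z \<Longrightarrow> sub_le C p n' \<longleftrightarrow> sub_le C (g \<cdot> p) v"
    by (rule stage_pullback_ex[OF z(2) y(3)]) (rule that)
  obtain i where i: "i \<in> monos_into C z"
    "\<And>t h. h \<in> hom C t z \<Longrightarrow> sub_le C h i \<longleftrightarrow> sub_le C h n \<and> sub_le C h n'"
    by (rule inter_img_ex[OF n(1) n'(1)]) (rule that)
  obtain o' where o': "o' \<in> monos_into C z" "is_empty_obj C (Dom C o')" using empty_sub_ex[OF zo] .
  have ei: "elem z c0 i" and eo: "elem z c0 o'" using i(1) o'(1) zo z(3) by (auto simp: elem_def)
  have "related (\<longrightarrow>) z c0 i c a U"
    by (rule relatedI[OF Ident_in[OF zo] z(1,3) act_Ident[OF zo z(3)] z(4)])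
      (use i(2) n(2) Ident_Comp in auto)
  moreover have "related (\<longrightarrow>) z c0 i y b' v"
    by (rule relatedI[OF Ident_in[OF zo] z(2,3) act_Ident[OF zo z(3)] z(5)])
      (use i(2) n'(2) Ident_Comp in auto)
  moreover have "L_class z c0 i \<in> carrier L" "L_class z c0 o' \<in> carrier L" using ei eo unfolding carrier_L by blast+
  ultimately have "related (\<longrightarrow>) z c0 i z c0 o'"
    using meet[of "L_class z c0 i" "L_class z c0 o'"] L_class_le_iff[OF ei eU] L_class_le_iff[OF ei eV]
      L_class_le_iff[OF ei eo] Y_def by simp
  \<comment> \<open>The intersection of the two pullbacks is below the empty subobject only at a
    later stage \<open>z'\<close>, along arrows \<open>h\<close> and \<open>h'\<close> that may
    differ. This is harmless: if \<open>h' \<cdot> p\<close> factors through \<open>o'\<close>, the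
    domain of \<open>p\<close> is already empty.\<close>
  then obtain z' h h' c' where h: "h \<in> hom C z' z" "h' \<in> hom C z' z" "c' \<in> S z' top_class.top"
    "A h top_class.top c' = c0" "A h' top_class.top c' = c0"
    "\<And>t p. p \<in> hom C t z' \<Longrightarrow> sub_le C (h \<cdot> p) i \<longrightarrow> sub_le C (h' \<cdot> p) o'"
    by (rule relatedE) (rule that)
  have zo': "z' \<in> Obj C" using hom_obj[OF h(1)] by simp
  \<comment> \<open>Both subobjects are transported to \<open>z'\<close> along \<open>h\<close>, the
    arrow on whose side the premise of the implication lives.\<close>
  define F where "F = f \<cdot> h"
  define G where "G = g \<cdot> h"
  have F: "F \<in> hom C z' c" "A F top_class.top c' = a" and G: "G \<in> hom C z' y" "A G top_class.top c' = b'"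
    unfolding F_def G_def using comp_in[OF z(1) h(1)] comp_in[OF z(2) h(1)]
      act_comp[OF z(1) h(1,3)] act_comp[OF z(2) h(1,3)] h(4) z(4,5) by simp_all
  obtain u' where u': "u' \<in> monos_into C z'" "\<And>t p. p \<in> hom C t z' \<Longrightarrow> sub_le C p u' \<longleftrightarrow> sub_le C (F \<cdot> p) U"
    "\<And>b s. s \<in> S z' b \<Longrightarrow> s \<in> img u' b \<longleftrightarrow> A F b s \<in> img U b"
    by (rule stage_pullback_ex[OF F(1) Um]) (rule that)
  obtain v' where v': "v' \<in> monos_into C z'" "\<And>t p. p \<in> hom C t z' \<Longrightarrow> sub_le C p v' \<longleftrightarrow> sub_le C (G \<cdot> p) v"
    by (rule stage_pullback_ex[OF G(1) y(3)]) (rule that)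
  note uh' = monos_into_hom[OF u'(1)] and vh' = monos_into_hom[OF v'(1)]
  have d: "is_empty_obj C t" if p: "p \<in> hom C t z'" and le: "sub_le C p u'" "sub_le C p v'" for t p
  proof -
    have hp: "h \<cdot> p \<in> hom C t z" and hp': "h' \<cdot> p \<in> hom C t z" using comp_in p h(1,2) by blast+
    have "sub_le C (f \<cdot> (h \<cdot> p)) U" "sub_le C (g \<cdot> (h \<cdot> p)) v"
      using le u'(2)[OF p] v'(2)[OF p] assoc[OF z(1) h(1) p] assoc[OF z(2) h(1) p] by (simp_all add: F_def G_def)
    then have "sub_le C (h \<cdot> p) i" using i(2)[OF hp] n(2)[OF hp] n'(2)[OF hp] by simp
    then have "sub_le C (h' \<cdot> p) o'" using h(6)[OF p] by simp
    then obtain l where "l \<in> hom C t (Dom C o')" using sub_le_iff[OF hp' monos_into_hom[OF o'(1)]] by blast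
    then show ?thesis by (rule empty_obj_hom[OF o'(2)])
  qed
  have "{u', v'} \<subseteq> monos_into C z'" using u'(1) v'(1) by simp
  then obtain m where m: "is_union C z' {u', v'} m"
    using union_ex[OF zo'] finite_less[of "{u', v'}"] by blast
  note mm = is_unionD(2)[OF m]
  note mh = monos_into_hom[OF mm]
  have le_m: "sub_le C p m" if "sub_le C p u' \<or> sub_le C p v'" for p
    using that is_unionD(3)[OF m] sub_le_trans[OF _ _ mh] by blast
  have em: "elem z' c' m" and eI: "elem z' c' (Ident C z')"
    using mm h(3) zo' Ident_mono[OF zo'] by (auto simp: elem_def)
  have "related (\<longrightarrow>) c a U z' c' m"
    by (rule relatedI[OF F(1) Ident_in[OF zo'] h(3) F(2) act_Ident[OF zo' h(3)]])
      (use u'(2) le_m Ident_Comp in auto)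
  moreover have "related (\<longrightarrow>) y b' v z' c' m"
    by (rule relatedI[OF G(1) Ident_in[OF zo'] h(3) G(2) act_Ident[OF zo' h(3)]])
      (use v'(2) le_m Ident_Comp in auto)
  moreover have "L_class z' c' m \<in> carrier L" "L_class z' c' (Ident C z') \<in> carrier L"
    using em eI unfolding carrier_L by blast+
  ultimately have "related (\<longrightarrow>) z' c' (Ident C z') z' c' m"
    using join[of "L_class z' c' m" "L_class z' c' (Ident C z')"] L_class_le_iff[OF eU em] L_class_le_iff[OF eV em]
      L_class_le_iff[OF eI em] Y_def by simp
  then obtain z'' k k' c'' where k: "k \<in> hom C z'' z'" "k' \<in> hom C z'' z'" "c'' \<in> S z'' top_class.top"
    "A k top_class.top c'' = c'" "A k' top_class.top c'' = c'"
    "\<And>t p. p \<in> hom C t z'' \<Longrightarrow> sub_le C (k \<cdot> p) (Ident C z') \<longrightarrow> sub_le C (k' \<cdot> p) m"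
    by (rule relatedE) (rule that)
  have "z'' \<in> Obj C" using hom_obj[OF k(1)] by simp
  \<comment> \<open>The union of the two parts is above everything in \<open>L1\<close>, which at
    one more stage says that \<open>k'\<close> factors through \<open>m\<close>; as
    \<open>c'\<close> is the image of \<open>c''\<close> under \<open>k'\<close>, it is a section of
    \<open>m\<close>.\<close>
  then have "sub_le C k' m"
    using k(6)[OF Ident_in] Comp_Ident[OF k(1)] Comp_Ident[OF k(2)] sub_le_Ident[OF k(1)] by simp
  moreover have "c' \<in> img k' top_class.top" using k(3,5) img_iff[OF k(2)] by blast
  ultimately have cm: "c' \<in> img m top_class.top" using img_sub_le[OF _ k(2) mh] by blast
  obtain T where T: "is_cover \<kappa> top_class.top T"
    "\<And>t. t \<in> T \<Longrightarrow> \<exists>w\<in>{u', v'}. R z' top_class.top t c' \<in> img w t"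
    by (rule act_union[OF m finite_less cm]) (simp, rule that)
  \<comment> \<open>Meeting the cover with \<open>b\<close> brings it back to the given section:
    over \<open>inf t b\<close> the image of \<open>c'\<close> under \<open>F\<close> is
    \<open>s\<close> seen in the summand \<open>x\<close>.\<close>
  have "\<exists>w\<in>insert u {v \<in> monos_into C x. sub_disjoint C x v u}. R x b (inf t b) s \<in> img w (inf t b)"
    if t: "t \<in> T" for t
  proof -
    let ?d = "inf t b"
    let ?s = "R x b ?d s" and ?c = "R z' top_class.top ?d c'"
    have sd: "?s \<in> S x ?d" using res_in[OF M_sheaf[OF x] s] by simp
    have cd: "?c \<in> S z' ?d" using res_in[OF M_sheaf[OF zo'] h(3)] by simp
    have "R c top_class.top ?d a = R c b ?d (R c top_class.top b a)"
      using res_res[OF M_sheaf[OF c] i0(6)] by simp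
    also have "\<dots> = A i0 ?d ?s" using i0(7) act_res[OF i0(3) s] by simp
    finally have Fc: "A F ?d ?c = A i0 ?d ?s" using act_res[OF F(1) h(3)] F(2) by simp
    have "R z' t ?d (R z' top_class.top t c') = ?c" using res_res[OF M_sheaf[OF zo'] h(3)] by simp
    then have "?c \<in> img u' ?d \<or> ?c \<in> img v' ?d"
      using T(2)[OF t] img_res[OF uh' _ inf_le1[of t b]] img_res[OF vh' _ inf_le1[of t b]] by fastforce
    then show ?thesis
    proof
      assume "?c \<in> img u' ?d"
      then have "A i0 ?d ?s \<in> img U ?d" using u'(3)[OF cd] Fc by simp
      then obtain r where r: "r \<in> S (Dom C u) ?d" "A i0 ?d ?s = A U ?d r" using img_iff[OF Uh] by blast
      then have "A i0 ?d ?s = A i0 ?d (A u ?d r)" using act_comp[OF i0(3) uh] unfolding U_def by simp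
      then have "?s = A u ?d r"
        using act_mono[OF i0(1), of ?d] sd act_in[OF uh r(1)] i0(3) by (auto simp: hom_iff dest: inj_onD)
      then show ?thesis using r(1) img_iff[OF uh] by blast
    next
      assume "?c \<in> img v' ?d"
      then obtain r where r: "r \<in> S (Dom C v') ?d" "?c = A v' ?d r" using img_iff[OF vh'] by blast
      note Fv = comp_in[OF F(1) vh']
      \<comment> \<open>The pullback cuts out the part of \<open>v'\<close> that \<open>F\<close>
        maps into the summand \<open>x\<close>; its arrow \<open>p2\<close> to \<open>x\<close> need
        not be monic, so the subobject wanted is its image \<open>v1\<close>.\<close>
      obtain w p1 p2 where p: "p1 \<in> hom C w (Dom C v')" "p2 \<in> hom C w x" "is_pullback C (F \<cdot> v') i0 p1 p2"
        using pullback_ex[OF Fv i0(3)] .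
      have "A (F \<cdot> v') ?d r = A i0 ?d ?s" using act_comp[OF F(1) vh' r(1)] r(2) Fc by simp
      then obtain r' where r': "r' \<in> S w ?d" "A p1 ?d r' = r" "A p2 ?d r' = ?s"
        by (rule act_pullback[OF p(3) Fv i0(3) p(1) r(1) sd])
      obtain v1 e where v1: "v1 \<in> monos_into C x" "e \<in> hom C w (Dom C v1)" "is_eff_epi C e" "v1 \<cdot> e = p2"
        using image_ex[OF p(2)] .
      note vh1 = monos_into_hom[OF v1(1)]
      \<comment> \<open>A common element of \<open>p2\<close> and \<open>u\<close> gives an element
        of \<open>z'\<close> lying both in \<open>u'\<close> and in \<open>v'\<close>, and
        \<open>d\<close> makes its domain empty.\<close>
      have "disjoint_arrows C p2 u" unfolding disjoint_arrows_def
      proof (intro allI ballI impI)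
        fix t q assume "q \<in> hom C t (Dom C p2)" and le: "sub_le C (p2 \<cdot> q) u"
        then have q: "q \<in> hom C t w" using p(2) by (simp add: hom_iff)
        note p1q = comp_in[OF p(1) q]
        have vp: "v' \<cdot> (p1 \<cdot> q) \<in> hom C t z'" by (rule comp_in[OF vh' p1q])
        have "F \<cdot> (v' \<cdot> (p1 \<cdot> q)) = F \<cdot> v' \<cdot> p1 \<cdot> q" using assoc[OF F(1) vh' p1q] assoc[OF Fv p(1) q] by simp
        also have "\<dots> = i0 \<cdot> (p2 \<cdot> q)" using is_pullbackD(5)[OF p(3)] assoc[OF i0(3) p(2) q] by simp
        finally have "sub_le C (F \<cdot> (v' \<cdot> (p1 \<cdot> q))) U"
          using sub_le_mono_postcomp[OF i0m i0(3) comp_in[OF p(2) q] uh] le unfolding U_def by simp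
        then have "sub_le C (v' \<cdot> (p1 \<cdot> q)) u'" using u'(2)[OF vp] by simp
        then show "is_empty_obj C t" using d[OF vp] sub_le_self_comp[OF vh' p1q] by blast
      qed
      then have "disjoint_arrows C v1 u" using disjoint_image[OF v1(3,2) vh1 uh] v1(4) by simp
      then have "sub_disjoint C x v1 u" using sub_disjoint_iff[OF v1(1) u] by simp
      moreover have "?s \<in> img v1 ?d"
        using act_comp[OF vh1 v1(2) r'(1)] v1(4) r'(3) act_in[OF v1(2) r'(1)] img_iff[OF vh1] by metis
      ultimately show ?thesis using v1(1) by blast
    qed
  qed
  then show ?thesis using is_cover_meet[OF T(1) top_greatest, of b] by blast
qed

text \<open>The family of subobjects disjoint from \<open>u\<close> may fail to be \<kappa>-small,
  so the union is verified directly in the sheaf category: a mono \<open>n\<close> containing M u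
  and all M v of the family is surjective on sections by the local decomposition, hence
  invertible.\<close>

lemma boolean_imp_spc:
  assumes bool: "is_boolean_lattice L" and cop: "has_small_disjoint_coproducts \<kappa> C"
  shows "strongly_positively_closed C D M"
  unfolding strongly_positively_closed_def
proof (intro ballI)
  fix x u assume x: "x \<in> Obj C" and u: "u \<in> monos_into C x"
  define W where "W = insert u {v \<in> monos_into C x. sub_disjoint C x v u}"
  have Wm: "w \<in> monos_into C x" if "w \<in> W" for w using that u by (auto simp: W_def)
  note F = M_sheaf[OF x]
  have "is_union D (fobj M x) (farr M ` W) (Ident D (fobj M x))"
    unfolding is_union_def
  proof (intro conjI ballI impI)
    show "farr M ` W \<subseteq> monos_into D (fobj M x)" using M_mono Wm by blast
    show "Ident D (fobj M x) \<in> monos_into D (fobj M x)" using D.Ident_mono F by simp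
    fix s assume "s \<in> farr M ` W"
    then obtain w where w: "w \<in> W" "s = farr M w" by blast
    have "s \<in> hom D (fobj M (Dom C w)) (fobj M x)" using M_hom[OF monos_into_hom[OF Wm]] w by simp
    then show "sub_le D s (Ident D (fobj M x))"
      using D.sub_le_iff[OF _ D.Ident_in] D.Ident_Comp F by simp
  next
    fix n assume n: "n \<in> monos_into D (fobj M x)" and le: "\<forall>s\<in>farr M ` W. sub_le D s n"
    have nh: "n \<in> hom D (src n) (fobj M x)" and nm: "is_mono D n"
      using monos_into_hom[OF n] n by (simp_all add: monos_into_iff)
    have inj: "inj_on (cmp n b) (sec (src n) b)" for b using nm sheaf_mono_iff[OF nh] by blast
    have img_n: "img w d \<subseteq> cmp n d ` sec (src n) d" if w: "w \<in> W" for w d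
    proof
      fix s assume "s \<in> img w d"
      have wh: "farr M w \<in> hom D (fobj M (Dom C w)) (fobj M x)" by (rule M_hom[OF monos_into_hom[OF Wm[OF w]]])
      obtain k where k: "k \<in> hom D (fobj M (Dom C w)) (src n)" "n \<cdot>\<^bsub>D\<^esub> k = farr M w"
        using le w D.sub_le_iff[OF wh nh] by blast
      obtain r where r: "r \<in> S (Dom C w) d" "s = A w d r" using \<open>s \<in> img w d\<close> by (auto simp: img_def)
      have "r \<in> sec (src k) d" using k(1) r(1) by (simp add: sheaf_hom_iff)
      then have "s = cmp n d (cmp k d r)" using cmp_comp[of r k d, where \<theta> = n and \<kappa> = \<kappa>] k(2) r(2) by simp
      then show "s \<in> cmp n d ` sec (src n) d" using cmp_in[OF k(1) r(1)] by blast
    qed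
    have surj: "s \<in> cmp n b ` sec (src n) b" if s: "s \<in> S x b" for s b
    proof -
      obtain T where T: "is_cover \<kappa> b T" "\<forall>d\<in>T. \<exists>w\<in>W. R x b d s \<in> img w d"
        using boolean_imp_locally_decomposed[OF bool cop u s] unfolding W_def by blast
      show ?thesis by (rule sheaf_glue_image[OF nh nm T(1) s]) (use T(2) img_n in blast)
    qed
    \<comment> \<open>The sectionwise inverse of \<open>n\<close>; it commutes with restriction
      because \<open>n\<close> does and has injective components.\<close>
    define k where "k = \<lparr>src = fobj M x, tgt = src n,
      cmp = (\<lambda>b. restrict (inv_into (sec (src n) b) (cmp n b)) (S x b))\<rparr>"
    have kc: "cmp k b s \<in> sec (src n) b" "cmp n b (cmp k b s) = s" if "s \<in> S x b" for b s
      using that surj[OF that] by (auto simp: k_def inv_into_into f_inv_into_f)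
    have N: "is_sheaf \<kappa> (src n)" using nh by (simp add: sheaf_hom_iff)
    have "cmp k d (R x b d s) = res (src n) b d (cmp k b s)" if "d \<le> b" "s \<in> S x b" for b d s
    proof (rule inj_onD[OF inj])
      have rs: "R x b d s \<in> S x d" using res_in[OF F that(2,1)] .
      show "cmp n d (cmp k d (R x b d s)) = cmp n d (res (src n) b d (cmp k b s))"
        using kc(2)[OF rs] cmp_res[OF nh kc(1)[OF that(2)] that(1)] kc(2)[OF that(2)] by simp
      show "cmp k d (R x b d s) \<in> sec (src n) d" by (rule kc(1)[OF rs])
      show "res (src n) b d (cmp k b s) \<in> sec (src n) d" by (rule res_in[OF N kc(1)[OF that(2)] that(1)])
    qed
    moreover have "cmp k b \<in> S x b \<rightarrow>\<^sub>E sec (src n) b" for b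
      using kc(1) by (auto simp: k_def PiE_iff extensional_def)
    ultimately have kh: "k \<in> hom D (fobj M x) (src n)"
      unfolding sheaf_hom_iff is_psh_map_def using F N by (simp add: k_def)
    have "n \<cdot>\<^bsub>D\<^esub> k = Ident D (fobj M x)"
    proof (rule psh_map_eqI)
      have nk: "n \<cdot>\<^bsub>D\<^esub> k \<in> hom D (fobj M x) (fobj M x)" and I: "Ident D (fobj M x) \<in> hom D (fobj M x) (fobj M x)"
        using D.comp_in[OF nh kh] D.Ident_in F by simp_all
      then show "is_psh_map (n \<cdot>\<^bsub>D\<^esub> k)" "is_psh_map (Ident D (fobj M x))"
        "src (n \<cdot>\<^bsub>D\<^esub> k) = src (Ident D (fobj M x))" "tgt (n \<cdot>\<^bsub>D\<^esub> k) = tgt (Ident D (fobj M x))"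
        by (simp_all add: sheaf_hom_iff)
      fix b s assume "s \<in> sec (src (n \<cdot>\<^bsub>D\<^esub> k)) b"
      then have s: "s \<in> S x b" using nk by (simp add: sheaf_hom_iff)
      then have "s \<in> sec (src k) b" by (simp add: k_def)
      then show "cmp (n \<cdot>\<^bsub>D\<^esub> k) b s = cmp (Ident D (fobj M x)) b s"
        using cmp_comp[of s k b, where \<theta> = n and \<kappa> = \<kappa>] kc(2)[OF s] cmp_Ident[OF s, where \<kappa> = \<kappa>] by simp
    qed
    then show "sub_le D (Ident D (fobj M x)) n"
      using D.sub_le_iff[OF D.Ident_in nh] F kh by auto
  qed
  then show "is_union D (fobj M x)
        (insert (farr M u) (farr M ` {v \<in> monos_into C x. sub_disjoint C x v u})) (Ident D (fobj M x))"
    unfolding W_def by simp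
qed

end

theorem theorem5p10:
  fixes \<kappa> :: "'k rel"
    and C :: "('o, 'm) cat"
    and M :: "('o, 'm, ('b::boolean_algebra, 's) psh, ('b, 's) psh_map) fctr"
  assumes "weakly_compact \<kappa>"
    and "kcoherent \<kappa> (order_cat :: ('b, 'b \<times> 'b) cat)"
    and "kcoherent \<kappa> C"
    and "has_small_disjoint_coproducts \<kappa> C"
    and "kcoherent_functor \<kappa> C (sheaf_cat \<kappa>) M"
  shows "(strongly_positively_closed C (sheaf_cat \<kappa> :: (('b, 's) psh, ('b, 's) psh_map) cat) M
        \<longleftrightarrow> is_boolean_lattice (L1 C (global_sections M)))
    \<and> (is_boolean_lattice (L1 C (global_sections M))
        \<longleftrightarrow> lattice_isomorphic (L1 C (global_sections M)) (order_of_type :: 'b gorder))"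
proof -
  interpret kcoherent_model \<kappa> C M
    using assms by unfold_locales (auto simp: weakly_compact_def)
  show ?thesis
    using spc_imp_isomorphic boolean_lattice_of_isomorphic[OF L_eq] boolean_imp_spc assms(4) by blast
qed

end
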